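(* Let $m$ be a positive integer, let $\Phi_m$ be the modular polynomial associated to cyclic isogenies of degree $m$, and let $\psi(m)=m\prod_{p\mid m}(1+p^{-1})$, the product being over the primes $p$ dividing $m$. Then $$h_\infty(\Phi_m)\leq\psi(m)\Big(6\log m+\log\psi(m)+6\log\big(12\log m+2\log\psi(m)+25.2\big)+15.7 \Big).$$
   Context: $\log$ is the natural logarithm. For a positive integer $m$, the modular polynomial $\Phi_m(X,Y)\in\mathbb{Z}[X,Y]$ is the polynomial such that $\Phi_m(X,j(z))$ is the (monic) minimal polynomial of $j(mz)$ over the field $\mathbb{C}(j(z))$, where $j$ is the modular $j$-function on the complex upper half plane, with expansion $j=\frac{1}{q}+744+196884q+\cdots$, $q=e^{2\pi i z}$. It has degree $\psi(m)$ in each variable. For a nonzero polynomial $P=\sum_{s,k}c_{s,k}X^sY^k$ with complex coefficients, $h_\infty(P)=\log\max_{s,k}\vert c_{s,k}\vert$. *)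

theory Defs
  imports
    "HOL-Complex_Analysis.Complex_Analysis"
    "HOL-Computational_Algebra.Polynomial"
    "HOL-Computational_Algebra.Primes"
    "HOL-Library.Function_Algebras"
begin

definition upper_half_plane :: "complex set" where
  "upper_half_plane = {z. Im z > 0}"

definition eisenstein_G :: "nat \<Rightarrow> complex \<Rightarrow> complex" where
  "eisenstein_G k z =
     (\<Sum>\<^sub>\<infinity>(a, b)\<in>UNIV - {(0::int, 0::int)}. 1 / (of_int a + of_int b * z) ^ k)"

text \<open>
  The elliptic modular function, normalised so that its expansion in \<open>q = exp (2 * pi * \<i> * z)\<close>
  is \<open>1 / q + 744 + 196884 * q + \<dots>\<close>. Only its values on the upper half plane matter.
\<close>
definition modular_j :: "complex \<Rightarrow> complex" where
  "modular_j z =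
     (let g2 = 60 * eisenstein_G 4 z; g3 = 140 * eisenstein_G 6 z
      in 1728 * g2 ^ 3 / (g2 ^ 3 - 27 * g3 ^ 2))"

text \<open>
  Meromorphic functions on the upper half plane are represented by functions
  \<open>complex \<Rightarrow> complex\<close>, two of which are identified when they agree on the upper half plane
  outside a set without accumulation point there; in particular the value \<open>x / 0 = 0\<close> at a
  pole is irrelevant. Polynomials over such functions use the pointwise ring structure.

  The set \<open>field_of_j\<close> contains a representative of every element of the field
  \<open>\<complex>(j(z))\<close>.
\<close>
definition field_of_j :: "(complex \<Rightarrow> complex) set" where
  "field_of_j =
     {f. \<exists>A B :: complex poly. B \<noteq> 0 \<and>
           f = (\<lambda>z. poly A (modular_j z) / poly B (modular_j z))}"

definition vanishes_at ::
    "(complex \<Rightarrow> complex) poly \<Rightarrow> (complex \<Rightarrow> complex) \<Rightarrow> bool" where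
  "vanishes_at P f \<longleftrightarrow> (\<forall>\<^sub>\<approx>z\<in>upper_half_plane. poly P f z = 0)"

definition is_minimal_polynomial ::
    "(complex \<Rightarrow> complex) set \<Rightarrow> (complex \<Rightarrow> complex) \<Rightarrow> (complex \<Rightarrow> complex) poly \<Rightarrow> bool" where
  "is_minimal_polynomial K f P \<longleftrightarrow>
     (\<forall>i. coeff P i \<in> K) \<and> lead_coeff P = 1 \<and> vanishes_at P f \<and>
     (\<forall>Q. (\<forall>i. coeff Q i \<in> K) \<and> lead_coeff Q = 1 \<and> vanishes_at Q f
            \<longrightarrow> degree P \<le> degree Q)"

text \<open>
  A polynomial \<open>\<Phi>(X, Y)\<close> is an element of \<open>\<int>[Y][X]\<close>: the coefficient of
  \<open>X ^ s * Y ^ k\<close> is \<open>coeff (coeff \<Phi> s) k\<close>.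
\<close>
definition subst_Y :: "int poly poly \<Rightarrow> (complex \<Rightarrow> complex) \<Rightarrow> (complex \<Rightarrow> complex) poly" where
  "subst_Y \<Phi> g = map_poly (\<lambda>a z. poly (map_poly of_int a) (g z)) \<Phi>"

definition is_modular_polynomial :: "nat \<Rightarrow> int poly poly \<Rightarrow> bool" where
  "is_modular_polynomial m \<Phi> \<longleftrightarrow>
     is_minimal_polynomial field_of_j (\<lambda>z. modular_j (of_nat m * z)) (subst_Y \<Phi> modular_j)"

definition h_inf :: "complex poly poly \<Rightarrow> real" where
  "h_inf P =
     ln (Max {cmod (coeff (coeff P s) k) | s k. s \<le> degree P \<and> k \<le> degree (coeff P s)})"

definition psi :: "nat \<Rightarrow> real" where
  "psi m = real m * (\<Prod>p\<in>{p. prime p \<and> p dvd m}. 1 + 1 / real p)"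

end

theory Submission
  imports Defs "HOL-Real_Asymp.Real_Asymp" "HOL-Number_Theory.Totient"
begin

text \<open>
  For a point \<open>z\<close> of the upper half plane, \<open>\<Phi>\<^sub>m(X, j(z))\<close> is the product of factors \<open>X - j(\<tau>)\<close>, where
  \<open>\<tau> = (a * z + b) / d\<close> runs through points attached to the sublattices with cyclic quotient of order \<open>m\<close>.
  There are at most \<open>\<psi>(m)\<close> of them, and the coefficients of \<open>\<Phi>\<^sub>m(X, j(z))\<close> are bounded by the product of the
  \<open>1 + \<bar>j(\<tau>)\<bar>\<close> (\<open>coeff_modular_polynomial_le\<close>).

  The reduced representative of \<open>\<tau>\<close> can have a height \<open>y\<close> of order \<open>m\<close>, and \<open>j(\<tau>)\<close> is of size
  \<open>exp (2 * pi * y)\<close>, so the factors must not be estimated one by one. Writing \<open>j\<close> as the quotient of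
  \<open>1728 * g\<^sub>2 ^ 3\<close> by the discriminant gives, for the invariant function \<open>\<phi>(\<tau>) = \<bar>\<Delta>(\<tau>)\<bar> * Im \<tau> ^ 6\<close>, a bound
  \<open>ln (1 + \<bar>j(\<tau>)\<bar>) \<le> 29 + 6 * ln y - ln \<phi>(\<tau>)\<close>. The product of the \<open>\<bar>\<Delta>(\<tau>)\<bar>\<close> is a power of \<open>\<bar>\<Delta>(z)\<bar>\<close>
  (\<open>prod_disc_cyc_points\<close>). So the terms \<open>- ln \<phi>(\<tau>)\<close> contribute on average \<open>6 * ln m - ln \<phi>(z)\<close> at most. The
  same average bounds the heights \<open>y\<close>, because \<open>- ln \<phi>(\<tau>)\<close> grows like \<open>2 * pi * y\<close>; therefore the average of
  \<open>6 * ln y\<close> is only of the size of \<open>6 * ln (ln m)\<close> (\<open>ln_one_plus_j_le\<close>, \<open>prod_lat_j_le\<close>).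

  This is applied on the line \<open>Im z = 2\<close>, where \<open>\<phi>\<close> is bounded below (\<open>disc_norm_lower\<close>). A coefficient of
  \<open>\<Phi>\<^sub>m(X, j(z))\<close> with respect to \<open>X\<close> is a polynomial in \<open>j(z)\<close>. The maximum principle for invariant functions
  carries its bound from the line to all reduced points below it, where \<open>j\<close> takes all values of modulus 1, and
  Cauchy's inequality bounds its coefficients (\<open>poly_in_j_coeff_bound\<close>).

  The facts on modular forms that are used -- the discriminant has a simple zero at the cusp and no other zero,
  holomorphic invariant functions with a pole at the cusp are polynomials in \<open>j\<close>, \<open>j\<close> is surjective, the product
  formula -- all follow from a single vanishing theorem (\<open>mform_vanishes\<close>): a form of weight \<open>k\<close> that vanishes to an
  order above \<open>k / 10\<close> at the cusp is zero. That the discriminant vanishes at the cusp at all is a relation between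
  \<open>\<zeta>(4)\<close> and \<open>\<zeta>(6)\<close>, whose values come from the product formula for the sine.
\<close>

section \<open>Zeta values from the sine product\<close>

definition zeta_nat :: "nat \<Rightarrow> real" where
  "zeta_nat s = (\<Sum>n. 1 / real (Suc n) ^ s)"

lemma summable_zeta_nat: "s \<ge> 2 \<Longrightarrow> summable (\<lambda>n. 1 / real (Suc n) ^ s)"
  using inverse_power_summable[of s, where 'a = real] summable_Suc_iff[of "\<lambda>n. inverse (real n ^ s)"]
  by (simp add: field_simps)

lemma zeta_nat_sums: "s \<ge> 2 \<Longrightarrow> (\<lambda>n. 1 / real (Suc n) ^ s) sums zeta_nat s"
  unfolding zeta_nat_def using summable_zeta_nat by (simp add: summable_sums)

lemma zeta_nat_2: "zeta_nat 2 = pi ^ 2 / 6"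
  unfolding zeta_nat_def using inverse_squares_sums by (simp add: sums_iff add.commute)

lemma zeta_nat_ge_1: "s \<ge> 2 \<Longrightarrow> zeta_nat s \<ge> 1"
  using sum_le_suminf[OF summable_zeta_nat, of s "{0}"] unfolding zeta_nat_def by simp

lemma zeta_nat_antimono: "2 \<le> s \<Longrightarrow> s \<le> t \<Longrightarrow> zeta_nat t \<le> zeta_nat s"
  unfolding zeta_nat_def
  by (intro suminf_le summable_zeta_nat) (auto intro!: divide_left_mono power_increasing)

lemma zeta_nat_2_le: "zeta_nat 2 \<le> 1.645"
proof -
  have "pi ^ 2 \<le> 3.1416 ^ 2" using pi_approx by (intro power_mono) auto
  thus ?thesis unfolding zeta_nat_2 by (simp add: power2_eq_square)
qed

lemma ln_remainder:
  fixes u :: real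
  assumes "0 \<le> u" "u \<le> 1/2"
  shows "\<bar>ln (1 - u) + u + u ^ 2 / 2 + u ^ 3 / 3\<bar> \<le> u ^ 4"
proof -
  have 1: "ln (1 - u) + u + u ^ 2 / 2 + u ^ 3 / 3 \<le> ln (1 - 0) + 0 + 0 ^ 2 / 2 + 0 ^ 3 / 3"
  proof (rule DERIV_nonpos_imp_nonincreasing[OF assms(1)])
    fix x :: real assume x: "0 \<le> x" "x \<le> u"
    have "((\<lambda>u. ln (1 - u) + u + u ^ 2 / 2 + u ^ 3 / 3) has_real_derivative (- (x ^ 3) / (1 - x))) (at x)"
      using x assms by (auto intro!: derivative_eq_intros simp: field_simps power2_eq_square power3_eq_cube)
    moreover have "- (x ^ 3) / (1 - x) \<le> 0" using x assms by (simp add: field_simps)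
    ultimately show "\<exists>y. ((\<lambda>u. ln (1 - u) + u + u ^ 2 / 2 + u ^ 3 / 3) has_real_derivative y) (at x) \<and> y \<le> 0" by blast
  qed
  have 2: "ln (1 - 0) + 0 + 0 ^ 2 / 2 + 0 ^ 3 / 3 + 0 ^ 4 \<le> ln (1 - u) + u + u ^ 2 / 2 + u ^ 3 / 3 + u ^ 4"
  proof (rule DERIV_nonneg_imp_nondecreasing[OF assms(1)])
    fix x :: real assume x: "0 \<le> x" "x \<le> u"
    have "((\<lambda>u. ln (1 - u) + u + u ^ 2 / 2 + u ^ 3 / 3 + u ^ 4) has_real_derivative (- (x ^ 3) / (1 - x) + 4 * x ^ 3)) (at x)"
      using x assms by (auto intro!: derivative_eq_intros simp: field_simps power2_eq_square power3_eq_cube)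
    moreover have "- (x ^ 3) / (1 - x) + 4 * x ^ 3 \<ge> 0"
    proof -
      have "x ^ 3 / (1 - x) \<le> x ^ 3 / (1/2)" using x assms by (intro divide_left_mono) auto
      also have "\<dots> \<le> 4 * x ^ 3" using x by simp
      finally show ?thesis by simp
    qed
    ultimately show "\<exists>y. ((\<lambda>u. ln (1 - u) + u + u ^ 2 / 2 + u ^ 3 / 3 + u ^ 4) has_real_derivative y) (at x) \<and> 0 \<le> y" by blast
  qed
  show ?thesis using 1 2 by (simp add: abs_le_iff)
qed

text \<open>
  Logarithms turn Euler's product for the sine into the sum of \<open>ln (1 - x\<^sup>2 / k\<^sup>2)\<close> over \<open>k\<close>.
  Expanding each summand in powers of \<open>x\<^sup>2 / k\<^sup>2\<close> and summing over \<open>k\<close> produces the zeta values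
  at the even integers, and the remainders of order \<open>x\<^sup>8\<close> add up as well.
\<close>

lemma ln_sinc_expansion:
  fixes x :: real
  assumes "0 < x" "x \<le> 1/2"
  shows "\<bar>ln (sin (pi * x) / (pi * x)) + zeta_nat 2 * x ^ 2 + zeta_nat 4 * x ^ 4 / 2 + zeta_nat 6 * x ^ 6 / 3\<bar>
           \<le> zeta_nat 8 * x ^ 8"
proof -
  let ?u = "\<lambda>k. x ^ 2 / real (Suc k) ^ 2"
  have x2: "x ^ 2 \<le> 1/4" using power_mono[of x "1/2" 2] assms by (simp add: power2_eq_square)
  have u: "0 \<le> ?u k" "?u k \<le> 1/2" for k
  proof -
    have "?u k \<le> x ^ 2 / 1" by (intro divide_left_mono) auto
    thus "?u k \<le> 1/2" using x2 by linarith
  qed auto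
  have pow: "?u k ^ j = x ^ (2 * j) * (1 / real (Suc k) ^ (2 * j))" for k j
    by (simp add: power_divide power_mult)
  have "(\<lambda>n. \<Prod>k=1..n. 1 - x^2 / of_nat k^2) \<longlonglongrightarrow> sin (pi * x) / (pi * x)"
    using assms by (intro sin_product_formula_real') auto
  also have "(\<lambda>n. \<Prod>k=1..n. 1 - x^2 / of_nat k^2) = (\<lambda>n. \<Prod>k<n. 1 - ?u k)"
    by (intro ext prod.reindex_bij_witness[of _ Suc "\<lambda>k. k - 1"]) auto
  finally have "(\<lambda>n. ln (\<Prod>k<n. 1 - ?u k)) \<longlonglongrightarrow> ln (sin (pi * x) / (pi * x))"
  proof (rule tendsto_ln)
    have "sin (pi * x) > 0" using assms by (intro sin_gt_zero) (auto simp: field_simps)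
    thus "sin (pi * x) / (pi * x) \<noteq> 0" using assms by auto
  qed
  also have "(\<lambda>n. ln (\<Prod>k<n. 1 - ?u k)) = (\<lambda>n. \<Sum>k<n. ln (1 - ?u k))"
  proof (intro ext ln_prod)
    show "1 - ?u k \<noteq> 0" for k using u(2)[of k] by linarith
  qed auto
  finally have s: "(\<lambda>k. ln (1 - ?u k)) sums ln (sin (pi * x) / (pi * x))" by (simp add: sums_def)
  have z: "(\<lambda>k. ?u k ^ j) sums (x ^ (2 * j) * zeta_nat (2 * j))" if "j \<ge> 1" for j
    unfolding pow by (intro sums_mult zeta_nat_sums) (use that in auto)
  have t: "(\<lambda>k. ln (1 - ?u k) + ?u k ^ 1 + ?u k ^ 2 / 2 + ?u k ^ 3 / 3) sums
     (ln (sin (pi * x) / (pi * x)) + x ^ (2 * 1) * zeta_nat (2 * 1) + (x ^ (2 * 2) * zeta_nat (2 * 2)) / 2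
        + (x ^ (2 * 3) * zeta_nat (2 * 3)) / 3)"
    by (intro sums_add sums_divide s z) auto
  have "\<bar>ln (1 - ?u k) + ?u k ^ 1 + ?u k ^ 2 / 2 + ?u k ^ 3 / 3\<bar> \<le> ?u k ^ 4" for k
    using ln_remainder[OF u] by simp
  then have "norm (\<Sum>k. ln (1 - ?u k) + ?u k ^ 1 + ?u k ^ 2 / 2 + ?u k ^ 3 / 3) \<le> (\<Sum>k. ?u k ^ 4)"
    by (intro norm_suminf_le sums_summable[OF z]) (auto simp del: power_one_right)
  also have "\<dots> = x ^ 8 * zeta_nat 8" using z[of 4] by (simp add: sums_iff)
  also have "(\<Sum>k. ln (1 - ?u k) + ?u k ^ 1 + ?u k ^ 2 / 2 + ?u k ^ 3 / 3) =
      (ln (sin (pi * x) / (pi * x)) + x ^ (2 * 1) * zeta_nat (2 * 1) + (x ^ (2 * 2) * zeta_nat (2 * 2)) / 2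
        + (x ^ (2 * 3) * zeta_nat (2 * 3)) / 3)" using t by (simp add: sums_iff)
  finally show ?thesis by (simp add: mult.commute)
qed

text \<open>
  The coefficient of \<open>x ^ 4\<close> in \<open>ln (sin (pi * x) / (pi * x))\<close> is computed twice: from the expansion
  above, and from the Taylor series of the sine.
\<close>

lemma zeta_nat_4: "zeta_nat 4 = pi ^ 4 / 90"
proof -
  define f where "f = (\<lambda>x. (ln (sin (pi * x) / (pi * x)) + pi ^ 2 / 6 * x ^ 2) / x ^ 4)"
  \<comment> \<open>In the variable \<open>y = pi * x\<close> all coefficients are rational.\<close>
  have g: "((\<lambda>y::real. (ln (sin y / y) + y ^ 2 / 6) / y ^ 4) \<longlongrightarrow> - (1 / 180)) (at_right 0)" by real_asymp
  have "filterlim (\<lambda>x::real. pi * x) (at_right 0) (at_right 0)" by real_asymp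
  from tendsto_mult_left[OF filterlim_compose[OF g this], of "pi ^ 4"]
  have "((\<lambda>x. pi ^ 4 * ((\<lambda>y. (ln (sin y / y) + y ^ 2 / 6) / y ^ 4) (pi * x))) \<longlongrightarrow> - (pi ^ 4 / 180)) (at_right 0)" by simp
  also have "(\<lambda>x. pi ^ 4 * ((\<lambda>y. (ln (sin y / y) + y ^ 2 / 6) / y ^ 4) (pi * x))) = f"
    by (rule ext) (simp add: f_def power_mult_distrib)
  finally have "(f \<longlongrightarrow> - (pi ^ 4 / 180)) (at_right 0)" .
  moreover have "(f \<longlongrightarrow> - (zeta_nat 4 / 2)) (at_right 0)"
  proof (rule Lim_transform2)
    show "((\<lambda>x. - (zeta_nat 4 / 2) - zeta_nat 6 * x ^ 2 / 3) \<longlongrightarrow> - (zeta_nat 4 / 2)) (at_right 0)"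
      by real_asymp
    have "((\<lambda>x. zeta_nat 8 * x ^ 4) \<longlongrightarrow> 0) (at_right 0)" by real_asymp
    moreover have "\<forall>\<^sub>F x in at_right 0. norm ((- (zeta_nat 4 / 2) - zeta_nat 6 * x ^ 2 / 3) - f x) \<le> zeta_nat 8 * x ^ 4"
      unfolding eventually_at_right_field
    proof (intro exI[of _ "1/2"] conjI allI impI)
      fix x :: real assume x: "0 < x" "x < 1/2"
      have "(- (zeta_nat 4 / 2) - zeta_nat 6 * x ^ 2 / 3) - f x = - (ln (sin (pi * x) / (pi * x)) + zeta_nat 2 * x ^ 2 + zeta_nat 4 * x ^ 4 / 2 + zeta_nat 6 * x ^ 6 / 3) / x ^ 4"
        unfolding f_def zeta_nat_2 using x by (simp add: field_simps flip: power_add)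
      also have "norm \<dots> \<le> zeta_nat 8 * x ^ 8 / x ^ 4"
        using ln_sinc_expansion[of x] x by (simp add: abs_divide divide_right_mono)
      also have "\<dots> = zeta_nat 8 * x ^ 4" using x by (simp add: field_simps flip: power_add)
      finally show "norm ((- (zeta_nat 4 / 2) - zeta_nat 6 * x ^ 2 / 3) - f x) \<le> zeta_nat 8 * x ^ 4" .
    qed auto
    ultimately show "((\<lambda>x. (- (zeta_nat 4 / 2) - zeta_nat 6 * x ^ 2 / 3) - f x) \<longlongrightarrow> 0) (at_right 0)"
      by (rule Lim_null_comparison[rotated])
  qed
  ultimately have "- (pi ^ 4 / 180) = - (zeta_nat 4 / 2)" using tendsto_unique trivial_limit_at_right_real by blast
  thus ?thesis by simp
qed

lemma zeta_nat_6: "zeta_nat 6 = pi ^ 6 / 945"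
proof -
  define f where "f = (\<lambda>x. (ln (sin (pi * x) / (pi * x)) + pi ^ 2 / 6 * x ^ 2 + pi ^ 4 / 180 * x ^ 4) / x ^ 6)"
  have g: "((\<lambda>y::real. (ln (sin y / y) + y ^ 2 / 6 + y ^ 4 / 180) / y ^ 6) \<longlongrightarrow> - (1 / 2835)) (at_right 0)" by real_asymp
  have "filterlim (\<lambda>x::real. pi * x) (at_right 0) (at_right 0)" by real_asymp
  from tendsto_mult_left[OF filterlim_compose[OF g this], of "pi ^ 6"]
  have "((\<lambda>x. pi ^ 6 * ((\<lambda>y. (ln (sin y / y) + y ^ 2 / 6 + y ^ 4 / 180) / y ^ 6) (pi * x))) \<longlongrightarrow> - (pi ^ 6 / 2835)) (at_right 0)" by simp
  also have "(\<lambda>x. pi ^ 6 * ((\<lambda>y. (ln (sin y / y) + y ^ 2 / 6 + y ^ 4 / 180) / y ^ 6) (pi * x))) = f"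
    by (rule ext) (simp add: f_def power_mult_distrib)
  finally have "(f \<longlongrightarrow> - (pi ^ 6 / 2835)) (at_right 0)" .
  moreover have "(f \<longlongrightarrow> - (zeta_nat 6 / 3)) (at_right 0)"
  proof (rule Lim_transform2)
    show "((\<lambda>x. - (zeta_nat 6 / 3)) \<longlongrightarrow> - (zeta_nat 6 / 3)) (at_right 0)" by simp
    have "((\<lambda>x. zeta_nat 8 * x ^ 2) \<longlongrightarrow> 0) (at_right 0)" by real_asymp
    moreover have "\<forall>\<^sub>F x in at_right 0. norm (- (zeta_nat 6 / 3) - f x) \<le> zeta_nat 8 * x ^ 2"
      unfolding eventually_at_right_field
    proof (intro exI[of _ "1/2"] conjI allI impI)
      fix x :: real assume x: "0 < x" "x < 1/2"
      have "(- (zeta_nat 6 / 3)) - f x = - (ln (sin (pi * x) / (pi * x)) + zeta_nat 2 * x ^ 2 + zeta_nat 4 * x ^ 4 / 2 + zeta_nat 6 * x ^ 6 / 3) / x ^ 6"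
        unfolding f_def zeta_nat_2 zeta_nat_4 using x by (simp add: field_simps flip: power_add)
      also have "norm \<dots> \<le> zeta_nat 8 * x ^ 8 / x ^ 6"
        using ln_sinc_expansion[of x] x by (simp add: abs_divide divide_right_mono)
      also have "\<dots> = zeta_nat 8 * x ^ 2" using x by (simp add: field_simps flip: power_add)
      finally show "norm (- (zeta_nat 6 / 3) - f x) \<le> zeta_nat 8 * x ^ 2" .
    qed auto
    ultimately show "((\<lambda>x. - (zeta_nat 6 / 3) - f x) \<longlongrightarrow> 0) (at_right 0)"
      by (rule Lim_null_comparison[rotated])
  qed
  ultimately have "- (pi ^ 6 / 2835) = - (zeta_nat 6 / 3)" using tendsto_unique trivial_limit_at_right_real by blast
  thus ?thesis by simp
qed

section \<open>Lattice sums and Eisenstein series\<close>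

text \<open>
  A pair \<open>(a, b)\<close> stands for the lattice point \<open>a + b * z\<close>, so that \<open>L = UNIV\<close> gives the Eisenstein
  series and a subgroup \<open>L\<close> gives the Eisenstein series of a sublattice. Keeping \<open>L\<close> as a parameter
  shows how the modular group permutes sublattices of given index.
\<close>

definition lat_sum :: "nat \<Rightarrow> (int \<times> int) set \<Rightarrow> complex \<Rightarrow> complex" where
  "lat_sum k L z = (\<Sum>\<^sub>\<infinity>(a, b)\<in>L - {(0, 0)}. 1 / (of_int a + of_int b * z) ^ k)"

definition mapT :: "int \<times> int \<Rightarrow> int \<times> int" where "mapT = (\<lambda>(a, b). (a + b, b))"
definition mapS :: "int \<times> int \<Rightarrow> int \<times> int" where "mapS = (\<lambda>(a, b). (- b, a))"

lemma eisenstein_G_eq_lat_sum: "eisenstein_G k z = lat_sum k UNIV z"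
  by (simp add: eisenstein_G_def lat_sum_def)

lemma inj_mapT: "inj mapT" and inj_mapS: "inj mapS"
  by (auto simp: inj_def mapT_def mapS_def)

text \<open>
  The generators \<open>z \<mapsto> z + 1\<close> and \<open>z \<mapsto> - (1 / z)\<close> of the modular group only rename the points of the
  lattice (up to the scaling by \<open>z\<close> for the second), so they act on the index set \<open>L\<close>.
\<close>

lemma lat_sum_plus1: "lat_sum k L (z + 1) = lat_sum k (mapT ` L) z"
proof -
  have "mapT ` L - {(0,0)} = mapT ` (L - {(0,0)})"
    using inj_mapT by (auto simp: mapT_def)
  moreover have "inj_on mapT (L - {(0,0)})" using inj_mapT by (rule inj_on_subset) auto
  ultimately have "lat_sum k (mapT ` L) z = infsum ((\<lambda>(a, b). 1 / (of_int a + of_int b * z) ^ k) \<circ> mapT) (L - {(0,0)})"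
    unfolding lat_sum_def by (simp add: infsum_reindex)
  also have "\<dots> = lat_sum k L (z + 1)"
    unfolding lat_sum_def by (intro infsum_cong) (auto simp: mapT_def algebra_simps)
  finally show ?thesis by simp
qed

lemma lat_sum_inversion:
  assumes "z \<noteq> 0"
  shows "lat_sum k L (- (1 / z)) = z ^ k * lat_sum k (mapS ` L) z"
proof -
  have "mapS ` L - {(0,0)} = mapS ` (L - {(0,0)})"
    using inj_mapS by (auto simp: mapS_def)
  moreover have "inj_on mapS (L - {(0,0)})" using inj_mapS by (rule inj_on_subset) auto
  ultimately have "z ^ k * lat_sum k (mapS ` L) z = z ^ k * infsum ((\<lambda>(a, b). 1 / (of_int a + of_int b * z) ^ k) \<circ> mapS) (L - {(0,0)})"
    unfolding lat_sum_def by (simp add: infsum_reindex)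
  also have "\<dots> = lat_sum k L (- (1 / z))"
    unfolding lat_sum_def
  proof (subst infsum_cmult_right'[symmetric], intro infsum_cong)
    fix p :: "int \<times> int"
    obtain a b where p: "p = (a, b)" by force
    have "of_int a + of_int b * (- (1 / z)) = (of_int (- b) + of_int a * z) / z"
      using assms by (simp add: field_simps)
    thus "z ^ k * ((\<lambda>(a, b). 1 / (of_int a + of_int b * z) ^ k) \<circ> mapS) p =
       (case p of (a, b) \<Rightarrow> 1 / (of_int a + of_int b * - (1 / z)) ^ k)"
      by (simp add: p mapS_def power_divide)
  qed
  finally show ?thesis by simp
qed

lemma mapT_UNIV: "mapT ` UNIV = UNIV"
proof -
  have "p = mapT (fst p - snd p, snd p)" for p by (simp add: mapT_def)
  thus ?thesis by blast
qed

lemma mapS_UNIV: "mapS ` UNIV = UNIV"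
proof -
  have "p = mapS (snd p, - fst p)" for p by (simp add: mapS_def)
  thus ?thesis by blast
qed

lemma eisenstein_G_plus1: "eisenstein_G k (z + 1) = eisenstein_G k z"
  by (simp add: eisenstein_G_eq_lat_sum lat_sum_plus1 mapT_UNIV)

lemma eisenstein_G_inversion:
  "z \<noteq> 0 \<Longrightarrow> eisenstein_G k (- (1 / z)) = z ^ k * eisenstein_G k z"
  by (simp add: eisenstein_G_eq_lat_sum lat_sum_inversion mapS_UNIV)

text \<open>
  Up to a constant, a lower bound for \<open>\<bar>a + b * z\<bar>\<^sup>2\<close>. It is a product of a function of \<open>a\<close> and a
  function of \<open>b\<close> off the axes, so the sums of its inverse powers are explicit in zeta values.
\<close>

definition lat_weight :: "int \<times> int \<Rightarrow> real" where
  "lat_weight = (\<lambda>(a, b). if b = 0 then real_of_int a ^ 2 else if a = 0 then real_of_int b ^ 2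
                          else \<bar>real_of_int a * real_of_int b\<bar>)"

lemma lat_weight_ge_1: "p \<noteq> (0, 0) \<Longrightarrow> lat_weight p \<ge> 1"
proof -
  assume p: "p \<noteq> (0,0)"
  obtain a b where [simp]: "p = (a, b)" by force
  have *: "1 \<le> \<bar>real_of_int c\<bar>" if "c \<noteq> 0" for c :: int using that by linarith
  have **: "1 \<le> (real_of_int c)^2" if "c \<noteq> 0" for c :: int
    using power_mono[OF *[OF that], of 2] by simp
  have ***: "1 \<le> \<bar>real_of_int c * real_of_int d\<bar>" if "c \<noteq> 0" "d \<noteq> 0" for c d :: int
    using mult_mono[OF *[OF that(1)] *[OF that(2)]] by (simp add: abs_mult)
  show ?thesis using p ** *** by (auto simp: lat_weight_def)
qed

lemma has_sum_int_powers:
  assumes "s \<ge> 2"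
  shows "((\<lambda>a. 1 / \<bar>real_of_int a\<bar> ^ s) has_sum (2 * zeta_nat s)) (UNIV - {0})"
proof -
  have *: "((\<lambda>n::nat. 1 / real (Suc n) ^ s) has_sum zeta_nat s) UNIV"
    by (rule sums_nonneg_imp_has_sum[OF zeta_nat_sums[OF assms]]) auto
  have "((\<lambda>a. 1 / \<bar>real_of_int a\<bar> ^ s) has_sum zeta_nat s) {0<..} \<longleftrightarrow>
          ((\<lambda>n::nat. 1 / real (Suc n) ^ s) has_sum zeta_nat s) UNIV"
    by (rule has_sum_reindex_bij_witness[where j = "\<lambda>a. nat a - 1" and i = "\<lambda>n. int n + 1"]) auto
  with * have 1: "((\<lambda>a. 1 / \<bar>real_of_int a\<bar> ^ s) has_sum zeta_nat s) {0<..}" by simp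
  have "((\<lambda>a. 1 / \<bar>real_of_int a\<bar> ^ s) has_sum zeta_nat s) {..<0} \<longleftrightarrow>
          ((\<lambda>n::nat. 1 / real (Suc n) ^ s) has_sum zeta_nat s) UNIV"
    by (rule has_sum_reindex_bij_witness[where j = "\<lambda>a. nat (-a) - 1" and i = "\<lambda>n. - int n - 1"]) auto
  with * have 2: "((\<lambda>a. 1 / \<bar>real_of_int a\<bar> ^ s) has_sum zeta_nat s) {..<0}" by simp
  have "((\<lambda>a. 1 / \<bar>real_of_int a\<bar> ^ s) has_sum (zeta_nat s + zeta_nat s)) ({0<..} \<union> {..<0})"
    by (rule has_sum_Un_disjoint[OF 1 2]) auto
  moreover have "{0<..} \<union> {..<0} = UNIV - {0::int}" by auto
  ultimately show ?thesis by simp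
qed

lemma has_sum_axes:
  fixes f :: "int \<times> int \<Rightarrow> 'a :: {topological_comm_monoid_add, t2_space}"
  assumes "((\<lambda>a. f (a, 0)) has_sum x) (UNIV - {0})" "((\<lambda>b. f (0, b)) has_sum y) (UNIV - {0})"
      and "(f has_sum w) ((UNIV - {0}) \<times> (UNIV - {0}))"
  shows "(f has_sum (x + y + w)) (UNIV - {(0, 0)})"
proof -
  have 1: "(f has_sum x) ((\<lambda>a. (a, 0)) ` (UNIV - {0}))"
    using assms(1) by (subst has_sum_reindex) (auto simp: inj_on_def o_def)
  have 2: "(f has_sum y) ((\<lambda>a. (0, a)) ` (UNIV - {0}))"
    using assms(2) by (subst has_sum_reindex) (auto simp: inj_on_def o_def)
  have "(f has_sum (x + y + w)) (((\<lambda>a. (a, 0)) ` (UNIV - {0}) \<union> (\<lambda>a. (0, a)) ` (UNIV - {0}))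
          \<union> ((UNIV - {0}) \<times> (UNIV - {0})))"
    by (intro has_sum_Un_disjoint 1 2 assms(3)) auto
  moreover have "((\<lambda>a. (a, 0)) ` (UNIV - {0}) \<union> (\<lambda>a. (0, a)) ` (UNIV - {0}))
          \<union> ((UNIV - {0}) \<times> (UNIV - {0})) = UNIV - {(0::int, 0::int)}" by auto
  ultimately show ?thesis by simp
qed

lemma has_sum_cross:
  assumes "r \<ge> 2"
  shows "((\<lambda>(a, b). 1 / \<bar>real_of_int a * real_of_int b\<bar> ^ r) has_sum (2 * zeta_nat r) ^ 2)
           ((UNIV - {0}) \<times> (UNIV - {0}))"
proof -
  have "((\<lambda>(a, b). 1 / \<bar>real_of_int a * real_of_int b\<bar> ^ r) has_sum (2 * zeta_nat r * (2 * zeta_nat r)))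
           ((UNIV - {0}) \<times> (UNIV - {0}))"
  proof (rule has_sum_SigmaI)
    fix a :: int
    show "((\<lambda>b. case (a, b) of (a, b) \<Rightarrow> 1 / \<bar>real_of_int a * real_of_int b\<bar> ^ r) has_sum
             (1 / \<bar>real_of_int a\<bar> ^ r * (2 * zeta_nat r))) (UNIV - {0})"
      using has_sum_cmult_right[OF has_sum_int_powers[OF assms], of "1 / \<bar>real_of_int a\<bar> ^ r"]
      by (simp add: abs_mult power_mult_distrib)
  next
    show "((\<lambda>a. 1 / \<bar>real_of_int a\<bar> ^ r * (2 * zeta_nat r)) has_sum 2 * zeta_nat r * (2 * zeta_nat r)) (UNIV - {0})"
      by (rule has_sum_cmult_left[OF has_sum_int_powers[OF assms]])
  next
    show "(\<lambda>(a, b). 1 / \<bar>real_of_int a * real_of_int b\<bar> ^ r) summable_on (UNIV - {0}) \<times> (UNIV - {0})"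
    proof (rule summable_on_SigmaI)
      fix a :: int
      show "((\<lambda>b. case (a, b) of (a, b) \<Rightarrow> 1 / \<bar>real_of_int a * real_of_int b\<bar> ^ r) has_sum
             (1 / \<bar>real_of_int a\<bar> ^ r * (2 * zeta_nat r))) (UNIV - {0})"
        using has_sum_cmult_right[OF has_sum_int_powers[OF assms], of "1 / \<bar>real_of_int a\<bar> ^ r"]
        by (simp add: abs_mult power_mult_distrib)
    next
      show "(\<lambda>a. 1 / \<bar>real_of_int a\<bar> ^ r * (2 * zeta_nat r)) summable_on UNIV - {0}"
        using has_sum_cmult_left[OF has_sum_int_powers[OF assms]] has_sum_imp_summable by blast
    qed auto
  qed
  thus ?thesis by (simp add: power2_eq_square)
qed

lemma has_sum_lat_weight:
  assumes "r \<ge> 2"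
  shows "((\<lambda>p. 1 / lat_weight p ^ r) has_sum (2 * zeta_nat (2 * r) + 2 * zeta_nat (2 * r) + (2 * zeta_nat r) ^ 2))
           (UNIV - {(0, 0)})"
proof (rule has_sum_axes)
  have e: "((\<lambda>a. 1 / \<bar>real_of_int a\<bar> ^ (2 * r)) has_sum 2 * zeta_nat (2 * r)) (UNIV - {0})"
    by (rule has_sum_int_powers) (use assms in auto)
  show "((\<lambda>a. 1 / lat_weight (a, 0) ^ r) has_sum 2 * zeta_nat (2 * r)) (UNIV - {0})"
    using e by (simp add: lat_weight_def power_mult)
  show "((\<lambda>a. 1 / lat_weight (0, a) ^ r) has_sum 2 * zeta_nat (2 * r)) (UNIV - {0})"
  proof -
    have "((\<lambda>a. 1 / lat_weight (0, a) ^ r) has_sum 2 * zeta_nat (2 * r)) (UNIV - {0}) \<longleftrightarrow>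
          ((\<lambda>a. 1 / \<bar>real_of_int a\<bar> ^ (2 * r)) has_sum 2 * zeta_nat (2 * r)) (UNIV - {0})"
      by (rule has_sum_cong) (simp add: lat_weight_def power_mult)
    with e show ?thesis by simp
  qed
  show "((\<lambda>p. 1 / lat_weight p ^ r) has_sum (2 * zeta_nat r)\<^sup>2) ((UNIV - {0}) \<times> (UNIV - {0}))"
  proof -
    have "((\<lambda>p. 1 / lat_weight p ^ r) has_sum (2 * zeta_nat r)\<^sup>2) ((UNIV - {0}) \<times> (UNIV - {0})) \<longleftrightarrow>
      ((\<lambda>(a, b). 1 / \<bar>real_of_int a * real_of_int b\<bar> ^ r) has_sum (2 * zeta_nat r) ^ 2) ((UNIV - {0}) \<times> (UNIV - {0}))"
      by (rule has_sum_cong) (auto simp: lat_weight_def split: if_splits)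
    with has_sum_cross[OF assms] show ?thesis by simp
  qed
qed

lemma summable_lat_weight: "r \<ge> 2 \<Longrightarrow> (\<lambda>p. 1 / lat_weight p ^ r) summable_on (UNIV - {(0, 0)})"
  using has_sum_lat_weight has_sum_imp_summable by blast

lemma lat_term_bound:
  assumes "c > 0" "p \<noteq> (0, 0)" "c * lat_weight p \<le> cmod (of_int (fst p) + of_int (snd p) * z) ^ 2"
  shows "cmod ((\<lambda>(a, b). 1 / (of_int a + of_int b * z) ^ (2 * r)) p) \<le> 1 / c ^ r * (1 / lat_weight p ^ r)"
proof -
  let ?D = "cmod (of_int (fst p) + of_int (snd p) * z) ^ 2"
  have pos: "0 < c * lat_weight p" using assms(1) lat_weight_ge_1[OF assms(2)] by simp
  have "(c * lat_weight p) ^ r \<le> ?D ^ r"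
    by (rule power_mono[OF assms(3) less_imp_le[OF pos]])
  hence "1 / ?D ^ r \<le> 1 / (c * lat_weight p) ^ r"
    by (rule frac_le[rotated 3]) (use pos in auto)
  thus ?thesis by (simp add: case_prod_beta norm_divide norm_power power_mult power_mult_distrib)
qed

lemma cmod_lattice_point:
  "cmod (of_int a + of_int b * z) ^ 2 = (of_int a + of_int b * Re z) ^ 2 + (of_int b * Im z) ^ 2"
  by (simp add: cmod_power2)

text \<open>
  For a reduced point \<open>z = x + \<i> * y\<close> the square of the norm is
  \<open>a\<^sup>2 + 2 * a * b * x + b\<^sup>2 * \<bar>z\<bar>\<^sup>2 \<ge> a\<^sup>2 - \<bar>a * b\<bar> + b\<^sup>2\<close>, and \<open>a\<^sup>2 + b\<^sup>2 \<ge> 2 * \<bar>a * b\<bar>\<close>.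
\<close>

lemma lat_weight_le_reduced:
  assumes "\<bar>Re z\<bar> \<le> 1 / 2" "cmod z \<ge> 1"
  shows "lat_weight (a, b) \<le> cmod (of_int a + of_int b * z) ^ 2"
proof -
  have z: "(Re z) ^ 2 + (Im z) ^ 2 \<ge> 1" using power_mono[OF assms(2), of 2] by (simp add: cmod_power2)
  let ?a = "real_of_int a" let ?b = "real_of_int b"
  have eq: "cmod (of_int a + of_int b * z) ^ 2 = ?a^2 + 2 * (?a * ?b) * Re z + ?b^2 * ((Re z)^2 + (Im z)^2)"
    unfolding cmod_lattice_point by (simp add: power2_eq_square algebra_simps)
  have "\<bar>2 * (?a * ?b) * Re z\<bar> \<le> \<bar>2 * (?a * ?b)\<bar> * (1/2)"
    unfolding abs_mult using assms by (intro mult_mono) (auto simp: abs_mult)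
  hence 1: "2 * (?a * ?b) * Re z \<ge> - \<bar>?a * ?b\<bar>" unfolding abs_le_iff by (simp add: abs_mult)
  have 2: "?b^2 * ((Re z)^2 + (Im z)^2) \<ge> ?b^2 * 1" using z by (intro mult_left_mono) auto
  have 3: "?a^2 + ?b^2 \<ge> 2 * \<bar>?a * ?b\<bar>"
    using zero_le_power2[of "\<bar>?a\<bar> - \<bar>?b\<bar>"] by (simp add: power2_diff abs_mult)
  show ?thesis
    using 1 2 3 unfolding eq by (auto simp: lat_weight_def)
qed

text \<open>
  The imaginary part of \<open>a + b * z\<close> controls \<open>b\<close>; then
  \<open>a\<^sup>2 \<le> 2 * (a + b * x)\<^sup>2 + 2 * (b * x)\<^sup>2\<close> controls \<open>a\<close>.
\<close>

lemma lat_weight_le_strip: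
  assumes "\<bar>Re z\<bar> \<le> A" "Im z \<ge> B" "B > 0"
  shows "1 / (2 + (2 * A ^ 2 + 1) / B ^ 2) * lat_weight (a, b) \<le> cmod (of_int a + of_int b * z) ^ 2"
proof -
  let ?a = "real_of_int a" let ?b = "real_of_int b"
  define x where "x = Re z" define y where "y = Im z"
  have x: "x ^ 2 \<le> A ^ 2" using assms(1) by (simp add: x_def abs_le_square_iff[symmetric])
  have y: "B ^ 2 \<le> y ^ 2" using assms by (simp add: y_def power_mono)
  have A: "A \<ge> 0" using assms(1) by linarith
  define D where "D = cmod (of_int a + of_int b * z) ^ 2"
  have D: "D = (?a + ?b * x) ^ 2 + ?b^2 * y^2" by (simp add: D_def cmod_lattice_point x_def y_def power_mult_distrib)
  have B2: "B ^ 2 > 0" using assms by simp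
  have bB: "?b^2 * B^2 \<le> D"
    using mult_left_mono[OF y, of "?b^2"] unfolding D by (smt (verit) zero_le_power2)
  hence b: "?b^2 \<le> D / B^2" using B2 by (simp add: field_simps)
  have "lat_weight (a, b) \<le> ?a^2 + ?b^2"
  proof -
    have "0 \<le> \<bar>?a * ?b\<bar>" by simp
    moreover have "2 * \<bar>?a * ?b\<bar> \<le> ?a^2 + ?b^2"
      using zero_le_power2[of "\<bar>?a\<bar> - \<bar>?b\<bar>"] by (simp add: power2_diff abs_mult)
    ultimately have "\<bar>?a * ?b\<bar> \<le> ?a^2 + ?b^2" by linarith
    thus ?thesis by (simp add: lat_weight_def)
  qed
  also have "?a^2 \<le> 2 * (?a + ?b * x)^2 + 2 * (?b^2 * x^2)"
    using zero_le_power2[of "?a + 2 * (?b * x)"] by (simp add: power2_eq_square algebra_simps)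
  also have "?b^2 * x^2 \<le> ?b^2 * A^2" using x by (intro mult_left_mono) auto
  also have "2 * (?a + ?b * x)^2 + 2 * (?b^2 * A^2) + ?b^2 = 2 * (?a + ?b * x)^2 + ?b^2 * (2 * A^2 + 1)"
    by (simp add: algebra_simps)
  also have "\<dots> \<le> 2 * D + D / B^2 * (2 * A^2 + 1)"
    using b by (intro add_mono mult_right_mono mult_left_mono) (auto simp: D)
  also have "\<dots> = (2 + (2 * A^2 + 1) / B^2) * D" by (simp add: field_simps)
  finally have *: "lat_weight (a, b) \<le> (2 + (2 * A^2 + 1) / B^2) * D" by simp
  have "2 + (2 * A^2 + 1) / B^2 > 0" by (intro add_pos_nonneg) auto
  with * show ?thesis unfolding D_def[symmetric] by (simp add: field_simps)
qed

lemma eisenstein_G_uniform_limit: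
  assumes "r \<ge> 2" "c > 0"
    and "\<And>z a b. z \<in> Y \<Longrightarrow> c * lat_weight (a, b) \<le> cmod (of_int a + of_int b * z) ^ 2"
  shows "uniform_limit Y (\<lambda>X z. \<Sum>p\<in>X. (\<lambda>(a, b). 1 / (of_int a + of_int b * z) ^ (2 * r)) p)
           (eisenstein_G (2 * r)) (finite_subsets_at_top (UNIV - {(0, 0)}))"
  unfolding eisenstein_G_def[abs_def]
proof (rule Weierstrass_m_test_general)
  show "(\<lambda>p. 1 / c ^ r * (1 / lat_weight p ^ r)) summable_on UNIV - {(0, 0)}"
    by (rule summable_on_cmult_right[OF summable_lat_weight[OF assms(1)]])
  fix p :: "int \<times> int" and z assume "p \<in> UNIV - {(0, 0)}" "z \<in> Y"
  thus "cmod (case p of (a, b) \<Rightarrow> 1 / (of_int a + of_int b * z) ^ (2 * r)) \<le> 1 / c ^ r * (1 / lat_weight p ^ r)"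
    using lat_term_bound[OF assms(2), of p z r] assms(3)[of z "fst p" "snd p"] by auto
qed

lemma holomorphic_eisenstein_G:
  assumes "r \<ge> 2"
  shows "eisenstein_G (2 * r) holomorphic_on upper_half_plane"
proof -
  have "\<exists>e>0. eisenstein_G (2 * r) holomorphic_on ball z e" if z: "Im z > 0" for z
  proof -
    define B where "B = Im z / 2"
    have B: "B > 0" using z by (simp add: B_def)
    have w: "\<bar>Re w\<bar> \<le> \<bar>Re z\<bar> + B" "Im w \<ge> B" if "w \<in> cball z B" for w
    proof -
      have "cmod (w - z) \<le> B" using that by (simp add: dist_norm norm_minus_commute)
      hence r: "\<bar>Re w - Re z\<bar> \<le> B" "\<bar>Im w - Im z\<bar> \<le> B"
        using abs_Re_le_cmod[of "w - z"] abs_Im_le_cmod[of "w - z"] by simp_all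
      show "\<bar>Re w\<bar> \<le> \<bar>Re z\<bar> + B" using r by linarith
      show "Im w \<ge> B" using r unfolding B_def by linarith
    qed
    define A where "A = \<bar>Re z\<bar> + B"
    have ul: "uniform_limit (cball z B) (\<lambda>X z. \<Sum>p\<in>X. (\<lambda>(a, b). 1 / (of_int a + of_int b * z) ^ (2 * r)) p)
           (eisenstein_G (2 * r)) (finite_subsets_at_top (UNIV - {(0, 0)}))"
    proof (rule eisenstein_G_uniform_limit[OF assms])
      show "0 < 1 / (2 + (2 * A ^ 2 + 1) / B ^ 2)" using B by (intro divide_pos_pos add_pos_nonneg) auto
      fix w a b assume "w \<in> cball z B"
      thus "1 / (2 + (2 * A ^ 2 + 1) / B ^ 2) * lat_weight (a, b) \<le> (cmod (of_int a + of_int b * w))\<^sup>2"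
        by (intro lat_weight_le_strip) (use w B in \<open>auto simp: A_def\<close>)
    qed
    have nz: "of_int a + of_int b * w \<noteq> 0" if "w \<in> cball z B" "(a, b) \<noteq> (0, 0)" for a b w
    proof
      assume *: "of_int a + of_int b * w = 0"
      hence "Im (of_int a + of_int b * w) = 0" by simp
      hence "b = 0" using w(2)[OF that(1)] B by auto
      with * that show False by auto
    qed
    have hol: "(\<lambda>z. \<Sum>p\<in>X. (\<lambda>(a, b). 1 / (of_int a + of_int b * z) ^ (2 * r)) p) holomorphic_on (cball z B)"
      if "X \<subseteq> UNIV - {(0,0)}" for X
    proof (rule holomorphic_on_sum)
      fix p assume "p \<in> X"
      obtain a b where [simp]: "p = (a, b)" by force
      have "(a, b) \<noteq> (0, 0)" using that \<open>p \<in> X\<close> by auto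
      thus "(\<lambda>z. (\<lambda>(a, b). 1 / (of_int a + of_int b * z) ^ (2 * r)) p) holomorphic_on (cball z B)"
        using nz by (auto intro!: holomorphic_intros)
    qed
    show ?thesis
    proof (rule holomorphic_uniform_limit[OF _ ul])
      show "\<forall>\<^sub>F X in finite_subsets_at_top (UNIV - {(0, 0)}).
         continuous_on (cball z B) (\<lambda>z. \<Sum>p\<in>X. (\<lambda>(a, b). 1 / (of_int a + of_int b * z) ^ (2 * r)) p) \<and>
         (\<lambda>z. \<Sum>p\<in>X. (\<lambda>(a, b). 1 / (of_int a + of_int b * z) ^ (2 * r)) p) holomorphic_on ball z B"
      proof (rule eventually_finite_subsets_at_top_weakI, intro conjI)
        fix X :: "(int \<times> int) set" assume "X \<subseteq> UNIV - {(0, 0)}"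
        from hol[OF this] show
          "continuous_on (cball z B) (\<lambda>z. \<Sum>p\<in>X. (\<lambda>(a, b). 1 / (of_int a + of_int b * z) ^ (2 * r)) p)"
          by (rule holomorphic_on_imp_continuous_on)
        from hol[OF \<open>X \<subseteq> UNIV - {(0, 0)}\<close>] ball_subset_cball show
          "(\<lambda>z. \<Sum>p\<in>X. (\<lambda>(a, b). 1 / (of_int a + of_int b * z) ^ (2 * r)) p) holomorphic_on ball z B"
          by (rule holomorphic_on_subset)
      qed
    qed (use B in auto)
  qed
  hence "\<forall>z\<in>upper_half_plane. \<exists>e>0. eisenstein_G (2 * r) holomorphic_on ball z e"
    by (auto simp: upper_half_plane_def)
  thus ?thesis
    by (metis analytic_on_def analytic_imp_holomorphic)
qed

lemma norm_eisenstein_G_le: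
  assumes "r \<ge> 2" "\<bar>Re z\<bar> \<le> 1 / 2" "cmod z \<ge> 1"
  shows "cmod (eisenstein_G (2 * r) z) \<le> 17.5"
proof -
  have "cmod (eisenstein_G (2 * r) z) \<le> 2 * zeta_nat (2 * r) + 2 * zeta_nat (2 * r) + (2 * zeta_nat r) ^ 2"
    unfolding eisenstein_G_def
  proof (rule norm_infsum_le[OF has_sum_infsum has_sum_lat_weight])
    fix p :: "int \<times> int" assume "p \<in> UNIV - {(0, 0)}"
    thus "cmod (case p of (a, b) \<Rightarrow> 1 / (of_int a + of_int b * z) ^ (2 * r)) \<le> 1 / lat_weight p ^ r"
      using lat_term_bound[of 1 p z r] lat_weight_le_reduced[OF assms(2,3), of "fst p" "snd p"] by auto
  next
    show "(\<lambda>(a, b). 1 / (of_int a + of_int b * z) ^ (2 * r)) summable_on UNIV - {(0, 0)}"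
    proof (rule abs_summable_summable, rule Infinite_Sum.abs_summable_on_comparison_test'[OF summable_lat_weight[OF assms(1)]])
      fix p :: "int \<times> int" assume "p \<in> UNIV - {(0, 0)}"
      thus "cmod (case p of (a, b) \<Rightarrow> 1 / (of_int a + of_int b * z) ^ (2 * r)) \<le> 1 / lat_weight p ^ r"
        using lat_term_bound[of 1 p z r] lat_weight_le_reduced[OF assms(2,3), of "fst p" "snd p"] by auto
    qed
  qed (use assms in auto)
  also have "\<dots> \<le> 2 * 1.645 + 2 * 1.645 + (2 * 1.645) ^ 2"
  proof -
    have "zeta_nat (2 * r) \<le> 1.645" using zeta_nat_antimono[of 2 "2 * r"] zeta_nat_2_le assms by linarith
    moreover have "zeta_nat r \<le> 1.645" using zeta_nat_antimono[of 2 r] zeta_nat_2_le assms by linarith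
    moreover have "zeta_nat r \<ge> 0" using zeta_nat_ge_1[of r] assms by linarith
    ultimately show ?thesis by (intro add_mono mult_left_mono power_mono) auto
  qed
  also have "\<dots> \<le> 17.5" by (simp add: power2_eq_square)
  finally show ?thesis .
qed

text \<open>
  Along the imaginary axis every term with \<open>b \<noteq> 0\<close> tends to 0, and the uniform convergence of the
  series allows the limit to be taken term by term.
\<close>

lemma eisenstein_G_tendsto:
  assumes "r \<ge> 2"
  shows "((\<lambda>y::real. eisenstein_G (2 * r) (\<i> * of_real y)) \<longlongrightarrow> of_real (2 * zeta_nat (2 * r))) at_top"
proof -
  define F where "F = finite_subsets_at_top (UNIV - {(0::int, 0::int)})"
  define G where "G = filtermap (\<lambda>y::real. \<i> * of_real y) at_top"
  define f where "f = (\<lambda>z (a::int, b::int). 1 / (of_int a + of_int b * z :: complex) ^ (2 * r))"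
  define g where "g = (\<lambda>(a::int, b::int). if b = 0 then 1 / (of_int a :: complex) ^ (2 * r) else 0)"
  define Y where "Y = {z. Re z = 0 \<and> Im z \<ge> 1}"
  have tm: "((\<lambda>z. f z p) \<longlongrightarrow> g p) G" for p
  proof -
    obtain a b where p: "p = (a, b)" by force
    show ?thesis
    proof (cases "b = 0")
      case False
      have "((\<lambda>y::real. f (\<i> * of_real y) p) \<longlongrightarrow> 0) at_top"
      proof (rule Lim_null_comparison)
        show "\<forall>\<^sub>F y in at_top. norm (f (\<i> * of_real y) p) \<le> 1 / (y::real)"
          using eventually_ge_at_top[of 1]
        proof eventually_elim
          case (elim y)
          let ?w = "of_int a + of_int b * (\<i> * of_real y) :: complex"
          have b: "1 \<le> \<bar>real_of_int b\<bar>" using False by linarith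
          have "y \<le> \<bar>real_of_int b\<bar> * y" using b elim by simp
          also have "\<dots> = \<bar>Im ?w\<bar>" using elim by (simp add: abs_mult)
          also have "\<dots> \<le> cmod ?w" by (rule abs_Im_le_cmod)
          finally have w: "y \<le> cmod ?w" .
          have "y \<le> cmod ?w ^ 1" using w by simp
          also have "\<dots> \<le> cmod ?w ^ (2 * r)" using w elim assms by (intro power_increasing) auto
          finally have "1 / cmod ?w ^ (2 * r) \<le> 1 / y" using elim by (intro frac_le) auto
          thus ?case by (simp add: f_def p norm_divide norm_power)
        qed
        show "((\<lambda>y::real. 1 / y) \<longlongrightarrow> 0) at_top" by real_asymp
      qed
      thus ?thesis using False by (simp add: g_def p G_def filterlim_filtermap)
    qed (simp add: f_def g_def p)
  qed
  have "(eisenstein_G (2 * r) \<longlongrightarrow> of_real (2 * zeta_nat (2 * r))) G"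
  proof (rule swap_uniform_limit')
    show "\<forall>\<^sub>F X in F. ((\<lambda>z. \<Sum>p\<in>X. f z p) \<longlongrightarrow> (\<Sum>p\<in>X. g p)) G"
      by (intro always_eventually allI tendsto_sum tm)
    have "((\<lambda>a. 1 / (of_int a :: complex) ^ (2 * r)) has_sum of_real (2 * zeta_nat (2 * r))) (UNIV - {0})"
      using has_sum_of_real[OF has_sum_int_powers[of "2 * r"], where 'a = complex] assms
      by (simp add: power_mult)
    hence "(g has_sum (of_real (2 * zeta_nat (2 * r)) + 0 + 0)) (UNIV - {(0, 0)})"
    proof (intro has_sum_axes)
      show "((\<lambda>b. g (0, b)) has_sum 0) (UNIV - {0})" by (rule has_sum_0) (auto simp: g_def)
      show "(g has_sum 0) ((UNIV - {0}) \<times> (UNIV - {0}))" by (rule has_sum_0) (auto simp: g_def split: if_splits)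
    qed (simp add: g_def)
    thus "((\<lambda>X. \<Sum>p\<in>X. g p) \<longlongrightarrow> of_real (2 * zeta_nat (2 * r))) F"
      by (simp add: has_sum_def F_def)
    show "uniform_limit Y (\<lambda>X z. \<Sum>p\<in>X. f z p) (eisenstein_G (2 * r)) F"
      unfolding f_def F_def
    proof (rule eisenstein_G_uniform_limit[OF assms, of 1])
      fix z a b assume "z \<in> Y"
      hence "\<bar>Re z\<bar> \<le> 1 / 2" "cmod z \<ge> 1" using abs_Im_le_cmod[of z] by (auto simp: Y_def)
      thus "1 * lat_weight (a, b) \<le> (cmod (of_int a + of_int b * z))\<^sup>2"
        using lat_weight_le_reduced by simp
    qed auto
    show "\<forall>\<^sub>F z in G. z \<in> Y"
      unfolding G_def eventually_filtermap using eventually_ge_at_top[of "1::real"]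
      by eventually_elim (auto simp: Y_def)
    show "F \<noteq> bot" by (simp add: F_def)
  qed
  thus ?thesis by (simp add: G_def filterlim_filtermap)
qed

text \<open>
  At \<open>\<i>\<close> the terms on both axes are positive with sum \<open>4 * \<zeta>(4)\<close>, while
  \<open>\<bar>a + b * \<i>\<bar>\<^sup>2 \<ge> 2 * \<bar>a * b\<bar>\<close> bounds all other terms together by \<open>\<zeta>(2)\<^sup>2\<close>. This value, with
  the vanishing of \<open>G\<^sub>6\<close> at the fixed point \<open>\<i>\<close> of the inversion, is the only place where the size of
  the discriminant is bounded from below directly.
\<close>

lemma norm_eisenstein_G4_ii: "cmod (eisenstein_G 4 \<i>) \<ge> 1.29"
proof -
  define f where "f = (\<lambda>(a::int, b::int). 1 / (of_int a + of_int b * \<i> :: complex) ^ 4)"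
  have ax: "((\<lambda>a. 1 / (of_int a :: complex) ^ 4) has_sum of_real (2 * zeta_nat 4)) (UNIV - {0})"
    using has_sum_of_real[OF has_sum_int_powers[of 4], where 'a = complex]
    by simp
  have cross: "((\<lambda>p. 1 / 4 * (case p of (a, b) \<Rightarrow> 1 / \<bar>real_of_int a * real_of_int b\<bar> ^ 2)) has_sum (1 / 4 * (2 * zeta_nat 2) ^ 2))
           ((UNIV - {0}) \<times> (UNIV - {0}))"
    by (rule has_sum_cmult_right[OF has_sum_cross]) auto
  have le: "cmod (f p) \<le> 1 / 4 * (case p of (a, b) \<Rightarrow> 1 / \<bar>real_of_int a * real_of_int b\<bar> ^ 2)"
    if p: "p \<in> (UNIV - {0}) \<times> (UNIV - {0})" for p
  proof -
    obtain a b where ab: "p = (a, b)" "a \<noteq> 0" "b \<noteq> 0" using p by auto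
    let ?n = "real_of_int a ^ 2 + real_of_int b ^ 2" and ?m = "\<bar>real_of_int a * real_of_int b\<bar>"
    have n: "cmod (of_int a + of_int b * \<i>) ^ 2 = ?n"
      using cmod_lattice_point[of a b \<i>] by simp
    have "2 * ?m \<le> ?n"
      using zero_le_power2[of "\<bar>real_of_int a\<bar> - \<bar>real_of_int b\<bar>"] by (simp add: power2_diff abs_mult)
    hence "(2 * ?m) ^ 2 \<le> ?n ^ 2" by (intro power_mono) auto
    hence "1 / ?n ^ 2 \<le> 1 / (2 * ?m) ^ 2" using ab by (intro frac_le) auto
    also have "1 / (2 * ?m) ^ 2 = 1 / 4 * (1 / ?m ^ 2)" by (simp add: power_mult_distrib)
    also have "?n ^ 2 = cmod (of_int a + of_int b * \<i>) ^ 4" unfolding n[symmetric] by (simp flip: power_mult)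
    finally show ?thesis by (simp add: f_def ab norm_divide norm_power)
  qed
  have "f summable_on ((UNIV - {0}) \<times> (UNIV - {0}))"
    by (rule abs_summable_summable, rule Infinite_Sum.abs_summable_on_comparison_test'[OF has_sum_imp_summable[OF cross] le])
  then obtain w where w: "(f has_sum w) ((UNIV - {0}) \<times> (UNIV - {0}))" by (auto simp: summable_on_def)
  have wle: "cmod w \<le> 1 / 4 * (2 * zeta_nat 2) ^ 2" by (rule norm_infsum_le[OF w cross le])
  have "(f has_sum (of_real (2 * zeta_nat 4) + of_real (2 * zeta_nat 4) + w)) (UNIV - {(0, 0)})"
    by (intro has_sum_axes w) (use ax in \<open>auto simp: f_def power_mult_distrib\<close>)
  hence "eisenstein_G 4 \<i> = of_real (4 * zeta_nat 4) + w"
    by (simp add: eisenstein_G_def f_def infsumI)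
  hence "cmod (eisenstein_G 4 \<i>) \<ge> 4 * zeta_nat 4 - cmod w"
    using norm_triangle_ineq2[of "of_real (4 * zeta_nat 4)" "- w"] zeta_nat_ge_1[of 4] by simp
  moreover have "(2 * zeta_nat 2) ^ 2 \<le> (2 * 1.645) ^ 2"
    using zeta_nat_2_le zeta_nat_ge_1[of 2] by (intro power_mono) auto
  moreover have "zeta_nat 4 \<ge> 1" by (rule zeta_nat_ge_1) auto
  ultimately show ?thesis using wle by (simp add: power2_eq_square)
qed

lemma eisenstein_G6_ii: "eisenstein_G 6 \<i> = 0"
proof -
  have "eisenstein_G 6 (- (1 / \<i>)) = \<i> ^ 6 * eisenstein_G 6 \<i>"
    by (rule eisenstein_G_inversion) auto
  moreover have "\<i> ^ 6 = (-1 :: complex)" using power_mult[of \<i> 2 3] by simp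
  ultimately show ?thesis by simp
qed

section \<open>Expansions at the cusp\<close>

definition qexp :: "complex \<Rightarrow> complex" where "qexp z = exp (2 * of_real pi * \<i> * z)"

lemma norm_qexp: "cmod (qexp z) = exp (- 2 * pi * Im z)"
  by (simp add: qexp_def)

lemma qexp_nonzero [simp]: "qexp z \<noteq> 0"
  by (simp add: qexp_def)

lemma norm_qexp_less_1: "Im z > 0 \<Longrightarrow> cmod (qexp z) < 1"
  by (simp add: norm_qexp)

lemma qexp_plus1 [simp]: "qexp (z + 1) = qexp z"
  by (simp add: qexp_def distrib_left exp_add exp_two_pi_i')

lemma holomorphic_qexp [holomorphic_intros]: "qexp holomorphic_on A"
  unfolding qexp_def[abs_def] by (intro holomorphic_intros)

lemma open_upper_half_plane: "open upper_half_plane"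
  unfolding upper_half_plane_def by (simp add: open_halfspace_Im_gt)

lemma connected_upper_half_plane: "connected upper_half_plane"
  unfolding upper_half_plane_def by (intro convex_connected convex_halfspace_Im_gt)

lemma Im_inversion: "Im (- (1 / z)) = Im z / cmod z ^ 2"
  by (simp add: Im_divide cmod_power2)

lemma Im_inversion_pos: "Im z > 0 \<Longrightarrow> Im (- (1 / z)) > 0"
  unfolding Im_inversion by (intro divide_pos_pos) auto

lemma periodic_of_int:
  assumes "\<And>z. Im z > 0 \<Longrightarrow> f (z + 1) = f z" "Im z > 0"
  shows "f (z + of_int n) = f z"
proof -
  have nat: "f (w + of_nat k) = f w" if "Im w > 0" for w k
  proof (induction k)
    case (Suc k)
    have "f (w + of_nat k + 1) = f (w + of_nat k)" using that by (intro assms(1)) auto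
    with Suc show ?case by (simp add: add_ac)
  qed auto
  show ?thesis
  proof (cases "n \<ge> 0")
    case True
    thus ?thesis using nat[OF assms(2), of "nat n"] by simp
  next
    case False
    thus ?thesis using nat[of "z + of_int n" "nat (-n)"] assms(2) by simp
  qed
qed

lemma qexp_log:
  assumes "exp L = w" "w \<noteq> 0"
  shows "qexp (L / (2 * of_real pi * \<i>)) = w" and "Im (L / (2 * of_real pi * \<i>)) = - ln (cmod w) / (2 * pi)"
proof -
  show "qexp (L / (2 * of_real pi * \<i>)) = w" using assms by (simp add: qexp_def)
  have "cmod w = exp (Re L)" using assms by auto
  hence "ln (cmod w) = Re L" by simp
  thus "Im (L / (2 * of_real pi * \<i>)) = - ln (cmod w) / (2 * pi)"
    by (simp add: Im_divide power2_eq_square)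
qed

lemma qexp_surj:
  assumes "w \<noteq> 0"
  obtains z where "qexp z = w" "Im z = - ln (cmod w) / (2 * pi)"
  using qexp_log[of "Ln w" w] assms that by (metis exp_Ln)

lemma qexp_onto:
  assumes "w \<noteq> 0" "cmod w < 1"
  obtains z where "qexp z = w" "Im z > 0"
proof -
  obtain z where z: "qexp z = w" "Im z = - ln (cmod w) / (2 * pi)" using qexp_surj[OF assms(1)] .
  have "ln (cmod w) < 0" using assms by simp
  hence "Im z > 0" using z by (simp add: divide_neg_pos)
  with z that show thesis by blast
qed

text \<open>
  Near every point of the punctured disc a branch of the logarithm inverts \<open>q\<close>, and periodicity makes the
  value of \<open>f\<close> independent of the branch.
\<close>

lemma q_lift:
  assumes hol: "f holomorphic_on upper_half_plane"
      and per: "\<And>z. Im z > 0 \<Longrightarrow> f (z + 1) = f z"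
  obtains g where "g holomorphic_on ball 0 1 - {0}" "\<And>z. Im z > 0 \<Longrightarrow> f z = g (qexp z)"
proof -
  define g where "g = (\<lambda>w. f (Ln w / (2 * of_real pi * \<i>)))"
  have f_eq: "f z = f z'" if eq: "qexp z = qexp z'" and "Im z > 0" and pos: "Im z' > 0" for z z'
  proof -
    obtain n :: int where n: "2 * of_real pi * \<i> * z = 2 * of_real pi * \<i> * z' + (of_int (2 * n) * pi) * \<i>"
      using eq unfolding qexp_def exp_eq by blast
    hence "2 * of_real pi * \<i> * z = 2 * of_real pi * \<i> * (z' + of_int n)" by (simp add: algebra_simps)
    hence "z = z' + of_int n" by simp
    thus ?thesis using periodic_of_int[of f, OF per pos] by simp
  qed
  have Im_pos: "Im z > 0" if "Im z = - ln (cmod w) / (2 * pi)" "cmod w < 1" "w \<noteq> 0" for z w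
    using that by (simp add: divide_neg_pos)
  have g_eq: "f z = g (qexp z)" if "Im z > 0" for z
    unfolding g_def
    by (rule f_eq) (use that qexp_log[of "Ln (qexp z)" "qexp z"] norm_qexp_less_1[OF that] Im_pos in auto)
  have "\<exists>e>0. g holomorphic_on ball w0 e" if w0: "w0 \<in> ball 0 1 - {0}" for w0
  proof -
    define e where "e = min (cmod w0) (1 - cmod w0)"
    have e: "e > 0" using w0 by (simp add: e_def)
    define L where "L = (\<lambda>w. (Ln (w / w0) + Ln w0) / (2 * of_real pi * \<i>))"
    have w: "w \<noteq> 0" "cmod w < 1" "w / w0 \<notin> \<real>\<^sub>\<le>\<^sub>0" if "w \<in> ball w0 e" for w
    proof -
      have d: "cmod (w - w0) < cmod w0" "cmod (w - w0) < 1 - cmod w0"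
        using that by (auto simp: e_def dist_norm norm_minus_commute)
      show "w \<noteq> 0" using d by auto
      show "cmod w < 1" using d norm_triangle_ineq[of "w - w0" w0] by simp
      have "w0 \<noteq> 0" using w0 by auto
      hence "w / w0 - 1 = (w - w0) / w0" by (simp add: diff_divide_distrib)
      hence "cmod (w / w0 - 1) = cmod (w - w0) / cmod w0" by (simp add: norm_divide)
      hence "cmod (w / w0 - 1) < 1" using d \<open>w0 \<noteq> 0\<close> by simp
      hence "Re (w / w0) > 0" using abs_Re_le_cmod[of "w / w0 - 1"] by auto
      thus "w / w0 \<notin> \<real>\<^sub>\<le>\<^sub>0" by (auto simp: complex_nonpos_Reals_iff)
    qed
    have ex: "exp (Ln (w / w0) + Ln w0) = w" if "w \<in> ball w0 e" for w
      using w[OF that] w0 by (simp add: exp_add)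
    have "(\<lambda>w. f (L w)) holomorphic_on ball w0 e"
    proof (rule holomorphic_on_compose_gen[OF _ hol, unfolded o_def])
      show "L holomorphic_on ball w0 e" unfolding L_def
        using w w0 by (intro holomorphic_intros) auto
      show "L ` ball w0 e \<subseteq> upper_half_plane"
      proof
        fix u assume "u \<in> L ` ball w0 e"
        then obtain w' where w': "w' \<in> ball w0 e" "u = L w'" by auto
        have "Im (L w') > 0"
          unfolding L_def by (rule Im_pos[OF qexp_log(2)[OF ex]]) (use w' w in auto)
        thus "u \<in> upper_half_plane" using w' by (simp add: upper_half_plane_def)
      qed
    qed
    moreover have "f (L w) = g w" if "w \<in> ball w0 e" for w
    proof -
      have "qexp (L w) = w" "Im (L w) > 0"
        using qexp_log[OF ex[OF that]] w[OF that] Im_pos by (auto simp: L_def)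
      thus ?thesis using g_eq[of "L w"] by simp
    qed
    ultimately have "g holomorphic_on ball w0 e" by (metis holomorphic_transform)
    with e show ?thesis by blast
  qed
  hence "g holomorphic_on ball 0 1 - {0}" by (metis analytic_on_def analytic_imp_holomorphic)
  with g_eq that show thesis by blast
qed

text \<open>
  The expansion of \<open>f\<close> in powers of \<open>q\<close> starts with \<open>q ^ n\<close> or later. This includes that \<open>f\<close> is
  holomorphic on the upper half plane and has period 1.
\<close>

definition cusp_order :: "nat \<Rightarrow> (complex \<Rightarrow> complex) \<Rightarrow> bool" where
  "cusp_order n f \<longleftrightarrow> (\<exists>g. g holomorphic_on ball 0 1 \<and> (\<forall>z. Im z > 0 \<longrightarrow> f z = qexp z ^ n * g (qexp z)))"

lemma cusp_order_holomorphic: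
  assumes "cusp_order n f"
  shows "f holomorphic_on upper_half_plane"
proof -
  obtain g where g: "g holomorphic_on ball 0 1" "\<And>z. Im z > 0 \<Longrightarrow> f z = qexp z ^ n * g (qexp z)"
    using assms by (auto simp: cusp_order_def)
  have "(g \<circ> qexp) holomorphic_on upper_half_plane"
    by (rule holomorphic_on_compose_gen[OF _ g(1)]) (auto intro!: holomorphic_intros simp: upper_half_plane_def norm_qexp_less_1)
  hence "(\<lambda>z. qexp z ^ n * (g \<circ> qexp) z) holomorphic_on upper_half_plane" by (intro holomorphic_intros)
  thus ?thesis by (rule holomorphic_transform) (use g in \<open>auto simp: upper_half_plane_def\<close>)
qed

lemma cusp_order_periodic: "cusp_order n f \<Longrightarrow> Im z > 0 \<Longrightarrow> f (z + 1) = f z"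
  by (auto simp: cusp_order_def)

text \<open>
  Riemann's theorem on removable singularities, applied to \<open>f / q ^ n\<close> as a function of \<open>q\<close>.
\<close>

lemma cusp_orderI:
  assumes hol: "f holomorphic_on upper_half_plane"
      and per: "\<And>z. Im z > 0 \<Longrightarrow> f (z + 1) = f z"
      and bound: "\<And>z. Im z > 0 \<Longrightarrow> Im z \<ge> Y \<Longrightarrow> cmod (f z) \<le> C * exp (- 2 * pi * n * Im z)"
  shows "cusp_order n f"
proof -
  have hol': "(\<lambda>z. f z / qexp z ^ n) holomorphic_on upper_half_plane"
    by (intro holomorphic_intros hol) auto
  obtain g where g: "g holomorphic_on ball 0 1 - {0}" "\<And>z. Im z > 0 \<Longrightarrow> f z / qexp z ^ n = g (qexp z)"
    using q_lift[OF hol'] per by auto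
  define r where "r = min 1 (exp (- 2 * pi * Y))"
  have r: "r > 0" by (simp add: r_def)
  have "cmod (g w) \<le> C" if w: "w \<noteq> 0" "cmod w < r" for w
  proof -
    obtain z where z: "qexp z = w" "Im z = - ln (cmod w) / (2 * pi)" using qexp_surj[OF w(1)] .
    have "ln (cmod w) < ln 1" using w by (subst ln_less_cancel_iff) (auto simp: r_def)
    hence Im: "Im z > 0" using z by (simp add: divide_neg_pos)
    have "exp (- 2 * pi * Im z) < exp (- 2 * pi * Y)" using w(2) norm_qexp[of z] z(1) by (simp add: r_def)
    hence "Im z \<ge> Y" by simp
    hence "cmod (f z) \<le> C * exp (- 2 * pi * n * Im z)" using Im bound by blast
    also have "exp (- 2 * pi * n * Im z) = cmod (qexp z ^ n)"
      by (simp add: norm_power norm_qexp exp_of_nat_mult[symmetric] mult_ac)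
    finally have "cmod (f z / qexp z ^ n) \<le> C" by (simp add: norm_divide divide_le_eq)
    thus ?thesis using g(2)[OF Im] z by simp
  qed
  hence "\<forall>\<^sub>F w in at 0. cmod (g w) \<le> C"
    unfolding eventually_at using r by (intro exI[of _ r]) auto
  hence "\<exists>h. h holomorphic_on ball 0 1 \<and> (\<forall>z\<in>ball 0 1 - {0}. h z = g z)"
    by (subst holomorphic_on_extend_bounded[OF g(1)]) auto
  then obtain h where h: "h holomorphic_on ball 0 1" "\<And>z. z \<in> ball 0 1 - {0} \<Longrightarrow> h z = g z" by blast
  have "f z = qexp z ^ n * h (qexp z)" if "Im z > 0" for z
  proof -
    have "h (qexp z) = f z / qexp z ^ n" using h(2)[of "qexp z"] g(2)[OF that] norm_qexp_less_1[OF that] by simp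
    thus ?thesis by simp
  qed
  with h(1) show ?thesis unfolding cusp_order_def by blast
qed

lemma cusp_order_bound:
  assumes "cusp_order n f" "Y > 0"
  obtains C where "C \<ge> 0" "\<And>z. Im z \<ge> Y \<Longrightarrow> cmod (f z) \<le> C * exp (- 2 * pi * n * Im z)"
proof -
  obtain g where g: "g holomorphic_on ball 0 1" "\<And>z. Im z > 0 \<Longrightarrow> f z = qexp z ^ n * g (qexp z)"
    using assms by (auto simp: cusp_order_def)
  define r where "r = exp (- 2 * pi * Y)"
  have r: "r < 1" using assms by (simp add: r_def)
  have "compact (g ` cball 0 r)"
    by (rule compact_continuous_image) (use r g in \<open>auto intro!: holomorphic_on_imp_continuous_on intro: holomorphic_on_subset\<close>)
  then obtain C where C: "\<And>w. w \<in> cball 0 r \<Longrightarrow> cmod (g w) \<le> C"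
    by (meson compact_imp_bounded bounded_iff imageI)
  have C0: "C \<ge> 0" using C[of 0] by (simp add: r_def) (meson norm_ge_zero order_trans)
  show thesis
  proof (rule that[OF C0])
    fix z assume z: "Im z \<ge> Y"
    have "cmod (f z) = cmod (qexp z ^ n) * cmod (g (qexp z))" using g(2)[of z] z assms by (simp add: norm_mult)
    also have "\<dots> \<le> cmod (qexp z ^ n) * C"
      using z by (intro mult_left_mono C) (auto simp: norm_qexp r_def)
    also have "cmod (qexp z ^ n) = exp (- 2 * pi * n * Im z)"
      by (simp add: norm_power norm_qexp exp_of_nat_mult[symmetric] mult_ac)
    finally show "cmod (f z) \<le> C * exp (- 2 * pi * n * Im z)" by (simp add: mult_ac)
  qed
qed

text \<open>
  The maximum modulus principle for \<open>f / q ^ n\<close> as a function of \<open>q\<close>, on the disc that corresponds to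
  \<open>Im z \<ge> Y\<close>.
\<close>

lemma cusp_order_max_modulus:
  assumes "cusp_order n f" "Y > 0" "\<And>z. Im z = Y \<Longrightarrow> cmod (f z) \<le> B" "Im z \<ge> Y"
  shows "cmod (f z) \<le> B * exp (- 2 * pi * n * (Im z - Y))"
proof -
  obtain g where g: "g holomorphic_on ball 0 1" "\<And>z. Im z > 0 \<Longrightarrow> f z = qexp z ^ n * g (qexp z)"
    using assms by (auto simp: cusp_order_def)
  define r where "r = exp (- 2 * pi * Y)"
  have r: "r < 1" "r > 0" using assms by (auto simp: r_def)
  have "cmod (g (qexp z)) \<le> B / r ^ n"
  proof (rule maximum_modulus_frontier[where S = "cball 0 r" and f = g and \<xi> = "qexp z"])
    show "g holomorphic_on interior (cball 0 r)" "continuous_on (closure (cball 0 r)) g"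
      using r g by (auto intro!: holomorphic_on_imp_continuous_on intro: holomorphic_on_subset)
    show "qexp z \<in> cball 0 r" using assms by (simp add: norm_qexp r_def)
    fix w :: complex assume "w \<in> frontier (cball 0 r)"
    hence w: "cmod w = r" by simp
    obtain z where z: "qexp z = w" "Im z = - ln (cmod w) / (2 * pi)" by (rule qexp_surj[of w]) (use w r in auto)
    have "Im z = Y" using z w by (simp add: r_def)
    hence "cmod (qexp z ^ n * g (qexp z)) \<le> B" using assms(3)[OF \<open>Im z = Y\<close>] g(2)[of z] \<open>Im z = Y\<close> assms(2) by simp
    thus "cmod (g w) \<le> B / r ^ n" using r w z by (simp add: norm_mult norm_power field_simps)
  qed auto
  moreover have "cmod (f z) = cmod (qexp z ^ n) * cmod (g (qexp z))"
    using g(2)[of z] assms by (simp add: norm_mult)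
  ultimately have "cmod (f z) \<le> cmod (qexp z ^ n) * (B / r ^ n)"
    using mult_left_mono[of "cmod (g (qexp z))" "B / r ^ n" "cmod (qexp z ^ n)"] by simp
  also have "cmod (qexp z ^ n) = exp (- 2 * pi * n * Im z)"
    by (simp add: norm_power norm_qexp exp_of_nat_mult[symmetric] mult_ac)
  also have "\<dots> * (B / r ^ n) = B * exp (- 2 * pi * n * (Im z - Y))"
    by (simp add: r_def exp_of_nat_mult[symmetric] exp_diff[symmetric] algebra_simps divide_inverse flip: exp_minus exp_add)
  finally show ?thesis .
qed

lemma cusp_order_Suc:
  assumes "g holomorphic_on ball 0 1" "g 0 = 0" "\<And>z. Im z > 0 \<Longrightarrow> f z = qexp z ^ n * g (qexp z)"
  shows "cusp_order (Suc n) f"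
proof -
  obtain h where h: "h holomorphic_on ball 0 1" "\<And>w. cmod w < 1 \<Longrightarrow> g w = w * h w"
    by (rule Schwarz3[OF assms(1,2)], rule that, assumption, blast)
  show ?thesis unfolding cusp_order_def
    by (intro exI[of _ h]) (use h assms(3) norm_qexp_less_1 in auto)
qed

section \<open>Reduction to the fundamental domain\<close>

text \<open>
  Equivalence under the modular group, in terms of its generators: the invariance of a function then has
  to be checked for \<open>z + 1\<close> and \<open>- (1 / z)\<close> only.
\<close>

inductive modular_equiv :: "complex \<Rightarrow> complex \<Rightarrow> bool" where
  modular_equiv_refl: "modular_equiv z z"
| modular_equiv_plus: "modular_equiv z w \<Longrightarrow> modular_equiv z (w + 1)"
| modular_equiv_minus: "modular_equiv z w \<Longrightarrow> modular_equiv z (w - 1)"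
| modular_equiv_inversion: "modular_equiv z w \<Longrightarrow> modular_equiv z (- (1 / w))"

lemma modular_equiv_Im_pos: "modular_equiv z w \<Longrightarrow> Im z > 0 \<Longrightarrow> Im w > 0"
proof (induction rule: modular_equiv.induct)
  case (modular_equiv_inversion z w)
  thus ?case using Im_inversion_pos by blast
qed auto

lemma modular_equiv_plus_int: "modular_equiv z w \<Longrightarrow> modular_equiv z (w + of_int n)"
proof (induction n rule: int_induct[of _ 0])
  case (step1 i)
  hence "modular_equiv z (w + of_int i + 1)" by (intro modular_equiv_plus)
  thus ?case by (simp add: add_ac)
next
  case (step2 i)
  hence "modular_equiv z (w + of_int i - 1)" by (intro modular_equiv_minus)
  thus ?case by (simp add: algebra_simps)
qed auto

lemma modular_equiv_invariant:
  assumes "\<And>z. Im z > 0 \<Longrightarrow> F (z + 1) = F z" "\<And>z. Im z > 0 \<Longrightarrow> F (- (1 / z)) = F z"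
  shows "modular_equiv z w \<Longrightarrow> Im z > 0 \<Longrightarrow> F w = F z"
proof (induction rule: modular_equiv.induct)
  case (modular_equiv_minus z w)
  thus ?case using assms(1)[of "w - 1"] modular_equiv_Im_pos[of z w] by simp
qed (use assms modular_equiv_Im_pos in auto)

lemma modular_equiv_matrix:
  "modular_equiv z w \<Longrightarrow> Im z > 0 \<Longrightarrow>
     \<exists>a b c d :: int. a * d - b * c = 1 \<and> w * (of_int c * z + of_int d) = of_int a * z + of_int b"
proof (induction rule: modular_equiv.induct)
  case (modular_equiv_refl z)
  show ?case by (rule exI[of _ 1], rule exI[of _ 0], rule exI[of _ 0], rule exI[of _ 1]) simp
next
  case (modular_equiv_plus z w)
  then obtain a b c d :: int where "a * d - b * c = 1" "w * (of_int c * z + of_int d) = of_int a * z + of_int b" by auto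
  thus ?case
    by (intro exI[of _ "a + c"] exI[of _ "b + d"] exI[of _ c] exI[of _ d]) (auto simp: algebra_simps)
next
  case (modular_equiv_minus z w)
  then obtain a b c d :: int where "a * d - b * c = 1" "w * (of_int c * z + of_int d) = of_int a * z + of_int b" by auto
  thus ?case
    by (intro exI[of _ "a - c"] exI[of _ "b - d"] exI[of _ c] exI[of _ d]) (auto simp: algebra_simps)
next
  case (modular_equiv_inversion z w)
  then obtain a b c d :: int where *: "a * d - b * c = 1" "w * (of_int c * z + of_int d) = of_int a * z + of_int b" by auto
  have "w \<noteq> 0" using modular_equiv_Im_pos[OF modular_equiv_inversion.hyps modular_equiv_inversion.prems] by auto
  hence "- (1 / w) * (of_int a * z + of_int b) = - (of_int c * z + of_int d)"
    unfolding *(2)[symmetric] by simp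
  thus ?case using *(1)
    by (intro exI[of _ "- c"] exI[of _ "- d"] exI[of _ a] exI[of _ b]) (auto simp: algebra_simps)
qed

lemma modular_equiv_Im:
  assumes "modular_equiv z w" "Im z > 0"
  obtains c d :: int where "(c, d) \<noteq> (0, 0)" "Im w = Im z / cmod (of_int c * z + of_int d) ^ 2"
proof -
  obtain a b c d :: int where *: "a * d - b * c = 1" "w * (of_int c * z + of_int d) = of_int a * z + of_int b"
    using modular_equiv_matrix[OF assms] by blast
  have cd: "(c, d) \<noteq> (0, 0)" using *(1) by auto
  let ?u = "of_int c * z + of_int d :: complex"
  have u: "?u \<noteq> 0"
  proof
    assume "?u = 0"
    hence "Im ?u = 0" "Re ?u = 0" by auto
    thus False using cd assms(2) by auto
  qed
  have "w = (of_int a * z + of_int b) / ?u" using *(2) u by (simp add: field_simps)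
  also have "Im \<dots> = (of_int (a * d - b * c) * Im z) / cmod ?u ^ 2"
    by (simp add: Im_divide cmod_power2 algebra_simps)
  finally have "Im w = Im z / cmod ?u ^ 2" using *(1) by simp
  with cd that show thesis by blast
qed

text \<open>
  From \<open>Im w = Im z / \<bar>c * z + d\<bar>\<^sup>2\<close>, where \<open>\<bar>c * z + d\<bar>\<close> is at least 1 if \<open>c = 0\<close> and at least \<open>Im z\<close>
  otherwise. It keeps the reduction of a point of a horizontal strip inside the strip.
\<close>

lemma modular_equiv_Im_le:
  assumes "modular_equiv z w" "Im z > 0"
  shows "Im w \<le> max (Im z) (1 / Im z)"
proof -
  obtain c d :: int where cd: "(c, d) \<noteq> (0, 0)" "Im w = Im z / cmod (of_int c * z + of_int d) ^ 2"
    using modular_equiv_Im[OF assms] .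
  show ?thesis
  proof (cases "c = 0")
    case True
    hence "1 \<le> \<bar>real_of_int d\<bar>" using cd by auto
    hence "1 \<le> \<bar>real_of_int d\<bar> ^ 2" using one_le_power by blast
    hence "Im w \<le> Im z / 1" unfolding cd(2) using True assms by (intro divide_left_mono) auto
    thus ?thesis by simp
  next
    case False
    hence "1 \<le> \<bar>real_of_int c\<bar>" by auto
    hence "Im z \<le> \<bar>real_of_int c\<bar> * Im z" using assms by simp
    also have "\<dots> = \<bar>Im (of_int c * z + of_int d)\<bar>" using assms by (simp add: abs_mult)
    also have "\<dots> \<le> cmod (of_int c * z + of_int d)" by (rule abs_Im_le_cmod)
    finally have "Im z ^ 2 \<le> cmod (of_int c * z + of_int d) ^ 2" using assms by (intro power_mono) auto
    hence "Im w \<le> Im z / Im z ^ 2" unfolding cd(2) using assms by (intro divide_left_mono) (auto intro!: mult_pos_pos simp: zero_less_power2 intro: less_le_trans[of _ "Im z ^ 2"])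
    also have "\<dots> = 1 / Im z" using assms by (simp add: power2_eq_square)
    finally show ?thesis by simp
  qed
qed

lemma exists_translate:
  obtains n :: int where "\<bar>Re (w + of_int n)\<bar> \<le> 1 / 2"
proof -
  have "\<bar>Re w - of_int (round (Re w))\<bar> \<le> 1 / 2" using of_int_round_abs_le[of "Re w"] by (simp add: abs_minus_commute)
  thus thesis by (intro that[of "- round (Re w)"]) simp
qed

text \<open>
  Only finitely many heights \<open>Im w \<ge> Im z\<close> occur among the points \<open>w\<close> equivalent to \<open>z\<close>. A point of maximal
  height, translated to \<open>\<bar>Re w\<bar> \<le> 1 / 2\<close>, satisfies \<open>\<bar>w\<bar> \<ge> 1\<close>, because the inversion would raise it
  otherwise. The constant 0.86 is a lower approximation of \<open>sqrt 3 / 2\<close>.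
\<close>

lemma fundamental_domain:
  assumes z: "Im z > 0"
  obtains w where "modular_equiv z w" "Im w > 0" "\<bar>Re w\<bar> \<le> 1 / 2" "cmod w \<ge> 1" "Im w \<ge> 0.86"
proof -
  define P where "P = {p :: int \<times> int. cmod (of_int (fst p) * z + of_int (snd p)) \<le> 1}"
  define V where "V = {y. \<exists>w. modular_equiv z w \<and> y = Im w \<and> Im w \<ge> Im z}"
  define N where "N = \<lceil>1 / Im z\<rceil>"
  define M where "M = \<lceil>1 + of_int N * cmod z\<rceil>"
  have "P \<subseteq> {-N..N} \<times> {-M..M}"
  proof
    fix p assume "p \<in> P"
    obtain c d where [simp]: "p = (c, d)" by force
    have le: "cmod (of_int c * z + of_int d) \<le> 1" using \<open>p \<in> P\<close> by (simp add: P_def)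
    have "\<bar>real_of_int c\<bar> * Im z = \<bar>Im (of_int c * z + of_int d)\<bar>" using z by (simp add: abs_mult)
    also have "\<dots> \<le> 1" using abs_Im_le_cmod le order_trans by blast
    finally have "\<bar>real_of_int c\<bar> \<le> 1 / Im z" using z by (simp add: field_simps)
    also have "\<dots> \<le> of_int N" by (simp add: N_def)
    finally have c: "\<bar>real_of_int c\<bar> \<le> of_int N" .
    have "\<bar>real_of_int d\<bar> = cmod (of_int c * z + of_int d - of_int c * z)" by simp
    also have "\<dots> \<le> cmod (of_int c * z + of_int d) + cmod (of_int c * z)" by (rule norm_triangle_ineq4)
    also have "\<dots> \<le> 1 + of_int N * cmod z" using le c by (intro add_mono) (auto simp: norm_mult intro!: mult_right_mono)
    also have "\<dots> \<le> of_int M" by (simp add: M_def)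
    finally have d: "\<bar>real_of_int d\<bar> \<le> of_int M" .
    show "p \<in> {-N..N} \<times> {-M..M}" using c d by auto
  qed
  hence "finite P" by (rule finite_subset) auto
  moreover have "V \<subseteq> (\<lambda>p. Im z / cmod (of_int (fst p) * z + of_int (snd p)) ^ 2) ` P"
  proof
    fix y assume "y \<in> V"
    then obtain w where w: "modular_equiv z w" "y = Im w" "Im w \<ge> Im z" by (auto simp: V_def)
    obtain c d :: int where cd: "(c, d) \<noteq> (0, 0)" "Im w = Im z / cmod (of_int c * z + of_int d) ^ 2"
      using modular_equiv_Im[OF w(1) z] .
    have nz: "cmod (of_int c * z + of_int d) > 0" using cd(2) w(3) z by (cases "of_int c * z + of_int d = 0") auto
    have "cmod (of_int c * z + of_int d) ^ 2 \<le> 1"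
      using w(3) z nz unfolding cd(2) by (simp add: le_divide_eq)
    hence "cmod (of_int c * z + of_int d) \<le> 1" by (simp add: power_le_one_iff)
    hence "(c, d) \<in> P" by (simp add: P_def)
    thus "y \<in> (\<lambda>p. Im z / cmod (of_int (fst p) * z + of_int (snd p)) ^ 2) ` P"
      using w(2) cd(2) by (intro image_eqI[of _ _ "(c, d)"]) auto
  qed
  ultimately have fin: "finite V" by (meson finite_imageI finite_subset)
  have ne: "V \<noteq> {}" using modular_equiv_refl by (auto simp: V_def)
  obtain w0 where w0: "modular_equiv z w0" "Max V = Im w0" "Im w0 \<ge> Im z" using Max_in[OF fin ne] by (auto simp: V_def)
  obtain n :: int where n: "\<bar>Re (w0 + of_int n)\<bar> \<le> 1 / 2" by (rule exists_translate)
  define w where "w = w0 + of_int n"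
  have w: "modular_equiv z w" unfolding w_def by (rule modular_equiv_plus_int[OF w0(1)])
  have pos: "Im w > 0" using modular_equiv_Im_pos[OF w z] .
  have norm: "cmod w \<ge> 1"
  proof (rule ccontr)
    assume "\<not> cmod w \<ge> 1"
    hence less: "cmod w ^ 2 < 1" by (simp add: power_less_one_iff)
    have nz: "cmod w ^ 2 > 0" using pos by auto
    have "Im w < Im (- (1 / w))" unfolding Im_inversion using less nz pos by (simp add: less_divide_eq)
    moreover have "Im (- (1 / w)) \<in> V"
      using modular_equiv_inversion[OF w] calculation w0(3) by (auto simp: V_def w_def)
    hence "Im (- (1 / w)) \<le> Im w0" using Max_ge[OF fin] w0(2) by metis
    ultimately show False by (simp add: w_def)
  qed
  have "Im w ^ 2 \<ge> 3 / 4"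
  proof -
    have "1 \<le> cmod w ^ 2" using norm by (simp add: power2_ge_1_iff)
    moreover have "Re w ^ 2 \<le> (1 / 2) ^ 2" using n unfolding abs_le_square_iff[symmetric] w_def by simp
    ultimately show ?thesis unfolding cmod_power2 by (simp add: power2_eq_square)
  qed
  hence "Im w \<ge> 0.86" using pos by (intro power2_le_imp_le[of "0.86"]) (auto simp: power2_eq_square)
  with w pos n norm show thesis by (intro that[of w]) (auto simp: w_def)
qed



section \<open>Vanishing of modular forms and the maximum principle\<close>

text \<open>
  Modular forms of weight \<open>k\<close> that vanish to order \<open>n\<close> at the cusp; the second conjunct contains the
  invariance under translation.
\<close>

definition mform :: "nat \<Rightarrow> nat \<Rightarrow> (complex \<Rightarrow> complex) \<Rightarrow> bool" where
  "mform k n f \<longleftrightarrow> (\<forall>z. Im z > 0 \<longrightarrow> f (- (1 / z)) = z ^ k * f z) \<and> cusp_order n f"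

text \<open>
  The function \<open>\<bar>f z\<bar>\<^sup>2 * Im z ^ k\<close> is invariant and tends to 0 at the cusp, so unless it is identically 0
  it has a maximum at some \<open>z0\<close> of height \<open>y0 \<ge> 0.86\<close>. The resulting bound for \<open>\<bar>f\<bar>\<close> on the line of height
  0.85 is propagated upwards by the maximum modulus principle. At \<open>z0\<close> this gives a bound for \<open>\<bar>f z0\<bar>\<^sup>2\<close> that
  differs from its value by the factor \<open>(y0 / 0.85) ^ k * exp (- 4 * pi * n * (y0 - 0.85))\<close>, which is less than 1 for
  \<open>k < 10 * n\<close>: a contradiction. The pairs \<open>(k, n)\<close> that occur below are \<open>(0, 1)\<close>, \<open>(12, 2)\<close> and
  \<open>(28, 3)\<close>.
\<close>

lemma mform_vanishes:
  assumes f: "mform k n f" and kn: "k < 10 * n" and z: "Im z > 0"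
  shows "f z = 0"
proof (rule ccontr)
  assume fz: "f z \<noteq> 0"
  have cusp: "cusp_order n f" and inv: "\<And>z. Im z > 0 \<Longrightarrow> f (- (1 / z)) = z ^ k * f z"
    using f by (auto simp: mform_def)
  have n: "n > 0" using kn by auto
  define \<phi> where "\<phi> = (\<lambda>z. cmod (f z) ^ 2 * Im z ^ k)"
  have \<phi>_nonneg: "\<phi> z \<ge> 0" if "Im z > 0" for z using that by (simp add: \<phi>_def)
  have \<phi>_pos: "\<phi> z > 0" using fz z by (simp add: \<phi>_def)
  have \<phi>_plus: "\<phi> (z + 1) = \<phi> z" if "Im z > 0" for z
    using cusp_order_periodic[OF cusp that] by (simp add: \<phi>_def)
  have \<phi>_inv: "\<phi> (- (1 / z)) = \<phi> z" if "Im z > 0" for z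
  proof -
    have "cmod z \<noteq> 0" using that by auto
    thus ?thesis unfolding \<phi>_def Im_inversion inv[OF that]
      by (simp add: norm_mult norm_power power_divide power_mult_distrib flip: power_mult)
         (simp add: mult.commute)
  qed
  have \<phi>_modular_equiv: "\<phi> w = \<phi> z" if "modular_equiv z w" "Im z > 0" for z w
    using modular_equiv_invariant[of \<phi>, OF \<phi>_plus \<phi>_inv that] by simp
  obtain C where C: "C \<ge> 0" "\<And>z. Im z \<ge> 1 \<Longrightarrow> cmod (f z) \<le> C * exp (- 2 * pi * n * Im z)"
    using cusp_order_bound[OF cusp, of 1] by auto
  have "((\<lambda>y::real. (C * exp (- y)) ^ 2 * y ^ k) \<longlongrightarrow> 0) at_top"
  proof -
    have "((\<lambda>y::real. C ^ 2 * exp (- y)) \<longlongrightarrow> 0) at_top" by real_asymp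
    from tendsto_mult[OF this tendsto_power_div_exp_0[of k]] show ?thesis
      by (simp add: power_mult_distrib power2_eq_square exp_minus divide_inverse mult_ac)
  qed
  hence "\<forall>\<^sub>F y in at_top. (C * exp (- y)) ^ 2 * y ^ k < \<phi> z" using \<phi>_pos by (rule order_tendstoD)
  then obtain Y0 where Y0: "\<And>y. y \<ge> Y0 \<Longrightarrow> (C * exp (- y)) ^ 2 * y ^ k < \<phi> z"
    by (auto simp: eventually_at_top_linorder)
  define Y where "Y = max 1 Y0"
  have small: "\<phi> w < \<phi> z" if "Im w \<ge> Y" for w
  proof -
    have w: "Im w \<ge> 1" "Im w \<ge> Y0" using that by (auto simp: Y_def)
    have "1 * 1 \<le> 2 * pi * real n" using pi_gt3 n by (intro mult_mono) auto
    hence "1 * Im w \<le> 2 * pi * real n * Im w" using w by (intro mult_right_mono) auto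
    hence "exp (- 2 * pi * n * Im w) \<le> exp (- Im w)" by simp
    hence "cmod (f w) \<le> C * exp (- Im w)"
      using C(2)[OF w(1)] C(1) by (meson mult_left_mono order_trans)
    hence "\<phi> w \<le> (C * exp (- Im w)) ^ 2 * Im w ^ k"
      unfolding \<phi>_def using w by (intro mult_right_mono power_mono) auto
    with Y0[OF w(2)] show ?thesis by linarith
  qed
  define K where "K = cbox (Complex (-1/2) 0.86) (Complex (1/2) Y)"
  have K: "w \<in> K \<longleftrightarrow> \<bar>Re w\<bar> \<le> 1 / 2 \<and> 0.86 \<le> Im w \<and> Im w \<le> Y" for w
    by (auto simp: K_def in_cbox_complex_iff)
  have "continuous_on upper_half_plane f"
    by (intro holomorphic_on_imp_continuous_on cusp_order_holomorphic[OF cusp])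
  hence cont: "continuous_on K \<phi>" unfolding \<phi>_def
    by (intro continuous_intros) (auto elim!: continuous_on_subset simp: K upper_half_plane_def)
  have "Complex 0 1 \<in> K" by (simp add: K Y_def)
  hence "\<exists>z0\<in>K. \<forall>w\<in>K. \<phi> w \<le> \<phi> z0"
    by (intro continuous_attains_sup cont) (auto simp: K_def)
  then obtain z0 where z0: "z0 \<in> K" "\<And>w. w \<in> K \<Longrightarrow> \<phi> w \<le> \<phi> z0" by blast
  have le: "\<phi> w \<le> max (\<phi> z0) (\<phi> z) \<and> (\<phi> w \<le> \<phi> z0 \<or> \<phi> w < \<phi> z)" if w: "Im w > 0" for w
  proof -
    obtain u where u: "modular_equiv w u" "Im u > 0" "\<bar>Re u\<bar> \<le> 1 / 2" "cmod u \<ge> 1" "Im u \<ge> 0.86"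
      using fundamental_domain[OF w] .
    have "\<phi> u \<le> \<phi> z0 \<or> \<phi> u < \<phi> z"
      by (cases "Im u \<ge> Y") (use small z0(2)[of u] u in \<open>auto simp: K\<close>)
    thus ?thesis using \<phi>_modular_equiv[OF u(1) w] by auto
  qed
  have "\<phi> z \<le> \<phi> z0" using le[OF z] by auto
  hence max: "\<phi> w \<le> \<phi> z0" if "Im w > 0" for w using le[OF that] by auto
  define y0 where "y0 = Im z0"
  have y0: "y0 \<ge> 0.86" using z0(1) by (simp add: K y0_def)
  have fz0: "cmod (f z0) > 0" using \<phi>_pos \<open>\<phi> z \<le> \<phi> z0\<close> by (auto simp: \<phi>_def)
  \<comment> \<open>The line of height 0.85 lies just below all reduced points.\<close>
  define B where "B = sqrt (\<phi> z0 / 0.85 ^ k)"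
  have "cmod (f w) \<le> B" if "Im w = 0.85" for w
    using max[of w] that by (auto simp: B_def \<phi>_def field_simps intro!: real_le_rsqrt)
  hence "cmod (f z0) \<le> B * exp (- 2 * pi * n * (Im z0 - 0.85))"
    by (intro cusp_order_max_modulus[OF cusp]) (use y0 in \<open>auto simp: y0_def\<close>)
  hence "cmod (f z0) ^ 2 \<le> (B * exp (- 2 * pi * n * (y0 - 0.85))) ^ 2"
    by (intro power_mono) (auto simp: y0_def)
  also have "\<dots> = B ^ 2 * exp (- 4 * pi * n * (y0 - 0.85))"
    by (simp add: power_mult_distrib exp_of_nat_mult[symmetric] mult_ac flip: exp_double)
  also have "B ^ 2 = cmod (f z0) ^ 2 * (y0 / 0.85) ^ k"
    using \<phi>_nonneg[of z0] y0 by (simp add: B_def \<phi>_def y0_def power_divide)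
  finally have "1 \<le> (y0 / 0.85) ^ k * exp (- 4 * pi * n * (y0 - 0.85))"
    using fz0 by simp
  also have "\<dots> \<le> exp (y0 / 0.85 - 1) ^ k * exp (- 4 * pi * n * (y0 - 0.85))"
    using exp_ge_add_one_self[of "y0 / 0.85 - 1"] y0 by (intro mult_right_mono power_mono) auto
  also have "\<dots> = exp ((y0 - 0.85) * (k / 0.85 - 4 * pi * n))"
    by (simp add: exp_of_nat_mult[symmetric] field_simps flip: exp_add)
  also have "\<dots> < 1"
  proof -
    have "real k / 0.85 < 12 * real n" using kn by simp
    also have "12 * real n \<le> 4 * pi * real n" using pi_gt3 by (intro mult_right_mono) auto
    finally have "(y0 - 0.85) * (k / 0.85 - 4 * pi * n) < 0" using y0 by (intro mult_pos_neg) auto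
    thus ?thesis by simp
  qed
  finally show False by simp
qed

lemma mform_0_const:
  assumes "mform 0 0 f"
  shows "\<exists>c. \<forall>z. Im z > 0 \<longrightarrow> f z = c"
proof -
  obtain g where g: "g holomorphic_on ball 0 1" "\<And>z. Im z > 0 \<Longrightarrow> f z = g (qexp z)"
    using assms by (auto simp: cusp_order_def mform_def)
  have "cusp_order (Suc 0) (\<lambda>z. f z - g 0)"
    by (rule cusp_order_Suc[where g = "\<lambda>w. g w - g 0"]) (use g in \<open>auto intro!: holomorphic_intros\<close>)
  hence "mform 0 1 (\<lambda>z. f z - g 0)" using assms by (simp add: mform_def)
  hence "f z = g 0" if "Im z > 0" for z using mform_vanishes[of 0 1 "\<lambda>z. f z - g 0" z] that by simp
  thus ?thesis by blast
qed

text \<open>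
  On the strip \<open>0.8 \<le> Im z \<le> T\<close> the maximum of \<open>\<bar>h\<bar>\<close> is attained by periodicity. The reduced
  representative of the maximal point has height at least 0.86, and at most \<open>max T (1 / 0.8) = T\<close>. So it
  lies on the upper boundary line, or it is an interior maximum and \<open>h\<close> is constant.
\<close>

lemma invariant_max_modulus:
  assumes hol: "h holomorphic_on upper_half_plane"
      and plus: "\<And>z. Im z > 0 \<Longrightarrow> h (z + 1) = h z"
      and inv: "\<And>z. Im z > 0 \<Longrightarrow> h (- (1 / z)) = h z"
      and T: "T \<ge> 1.25" and B: "\<And>z. Im z = T \<Longrightarrow> cmod (h z) \<le> B"
      and z: "0.8 \<le> Im z" "Im z \<le> T"
  shows "cmod (h z) \<le> B"
proof -
  define K where "K = cbox (Complex (-1/2) 0.8) (Complex (1/2) T)"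
  have K: "w \<in> K \<longleftrightarrow> \<bar>Re w\<bar> \<le> 1 / 2 \<and> 0.8 \<le> Im w \<and> Im w \<le> T" for w
    by (auto simp: K_def in_cbox_complex_iff)
  have cont: "continuous_on upper_half_plane h"
    by (intro holomorphic_on_imp_continuous_on hol)
  have "Complex 0 1 \<in> K" using T by (simp add: K)
  moreover have "continuous_on K (\<lambda>w. cmod (h w))"
    by (intro continuous_intros continuous_on_subset[OF cont]) (auto simp: K upper_half_plane_def)
  ultimately have "\<exists>z0\<in>K. \<forall>w\<in>K. cmod (h w) \<le> cmod (h z0)"
    by (intro continuous_attains_sup) (auto simp: K_def)
  then obtain z0 where z0: "z0 \<in> K" "\<And>w. w \<in> K \<Longrightarrow> cmod (h w) \<le> cmod (h z0)" by blast
  have z0': "Im z0 > 0" using z0(1) by (simp add: K)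
  have all: "cmod (h w) \<le> cmod (h z0)" if w: "0.8 \<le> Im w" "Im w \<le> T" for w
  proof -
    obtain n :: int where n: "\<bar>Re (w + of_int n)\<bar> \<le> 1 / 2" by (rule exists_translate)
    have "h (w + of_int n) = h w" using periodic_of_int[of h, OF plus] w by simp
    moreover have "w + of_int n \<in> K" using n w by (simp add: K)
    ultimately show ?thesis using z0(2)[of "w + of_int n"] by simp
  qed
  obtain w where w: "modular_equiv z0 w" "Im w > 0" "\<bar>Re w\<bar> \<le> 1 / 2" "cmod w \<ge> 1" "Im w \<ge> 0.86"
    using fundamental_domain[OF z0'] .
  have hw: "h w = h z0" using modular_equiv_invariant[of h, OF plus inv w(1) z0'] by simp
  have "1 / Im z0 \<le> 1 / 0.8" using z0(1) by (intro divide_left_mono) (auto simp: K)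
  hence "Im w \<le> T" using modular_equiv_Im_le[OF w(1) z0'] z0(1) T by (auto simp: K)
  have "cmod (h z0) \<le> B"
  proof (cases "Im w = T")
    case True
    thus ?thesis using B[of w] hw by simp
  next
    case False
    hence wT: "Im w < T" using \<open>Im w \<le> T\<close> by simp
    define U where "U = {z. Im z > 0.8} \<inter> {z. Im z < T}"
    have "h constant_on U"
    proof (rule maximum_modulus_principle)
      show "h holomorphic_on U" by (rule holomorphic_on_subset[OF hol]) (auto simp: U_def upper_half_plane_def)
      show "open U" unfolding U_def by (intro open_Int open_halfspace_Im_gt open_halfspace_Im_lt)
      thus "open U" .
      show "connected U" unfolding U_def
        by (intro convex_connected convex_Int convex_halfspace_Im_gt convex_halfspace_Im_lt)
      show "w \<in> U" using w wT by (simp add: U_def)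
      show "cmod (h u) \<le> cmod (h w)" if "u \<in> U" for u using all[of u] that by (simp add: U_def hw)
    qed auto
    then obtain c where c: "\<And>u. u \<in> U \<Longrightarrow> h u = c" by (auto simp: constant_on_def)
    have "((\<lambda>t. h (Complex 0 t)) \<longlongrightarrow> h (Complex 0 T)) (at_left T)"
    proof -
      have "isCont h (Complex 0 T)"
        using cont open_upper_half_plane T by (auto simp: continuous_on_eq_continuous_at upper_half_plane_def)
      moreover have "((\<lambda>t. Complex 0 t) \<longlongrightarrow> Complex 0 T) (at_left T)" by (intro tendsto_intros)
      ultimately show ?thesis by (rule isCont_tendsto_compose)
    qed
    moreover have "\<forall>\<^sub>F t in at_left T. h (Complex 0 t) = c"
      unfolding eventually_at_left_field
      by (rule exI[of _ "0.8"]) (use T c in \<open>auto simp: U_def\<close>)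
    ultimately have "h (Complex 0 T) = c"
      by (metis tendsto_eventually tendsto_unique trivial_limit_at_left_real)
    also have "c = h z0" using c[of w] w wT hw by (simp add: U_def)
    finally show ?thesis using B[of "Complex 0 T"] by simp
  qed
  with all[OF z] show ?thesis by simp
qed

section \<open>The discriminant\<close>

lemma norm_eisenstein_G_le_1:
  assumes "r \<ge> 2" "Im z \<ge> 1"
  shows "cmod (eisenstein_G (2 * r) z) \<le> 17.5"
proof -
  obtain n :: int where n: "\<bar>Re (z + of_int n)\<bar> \<le> 1 / 2" by (rule exists_translate)
  have "eisenstein_G (2 * r) (z + of_int n) = eisenstein_G (2 * r) z"
    using periodic_of_int[of "eisenstein_G (2 * r)" z n] eisenstein_G_plus1 assms by simp
  moreover have "cmod (z + of_int n) \<ge> 1" using abs_Im_le_cmod[of "z + of_int n"] assms by simp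
  ultimately show ?thesis using norm_eisenstein_G_le[OF assms(1) n] by simp
qed

text \<open>
  The boundedness of the Eisenstein series gives the expansion in \<open>q\<close>; its constant term is the limit along
  the imaginary axis.
\<close>

lemma eisenstein_G_cusp:
  assumes "r \<ge> 2"
  obtains g where "g holomorphic_on ball 0 1" "\<And>z. Im z > 0 \<Longrightarrow> eisenstein_G (2 * r) z = g (qexp z)"
      "g 0 = of_real (2 * zeta_nat (2 * r))"
proof -
  have "cusp_order 0 (eisenstein_G (2 * r))"
    by (rule cusp_orderI[of _ 1 "17.5"])
       (use assms holomorphic_eisenstein_G eisenstein_G_plus1 norm_eisenstein_G_le_1 in auto)
  then obtain g where g: "g holomorphic_on ball 0 1" "\<And>z. Im z > 0 \<Longrightarrow> eisenstein_G (2 * r) z = g (qexp z)"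
    by (auto simp: cusp_order_def)
  have "((\<lambda>y::real. qexp (\<i> * of_real y)) \<longlongrightarrow> 0) at_top"
  proof (rule Lim_null_comparison)
    show "\<forall>\<^sub>F y in at_top. norm (qexp (\<i> * of_real y)) \<le> exp (- 2 * pi * y)" by (simp add: norm_qexp)
    show "((\<lambda>y::real. exp (- 2 * pi * y)) \<longlongrightarrow> 0) at_top" by real_asymp
  qed
  moreover have "isCont g 0"
    using holomorphic_on_imp_continuous_on[OF g(1)] by (simp add: continuous_on_eq_continuous_at)
  ultimately have "((\<lambda>y::real. g (qexp (\<i> * of_real y))) \<longlongrightarrow> g 0) at_top" by (rule isCont_tendsto_compose[rotated])
  moreover have "\<forall>\<^sub>F y in at_top. g (qexp (\<i> * of_real y)) = eisenstein_G (2 * r) (\<i> * of_real y)"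
    using eventually_gt_at_top[of "0::real"] by eventually_elim (use g(2) in auto)
  ultimately have "((\<lambda>y::real. eisenstein_G (2 * r) (\<i> * of_real y)) \<longlongrightarrow> g 0) at_top"
    by (rule Lim_transform_eventually)
  hence "g 0 = of_real (2 * zeta_nat (2 * r))"
    using eisenstein_G_tendsto[OF assms] by (rule tendsto_unique[rotated]) auto
  with g that show thesis by blast
qed

definition disc :: "complex \<Rightarrow> complex" where
  "disc z = (60 * eisenstein_G 4 z) ^ 3 - 27 * (140 * eisenstein_G 6 z) ^ 2"

lemma modular_j_eq: "modular_j z = 1728 * (60 * eisenstein_G 4 z) ^ 3 / disc z"
  by (simp add: modular_j_def disc_def Let_def)

text \<open>
  The constant term of the discriminant is a multiple of
  \<open>(120 * \<zeta>(4)) ^ 3 - 27 * (280 * \<zeta>(6))\<^sup>2\<close>, which vanishes by the values of the zeta function.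
\<close>

lemma mform_disc: "mform 12 1 disc"
proof -
  obtain a where a: "a holomorphic_on ball 0 1" "\<And>z. Im z > 0 \<Longrightarrow> eisenstein_G 4 z = a (qexp z)"
      "a 0 = of_real (2 * zeta_nat 4)"
    using eisenstein_G_cusp[of 2] by auto
  obtain b where b: "b holomorphic_on ball 0 1" "\<And>z. Im z > 0 \<Longrightarrow> eisenstein_G 6 z = b (qexp z)"
      "b 0 = of_real (2 * zeta_nat 6)"
    using eisenstein_G_cusp[of 3] by auto
  define g where "g = (\<lambda>w. (60 * a w) ^ 3 - 27 * (140 * b w) ^ 2)"
  have "g 0 = of_real ((120 * zeta_nat 4) ^ 3 - 27 * (280 * zeta_nat 6) ^ 2)"
    by (simp add: g_def a b)
  also have "(120 * zeta_nat 4) ^ 3 - 27 * (280 * zeta_nat 6) ^ 2 = 0"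
    unfolding zeta_nat_4 zeta_nat_6 by (simp add: power_mult_distrib power_divide flip: power_mult)
  finally have g0: "g 0 = 0" by simp
  have "cusp_order (Suc 0) disc"
    by (rule cusp_order_Suc[where g = g]) (use g0 in \<open>auto simp: g_def disc_def a b intro!: holomorphic_intros\<close>)
  moreover have "disc (- (1 / z)) = z ^ 12 * disc z" if "Im z > 0" for z
  proof -
    have "z \<noteq> 0" using that by auto
    thus ?thesis unfolding disc_def
      by (simp add: eisenstein_G_inversion power_mult_distrib algebra_simps flip: power_mult)
  qed
  ultimately show ?thesis by (simp add: mform_def)
qed

lemma disc_plus1: "disc (z + 1) = disc z"
  by (simp add: disc_def eisenstein_G_plus1)

lemma disc_inversion: "Im z > 0 \<Longrightarrow> disc (- (1 / z)) = z ^ 12 * disc z"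
  using mform_disc by (simp add: mform_def)

lemma norm_disc_ii: "cmod (disc \<i>) \<ge> 460000"
proof -
  have "(60 * 1.29) ^ 3 \<le> (60 * cmod (eisenstein_G 4 \<i>)) ^ 3"
    using norm_eisenstein_G4_ii by (intro power_mono) auto
  thus ?thesis by (simp add: disc_def eisenstein_G6_ii norm_power norm_mult power3_eq_cube)
qed

text \<open>
  If the discriminant vanished to order 2 at the cusp, then it would be a form with \<open>(k, n) = (12, 2)\<close> and
  hence zero, but it does not vanish at \<open>\<i>\<close>.
\<close>

lemma disc_cusp_simple:
  obtains h where "h holomorphic_on ball 0 1" "\<And>z. Im z > 0 \<Longrightarrow> disc z = qexp z * h (qexp z)" "h 0 \<noteq> 0"
proof -
  obtain h where h: "h holomorphic_on ball 0 1" "\<And>z. Im z > 0 \<Longrightarrow> disc z = qexp z ^ 1 * h (qexp z)"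
    using mform_disc by (auto simp: mform_def cusp_order_def)
  have "h 0 \<noteq> 0"
  proof
    assume "h 0 = 0"
    hence "cusp_order (Suc 1) disc" by (rule cusp_order_Suc[OF h(1)]) (use h(2) in auto)
    hence "mform 12 2 disc" using mform_disc by (simp add: mform_def numeral_2_eq_2)
    hence "disc \<i> = 0" by (rule mform_vanishes) auto
    thus False using norm_disc_ii by simp
  qed
  with h that show thesis by simp
qed

lemma DERIV_q_series:
  assumes "h holomorphic_on ball 0 1" "Im z > 0"
  shows "((\<lambda>z. qexp z * h (qexp z)) has_field_derivative
           (2 * of_real pi * \<i> * (qexp z * (h (qexp z) + qexp z * deriv h (qexp z))))) (at z)"
proof -
  have q: "(qexp has_field_derivative 2 * of_real pi * \<i> * qexp z) (at z)"
    unfolding qexp_def[abs_def] by (auto intro!: derivative_eq_intros)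
  have "(h has_field_derivative deriv h (qexp z)) (at (qexp z))"
    using assms norm_qexp_less_1 by (intro holomorphic_derivI[of h "ball 0 1"]) auto
  from DERIV_chain2[OF this q] show ?thesis
    by (auto intro!: derivative_eq_intros q simp: algebra_simps)
qed

lemma DERIV_comp_inversion:
  assumes "(f has_field_derivative D) (at (- (1 / z)))" "z \<noteq> 0"
  shows "((\<lambda>z. f (- (1 / z))) has_field_derivative D / z ^ 2) (at z)"
proof -
  have "((\<lambda>z. - (1 / z)) has_field_derivative 1 / z ^ 2) (at z)"
    using assms(2) by (auto intro!: derivative_eq_intros simp: power2_eq_square)
  from DERIV_chain2[OF assms(1) this] show ?thesis by simp
qed

lemma DERIV_unique_upper_half_plane:
  assumes "(f has_field_derivative D) (at z)" "(g has_field_derivative E) (at z)"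
      and "\<And>w. Im w > 0 \<Longrightarrow> f w = g w" "Im z > 0"
  shows "D = E"
proof (rule DERIV_unique)
  show "(f has_field_derivative D) (at z)" by fact
  show "(f has_field_derivative E) (at z)"
    by (rule has_field_derivative_transform_within_open[OF assms(2) open_upper_half_plane])
       (use assms in \<open>auto simp: upper_half_plane_def\<close>)
qed

text \<open>
  Up to a factor the left-hand side is the second Rankin--Cohen bracket \<open>12 * \<Delta> * \<Delta>'' - 13 * \<Delta>'\<^sup>2\<close> of the
  discriminant with itself: the terms by which \<open>\<Delta>'\<close> and \<open>\<Delta>''\<close> fail to be modular cancel, and it has weight
  28. Both this form and \<open>G\<^sub>4 * \<Delta>\<^sup>2\<close> vanish to order 2 at the cusp. The combination that removes the
  coefficient of \<open>q\<^sup>2\<close> has weight 28 and order 3, so it is zero.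
\<close>

lemma disc_bracket:
  obtains f1 f2 lam where
    "\<And>z. Im z > 0 \<Longrightarrow> (disc has_field_derivative f1 z) (at z)"
    "\<And>z. Im z > 0 \<Longrightarrow> (f1 has_field_derivative f2 z) (at z)"
    "\<And>z. Im z > 0 \<Longrightarrow> disc z * f2 z - 13 / 12 * f1 z ^ 2 = lam * (eisenstein_G 4 z * disc z ^ 2)"
proof -
  obtain h where h: "h holomorphic_on ball 0 1" "\<And>z. Im z > 0 \<Longrightarrow> disc z = qexp z * h (qexp z)" "h 0 \<noteq> 0"
    by (rule disc_cusp_simple, rule that, assumption, blast, assumption)
  obtain e where e: "e holomorphic_on ball 0 1" "\<And>z. Im z > 0 \<Longrightarrow> eisenstein_G 4 z = e (qexp z)"
      "e 0 = of_real (2 * zeta_nat 4)"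
    using eisenstein_G_cusp[of 2] by auto
  have e0: "e 0 \<noteq> 0" using zeta_nat_ge_1[of 4] e(3) by auto
  define c where "c = 2 * of_real pi * \<i>"
  define D1 where "D1 = (\<lambda>w. h w + w * deriv h w)"
  define D2 where "D2 = (\<lambda>w. D1 w + w * deriv D1 w)"
  have D1: "D1 holomorphic_on ball 0 1" unfolding D1_def using h(1) by (intro holomorphic_intros) auto
  have D2: "D2 holomorphic_on ball 0 1" unfolding D2_def using D1 by (intro holomorphic_intros) auto
  define f1 where "f1 = (\<lambda>z. c * (qexp z * D1 (qexp z)))"
  define f2 where "f2 = (\<lambda>z. c * (c * (qexp z * D2 (qexp z))))"
  have f1: "(disc has_field_derivative f1 z) (at z)" if "Im z > 0" for z
    unfolding f1_def D1_def c_def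
    by (rule has_field_derivative_transform_within_open[OF DERIV_q_series[OF h(1) that] open_upper_half_plane])
       (use that h(2) in \<open>auto simp: upper_half_plane_def\<close>)
  have f2: "(f1 has_field_derivative f2 z) (at z)" if "Im z > 0" for z
    using DERIV_cmult[OF DERIV_q_series[OF D1 that], of c]
    unfolding f1_def f2_def D2_def c_def by simp
  have inv1: "f1 (- (1 / z)) = z ^ 14 * f1 z + 12 * z ^ 13 * disc z" if "Im z > 0" for z
  proof -
    have z: "z \<noteq> 0" using that by auto
    have "f1 (- (1 / z)) / z ^ 2 = 12 * z ^ 11 * disc z + z ^ 12 * f1 z"
    proof (rule DERIV_unique_upper_half_plane[OF DERIV_comp_inversion[OF f1[OF Im_inversion_pos[OF that]] z] _ disc_inversion that])
      show "((\<lambda>z. z ^ 12 * disc z) has_field_derivative 12 * z ^ 11 * disc z + z ^ 12 * f1 z) (at z)"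
        by (auto intro!: derivative_eq_intros f1[OF that] simp: algebra_simps)
    qed
    hence "f1 (- (1 / z)) = (12 * z ^ 11 * disc z + z ^ 12 * f1 z) * z ^ 2" using z by (simp add: field_simps)
    thus ?thesis by (simp add: algebra_simps flip: power_add)
  qed
  have inv2: "f2 (- (1 / z)) = z ^ 16 * f2 z + 26 * z ^ 15 * f1 z + 156 * z ^ 14 * disc z" if "Im z > 0" for z
  proof -
    have z: "z \<noteq> 0" using that by auto
    have "f2 (- (1 / z)) / z ^ 2 = 14 * z ^ 13 * f1 z + z ^ 14 * f2 z + 12 * (13 * z ^ 12 * disc z + z ^ 13 * f1 z)"
    proof (rule DERIV_unique_upper_half_plane[OF DERIV_comp_inversion[OF f2[OF Im_inversion_pos[OF that]] z] _ inv1 that])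
      show "((\<lambda>z. z ^ 14 * f1 z + 12 * z ^ 13 * disc z) has_field_derivative
         14 * z ^ 13 * f1 z + z ^ 14 * f2 z + 12 * (13 * z ^ 12 * disc z + z ^ 13 * f1 z)) (at z)"
        by (auto intro!: derivative_eq_intros f1[OF that] f2[OF that] simp: algebra_simps)
    qed
    hence "f2 (- (1 / z)) = (14 * z ^ 13 * f1 z + z ^ 14 * f2 z + 12 * (13 * z ^ 12 * disc z + z ^ 13 * f1 z)) * z ^ 2"
      using z by (simp add: field_simps)
    thus ?thesis by (simp add: algebra_simps flip: power_add)
  qed
  define F where "F = (\<lambda>z. disc z * f2 z - 13 / 12 * f1 z ^ 2)"
  define G where "G = (\<lambda>z. eisenstein_G 4 z * disc z ^ 2)"
  have F_inv: "F (- (1 / z)) = z ^ 28 * F z" if "Im z > 0" for z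
    unfolding F_def inv1[OF that] inv2[OF that] disc_inversion[OF that]
    by (simp add: power2_eq_square algebra_simps flip: power_add)
  have G_inv: "G (- (1 / z)) = z ^ 28 * G z" if "Im z > 0" for z
  proof -
    have "z \<noteq> 0" using that by auto
    thus ?thesis unfolding G_def disc_inversion[OF that] eisenstein_G_inversion[OF \<open>z \<noteq> 0\<close>]
      by (simp add: power2_eq_square algebra_simps flip: power_add)
  qed
  \<comment> \<open>The quotient of the coefficients of \<open>q\<^sup>2\<close> in \<open>F\<close> and \<open>G\<close>.\<close>
  define lam where "lam = - (c ^ 2) / (12 * e 0)"
  define H where "H = (\<lambda>z. F z - lam * G z)"
  define g where "g = (\<lambda>w. h w * (c ^ 2 * D2 w) - 13 / 12 * (c * D1 w) ^ 2 - lam * (e w * h w ^ 2))"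
  have "cusp_order (Suc 2) H"
  proof (rule cusp_order_Suc)
    show "g holomorphic_on ball 0 1" unfolding g_def by (intro holomorphic_intros h e D1 D2)
    show "g 0 = 0" using e0 by (simp add: g_def D1_def D2_def lam_def power2_eq_square field_simps)
    show "H z = qexp z ^ 2 * g (qexp z)" if "Im z > 0" for z
      unfolding H_def F_def G_def g_def f1_def f2_def h(2)[OF that] e(2)[OF that]
      by (simp add: power2_eq_square algebra_simps)
  qed
  moreover have "H (- (1 / z)) = z ^ 28 * H z" if "Im z > 0" for z
    using F_inv[OF that] G_inv[OF that] by (simp add: H_def algebra_simps)
  ultimately have "mform 28 3 H" by (simp add: mform_def numeral_3_eq_3)
  hence "H z = 0" if "Im z > 0" for z using mform_vanishes[of 28 3 H z] that by simp
  hence "disc z * f2 z - 13 / 12 * f1 z ^ 2 = lam * (eisenstein_G 4 z * disc z ^ 2)" if "Im z > 0" for z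
    using that by (simp add: H_def F_def G_def)
  with f1 f2 that show thesis by blast
qed

lemma disc_holomorphic: "disc holomorphic_on upper_half_plane"
  using mform_disc by (auto simp: mform_def intro: cusp_order_holomorphic)

text \<open>
  At a zero of order \<open>n > 0\<close> the left-hand side of the bracket identity has order \<open>2 * n - 2\<close>, with leading
  coefficient a multiple of \<open>n\<^sup>2 - n - 13 / 12 * n\<^sup>2 < 0\<close>, whereas the right-hand side has order at least
  \<open>2 * n\<close>.
\<close>

theorem disc_nonzero:
  assumes "Im z > 0"
  shows "disc z \<noteq> 0"
proof
  assume zero: "disc z = 0"
  obtain f1 f2 lam where
    f1: "\<And>z. Im z > 0 \<Longrightarrow> (disc has_field_derivative f1 z) (at z)" and
    f2: "\<And>z. Im z > 0 \<Longrightarrow> (f1 has_field_derivative f2 z) (at z)" and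
    eq: "\<And>z. Im z > 0 \<Longrightarrow> disc z * f2 z - 13 / 12 * f1 z ^ 2 = lam * (eisenstein_G 4 z * disc z ^ 2)"
    by (rule disc_bracket, rule that, blast, blast, blast)
  have nc: "\<not> disc constant_on upper_half_plane"
  proof
    assume "disc constant_on upper_half_plane"
    hence "disc \<i> = disc z" using assms by (auto simp: constant_on_def upper_half_plane_def)
    thus False using zero norm_disc_ii by simp
  qed
  have zH: "z \<in> upper_half_plane" using assms by (simp add: upper_half_plane_def)
  obtain u r n where u: "0 < n" "0 < r" "ball z r \<subseteq> upper_half_plane" "u holomorphic_on ball z r"
      "\<And>w. w \<in> ball z r \<Longrightarrow> disc w = (w - z) ^ n * u w" "\<And>w. w \<in> ball z r \<Longrightarrow> u w \<noteq> 0"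
    by (rule holomorphic_factor_zero_nonconstant[OF disc_holomorphic open_upper_half_plane connected_upper_half_plane zH zero nc],
        rule that, assumption, assumption, assumption, assumption, blast, blast)
  have pos: "Im w > 0" if "w \<in> ball z r" for w using that u(3) by (auto simp: upper_half_plane_def)
  \<comment> \<open>With \<open>t = w - z\<close> and \<open>\<Delta> = t ^ n * u\<close>, one has \<open>t * \<Delta>' = t ^ n * v\<close>.\<close>
  define v where "v = (\<lambda>w. of_nat n * u w + (w - z) * deriv u w)"
  have v: "v holomorphic_on ball z r" unfolding v_def using u(4) by (intro holomorphic_intros) auto
  have Dpow: "((\<lambda>w. (w - z) ^ n * k w) has_field_derivative
       (of_nat n * (w - z) ^ (n - 1) * k w + (w - z) ^ n * deriv k w)) (at w)"
    if "k holomorphic_on ball z r" "w \<in> ball z r" for k w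
  proof -
    have "(k has_field_derivative deriv k w) (at w)" using that by (intro holomorphic_derivI[of k "ball z r"]) auto
    thus ?thesis by (auto intro!: derivative_eq_intros simp: algebra_simps)
  qed
  have pw: "(w - z) * (w - z) ^ (n - 1) = (w - z) ^ n" for w using u(1) by (cases n) auto
  have e1: "(w - z) * f1 w = (w - z) ^ n * v w" if w: "w \<in> ball z r" for w
  proof -
    have "f1 w = of_nat n * (w - z) ^ (n - 1) * u w + (w - z) ^ n * deriv u w"
      by (rule DERIV_unique[OF f1[OF pos[OF w]]],
          rule has_field_derivative_transform_within_open[OF Dpow[OF u(4) w] open_ball w]) (use u(5) in auto)
    hence "(w - z) * f1 w = of_nat n * ((w - z) * (w - z) ^ (n - 1)) * u w + (w - z) ^ n * ((w - z) * deriv u w)"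
      by (simp add: algebra_simps)
    thus ?thesis unfolding pw by (simp add: v_def algebra_simps)
  qed
  have e2: "(w - z) ^ 2 * f2 w = (w - z) ^ n * (of_nat n * v w + (w - z) * deriv v w - v w)" if w: "w \<in> ball z r" for w
  proof -
    have "((\<lambda>w. (w - z) * f1 w) has_field_derivative f1 w + (w - z) * f2 w) (at w)"
      using f2[OF pos[OF w]] by (auto intro!: derivative_eq_intros simp: algebra_simps)
    hence "f1 w + (w - z) * f2 w = of_nat n * (w - z) ^ (n - 1) * v w + (w - z) ^ n * deriv v w"
      by (rule DERIV_unique, intro has_field_derivative_transform_within_open[OF Dpow[OF v w] open_ball w])
         (use e1 in auto)
    hence "(w - z) * (f1 w + (w - z) * f2 w) = (w - z) * (of_nat n * (w - z) ^ (n - 1) * v w + (w - z) ^ n * deriv v w)"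
      by simp
    hence "(w - z) * f1 w + (w - z) ^ 2 * f2 w = of_nat n * ((w - z) * (w - z) ^ (n - 1)) * v w + (w - z) ^ n * ((w - z) * deriv v w)"
      by (simp add: power2_eq_square algebra_simps)
    thus ?thesis unfolding pw e1[OF w] by (simp add: algebra_simps)
  qed
  define L where "L = (\<lambda>w. u w * (of_nat n * v w + (w - z) * deriv v w - v w) - 13 / 12 * v w ^ 2
                          - lam * ((w - z) ^ 2 * (eisenstein_G 4 w * u w ^ 2)))"
  have L0: "L w = 0" if w: "w \<in> ball z r" "w \<noteq> z" for w
  proof -
    have "(w - z) ^ n * u w * ((w - z) ^ 2 * f2 w) - 13 / 12 * ((w - z) * f1 w) ^ 2 =
            (w - z) ^ 2 * (disc w * f2 w - 13 / 12 * f1 w ^ 2)"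
      by (simp only: u(5)[OF w(1)] power_mult_distrib) (simp add: algebra_simps)
    also have "\<dots> = (w - z) ^ 2 * (lam * (eisenstein_G 4 w * ((w - z) ^ n * u w) ^ 2))"
      unfolding eq[OF pos[OF w(1)]] by (simp add: u(5)[OF w(1)])
    finally have "((w - z) ^ n) ^ 2 * L w = 0"
      unfolding e1[OF w(1)] e2[OF w(1)] L_def by (simp add: power2_eq_square algebra_simps)
    thus ?thesis using w(2) by simp
  qed
  have "eisenstein_G 4 holomorphic_on ball z r"
    using holomorphic_eisenstein_G[of 2] u(3) by (auto intro: holomorphic_on_subset)
  hence "L holomorphic_on ball z r"
    unfolding L_def using u(4) v by (intro holomorphic_intros) auto
  hence "isCont L z"
    using u(2) holomorphic_on_imp_continuous_on[of L "ball z r"] by (simp add: continuous_on_eq_continuous_at)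
  hence "(L \<longlongrightarrow> L z) (at z)" by (simp add: isCont_def)
  moreover have "\<forall>\<^sub>F w in at z. L w = 0"
    unfolding eventually_at using u(2) L0 by (intro exI[of _ r]) (auto simp: dist_commute)
  hence "(L \<longlongrightarrow> 0) (at z)" by (rule tendsto_eventually)
  ultimately have "L z = 0" by (metis LIM_unique)
  hence "u z ^ 2 * of_real (real n ^ 2 - real n - 13 / 12 * real n ^ 2) = 0"
    by (simp add: L_def v_def power2_eq_square algebra_simps)
  hence "complex_of_real (real n ^ 2 - real n - 13 / 12 * real n ^ 2) = 0"
    using u(2) u(6)[of z] by simp
  hence "real n ^ 2 - real n - 13 / 12 * real n ^ 2 = 0" by (simp only: of_real_eq_0_iff)
  moreover have "real n ^ 2 \<ge> 0" "real n > 0" using u(1) by auto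
  ultimately show False by linarith
qed

section \<open>Size of the discriminant\<close>

lemma exp_lower: "2.718 ^ n \<le> exp (real n)"
proof -
  have "(2.718 :: real) \<le> exp 1" using e_approx_32 unfolding abs_le_iff by simp
  hence "(2.718 :: real) ^ n \<le> exp 1 ^ n" by (intro power_mono) auto
  thus ?thesis by (simp add: exp_of_nat_mult[symmetric])
qed

lemma exp_upper: "exp (real n) \<le> 2.7183 ^ n"
proof -
  have "exp 1 \<le> (2.7183 :: real)" using e_approx_32 unfolding abs_le_iff by simp
  hence "exp 1 ^ n \<le> (2.7183 :: real) ^ n" by (intro power_mono) auto
  thus ?thesis by (simp add: exp_of_nat_mult[symmetric])
qed

definition in_fundamental_domain :: "complex \<Rightarrow> bool" where
  "in_fundamental_domain z \<longleftrightarrow> Im z > 0 \<and> \<bar>Re z\<bar> \<le> 1 / 2 \<and> cmod z \<ge> 1"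

lemma norm_disc_le_aux:
  assumes "cmod (eisenstein_G 4 z) \<le> 17.5" "cmod (eisenstein_G 6 z) \<le> 17.5"
  shows "cmod (60 * eisenstein_G 4 z) ^ 3 \<le> 1160000000" "cmod (disc z) \<le> 1330000000"
proof -
  have a: "cmod (60 * eisenstein_G 4 z) ^ 3 \<le> 1050 ^ 3"
    using assms(1) by (intro power_mono) (auto simp: norm_mult)
  have b: "cmod (140 * eisenstein_G 6 z) ^ 2 \<le> 2450 ^ 2"
    using assms(2) by (intro power_mono) (auto simp: norm_mult)
  show "cmod (60 * eisenstein_G 4 z) ^ 3 \<le> 1160000000" using a by simp
  have "cmod (disc z) \<le> cmod ((60 * eisenstein_G 4 z) ^ 3) + cmod (27 * (140 * eisenstein_G 6 z) ^ 2)"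
    unfolding disc_def by (rule norm_triangle_ineq4)
  also have "\<dots> = cmod (60 * eisenstein_G 4 z) ^ 3 + 27 * cmod (140 * eisenstein_G 6 z) ^ 2"
    by (simp only: norm_power norm_mult[of 27]) simp
  also have "\<dots> \<le> 1330000000" using a b by simp
  finally show "cmod (disc z) \<le> 1330000000" .
qed

lemma norm_disc_le_fund:
  assumes "in_fundamental_domain z"
  shows "cmod (60 * eisenstein_G 4 z) ^ 3 \<le> 1160000000" "cmod (disc z) \<le> 1330000000"
  using norm_disc_le_aux[of z] norm_eisenstein_G_le[of 2 z] norm_eisenstein_G_le[of 3 z] assms
  by (auto simp: in_fundamental_domain_def)

lemma norm_disc_le_1:
  assumes "Im z \<ge> 1"
  shows "cmod (disc z) \<le> 1330000000 * exp (- 2 * pi * (Im z - 1))"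
proof -
  have "cusp_order 1 disc" using mform_disc by (simp add: mform_def)
  moreover have "cmod (disc w) \<le> 1330000000" if "Im w = 1" for w
    using norm_disc_le_aux(2)[of w] norm_eisenstein_G_le_1[of 2 w] norm_eisenstein_G_le_1[of 3 w] that by auto
  ultimately show ?thesis using cusp_order_max_modulus[of 1 disc 1 "1330000000" z] assms by simp
qed

text \<open>
  The bound at height 1 is propagated upwards with the decay of \<open>q\<close>; below height 1 the uniform bound is
  enough.
\<close>

lemma norm_disc_le_exp:
  assumes "in_fundamental_domain z"
  shows "cmod (disc z) \<le> exp (28 - 2 * pi * Im z)"
proof -
  \<comment> \<open>The number 21.7 separates \<open>ln 1330000000\<close> from \<open>28 - 2 * pi\<close>.\<close>
  have "1330000000 \<le> exp (28 - 2 * pi)"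
  proof -
    have "1330000000 \<le> (2.718 ^ 21) * (1 + 0.7 :: real)" by (simp add: power_divide)
    also have "\<dots> \<le> exp (real 21) * exp 0.7" by (intro mult_mono exp_lower exp_ge_add_one_self) auto
    also have "\<dots> = exp 21.7" by (simp flip: exp_add)
    also have "\<dots> \<le> exp (28 - 2 * pi)" using pi_approx by simp
    finally show ?thesis .
  qed
  note * = this
  show ?thesis
  proof (cases "Im z \<ge> 1")
    case True
    have "cmod (disc z) \<le> 1330000000 * exp (- 2 * pi * (Im z - 1))" by (rule norm_disc_le_1[OF True])
    also have "\<dots> \<le> exp (28 - 2 * pi) * exp (- 2 * pi * (Im z - 1))" by (intro mult_right_mono *) auto
    also have "\<dots> = exp (28 - 2 * pi * Im z)" by (simp flip: exp_add add: algebra_simps)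
    finally show ?thesis .
  next
    case False
    have "cmod (disc z) \<le> 1330000000" by (rule norm_disc_le_fund[OF assms])
    also note *
    also have "exp (28 - 2 * pi) \<le> exp (28 - 2 * pi * Im z)" using False by simp
    finally show ?thesis .
  qed
qed

lemma norm_disc_plus_le:
  assumes "in_fundamental_domain z"
  shows "cmod (disc z) + 1728 * cmod (60 * eisenstein_G 4 z) ^ 3 \<le> exp 29"
proof -
  have "cmod (disc z) + 1728 * cmod (60 * eisenstein_G 4 z) ^ 3 \<le> 1330000000 + 1728 * 1160000000"
    using norm_disc_le_fund[OF assms] by (intro add_mono mult_left_mono) auto
  also have "\<dots> \<le> 2.718 ^ 29" by (simp add: power_divide)
  also have "\<dots> \<le> exp 29" using exp_lower[of 29] by simp
  finally show ?thesis .
qed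

lemma exists_in_fundamental_domain:
  assumes "Im z > 0"
  obtains w where "modular_equiv z w" "in_fundamental_domain w"
proof -
  obtain w where "modular_equiv z w" "Im w > 0" "\<bar>Re w\<bar> \<le> 1 / 2" "cmod w \<ge> 1" "Im w \<ge> 0.86"
    using fundamental_domain[OF assms] .
  thus thesis by (intro that[of w]) (auto simp: in_fundamental_domain_def)
qed

text \<open>
  The invariant function through which the discriminant enters the final estimate.
\<close>

definition disc_norm :: "complex \<Rightarrow> real" where
  "disc_norm z = cmod (disc z) * Im z ^ 6"

lemma disc_norm_modular_equiv:
  assumes "modular_equiv z w" "Im z > 0"
  shows "disc_norm w = disc_norm z"
proof (rule modular_equiv_invariant[OF _ _ assms])
  fix z :: complex assume z: "Im z > 0"
  show "disc_norm (z + 1) = disc_norm z" by (simp add: disc_norm_def disc_plus1)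
  have "cmod z \<noteq> 0" using z by auto
  thus "disc_norm (- (1 / z)) = disc_norm z"
    unfolding disc_norm_def disc_inversion[OF z] Im_inversion
    by (simp add: norm_mult norm_power power_divide flip: power_mult)
qed

lemma disc_norm_le_fund:
  assumes "in_fundamental_domain z"
  shows "disc_norm z \<le> exp (28 - 2 * pi * Im z) * Im z ^ 6"
  unfolding disc_norm_def using norm_disc_le_exp[OF assms] assms
  by (intro mult_right_mono) (auto simp: in_fundamental_domain_def)

lemma disc_norm_le:
  assumes "Im z > 0"
  shows "disc_norm z \<le> exp 22"
proof -
  obtain w where w: "modular_equiv z w" "in_fundamental_domain w" using exists_in_fundamental_domain[OF assms] .
  have pos: "Im w > 0" using w by (simp add: in_fundamental_domain_def)
  have "disc_norm z = disc_norm w" using disc_norm_modular_equiv[OF w(1) assms] by simp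
  also have "\<dots> \<le> exp (28 - 2 * pi * Im w) * Im w ^ 6" by (rule disc_norm_le_fund[OF w(2)])
  also have "\<dots> \<le> exp (28 - 6 * Im w) * exp (Im w - 1) ^ 6"
  proof (intro mult_mono power_mono)
    have "6 * Im w \<le> 2 * pi * Im w" using pi_gt3 pos by (intro mult_right_mono) auto
    thus "exp (28 - 2 * pi * Im w) \<le> exp (28 - 6 * Im w)" by simp
    show "Im w \<le> exp (Im w - 1)" using exp_ge_add_one_self[of "Im w - 1"] by simp
  qed (use pos in auto)
  also have "\<dots> = exp (28 - 6 * Im w + 6 * (Im w - 1))"
    unfolding exp_add by (simp add: exp_of_nat_mult[symmetric])
  finally show ?thesis by simp
qed

text \<open>
  Schwarz's lemma for \<open>(A w - A 0) / (A w + cnj (A 0))\<close>, the composition of \<open>A\<close> with a linear fractional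
  transformation from the right half plane to the disc.
\<close>

lemma schwarz_positive_real_part:
  assumes hol: "A holomorphic_on ball 0 1" and pos: "\<And>w. cmod w < 1 \<Longrightarrow> Re (A w) > 0" and w: "cmod w < 1"
  shows "\<bar>Re (A w) - Re (A 0)\<bar> \<le> cmod w * (Re (A w) + Re (A 0))"
proof -
  define a where "a = A 0"
  have a: "Re a > 0" using pos[of 0] by (simp add: a_def)
  have nz: "A w + cnj a \<noteq> 0" if "cmod w < 1" for w
  proof
    assume "A w + cnj a = 0"
    hence "Re (A w + cnj a) = 0" by simp
    thus False using pos[OF that] a by simp
  qed
  define F where "F = (\<lambda>w. (A w - a) / (A w + cnj a))"
  have F: "F holomorphic_on ball 0 1" unfolding F_def using nz by (intro holomorphic_intros hol) auto
  have sq: "cmod (A w - a) ^ 2 = (Re (A w) - Re a) ^ 2 + (Im (A w) - Im a) ^ 2"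
           "cmod (A w + cnj a) ^ 2 = (Re (A w) + Re a) ^ 2 + (Im (A w) - Im a) ^ 2" for w
    by (simp_all add: cmod_power2)
  have lt: "cmod (F w) < 1" if "cmod w < 1" for w
  proof -
    have "0 < 4 * (Re (A w) * Re a)" using pos[OF that] a by simp
    hence "cmod (A w - a) ^ 2 < cmod (A w + cnj a) ^ 2"
      unfolding sq by (simp add: power2_eq_square algebra_simps)
    hence "cmod (A w - a) < cmod (A w + cnj a)" by (rule power_less_imp_less_base) auto
    thus ?thesis using nz[OF that] by (simp add: F_def norm_divide)
  qed
  have "cmod (F w) \<le> cmod w" by (rule Schwarz_Lemma(1)[OF F _ lt w]) (auto simp: F_def a_def)
  hence "cmod (A w - a) \<le> cmod w * cmod (A w + cnj a)" using nz[OF w] by (simp add: F_def norm_divide divide_le_eq)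
  hence "cmod (A w - a) ^ 2 \<le> (cmod w * cmod (A w + cnj a)) ^ 2" by (intro power_mono) auto
  hence 1: "(Re (A w) - Re a) ^ 2 + (Im (A w) - Im a) ^ 2 \<le> cmod w ^ 2 * ((Re (A w) + Re a) ^ 2 + (Im (A w) - Im a) ^ 2)"
    unfolding power_mult_distrib sq .
  have "cmod w ^ 2 \<le> 1" using w by (simp add: power_le_one)
  hence "cmod w ^ 2 * (Im (A w) - Im a) ^ 2 \<le> 1 * (Im (A w) - Im a) ^ 2" by (intro mult_right_mono) auto
  with 1 have "(Re (A w) - Re a) ^ 2 \<le> (cmod w * (Re (A w) + Re a)) ^ 2"
    unfolding power_mult_distrib distrib_left[of "cmod w ^ 2"] by linarith
  hence "\<bar>Re (A w) - Re a\<bar> \<le> \<bar>cmod w * (Re (A w) + Re a)\<bar>" by (simp only: abs_le_square_iff)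
  also have "\<dots> = cmod w * (Re (A w) + Re a)" using pos[OF w] a by (simp add: abs_mult)
  finally show ?thesis by (simp add: a_def)
qed

text \<open>
  Harnack's inequality for the positive harmonic function \<open>ln B - ln \<bar>h\<bar>\<close>, which is the real part of a
  holomorphic function because \<open>h\<close> has a logarithm.
\<close>

lemma harnack_nonvanishing:
  assumes hol: "h holomorphic_on ball 0 1" and h: "\<And>w. cmod w < 1 \<Longrightarrow> h w \<noteq> 0 \<and> cmod (h w) < B"
      and w: "cmod w < 1"
  shows "\<bar>ln (cmod (h w)) - ln (cmod (h 0))\<bar> \<le> cmod w * (2 * ln B - ln (cmod (h w)) - ln (cmod (h 0)))"
proof -
  obtain L where L: "L holomorphic_on ball 0 1" "\<And>z. z \<in> ball 0 1 \<Longrightarrow> h z = exp (L z)"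
    by (rule contractible_imp_holomorphic_log[OF hol convex_imp_contractible[OF convex_ball]])
       (use h in auto)
  have Re: "Re (L z) = ln (cmod (h z))" if "cmod z < 1" for z
    using L(2)[of z] that by simp
  have B: "B > 0" using h[of 0] by (auto intro: le_less_trans[OF norm_ge_zero])
  have "(\<lambda>z. of_real (ln B) - L z) holomorphic_on ball 0 1" by (intro holomorphic_intros L)
  moreover have "Re (of_real (ln B) - L z) > 0" if "cmod z < 1" for z
    using h[OF that] B by (simp add: Re[OF that])
  ultimately have "\<bar>Re (of_real (ln B) - L w) - Re (of_real (ln B) - L 0)\<bar>
       \<le> cmod w * (Re (of_real (ln B) - L w) + Re (of_real (ln B) - L 0))"
    using schwarz_positive_real_part w by blast
  thus ?thesis using w by (simp add: Re abs_minus_commute algebra_simps)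
qed

text \<open>
  The quotient \<open>\<Delta> / q\<close> has no zeros in the disc \<open>\<bar>q\<bar> < 1\<close>, and on the disc that corresponds to
  \<open>Im z > 1 / 2\<close> it is bounded because the invariant function \<open>disc_norm\<close> is. Harnack's inequality carries the
  known lower bound at \<open>\<i>\<close> to the centre \<open>q = 0\<close>, and from there to the line \<open>Im z = 2\<close>.
\<close>

lemma disc_norm_lower:
  assumes "Im z = 2"
  shows "disc_norm z \<ge> exp 8"
proof -
  obtain h where h: "h holomorphic_on ball 0 1" "\<And>z. Im z > 0 \<Longrightarrow> disc z = qexp z * h (qexp z)" "h 0 \<noteq> 0"
    by (rule disc_cusp_simple, rule that, assumption, blast, assumption)
  define R where "R = exp (- pi)"
  have R: "0 < R" "R < 1" by (auto simp: R_def)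
  define H where "H = (\<lambda>w. h (of_real R * w))"
  have H: "H holomorphic_on ball 0 1" unfolding H_def
  proof (rule holomorphic_on_compose_gen[OF _ h(1), unfolded o_def])
    show "(*) (complex_of_real R) ` ball 0 1 \<subseteq> ball 0 1"
      using R by (auto simp: norm_mult intro: mult_less_le_imp_less) (smt (verit) mult_left_le norm_ge_zero mult_right_less_imp_less)
  qed (intro holomorphic_intros)
  have cusp: "cusp_order 1 disc" using mform_disc by (simp add: mform_def)
  have half: "cmod (disc z) \<le> exp 22 * 64" if "Im z = 1 / 2" for z
    using disc_norm_le[of z] that by (simp add: disc_norm_def power_divide)
  \<comment> \<open>The constant is an upper bound for \<open>22 + ln 64 + pi\<close>.\<close>
  have up: "cmod (h (qexp z)) \<le> exp (29.4)" if z: "Im z \<ge> 1 / 2" for z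
  proof -
    have "cmod (disc z) \<le> exp 22 * 64 * exp (- 2 * pi * real 1 * (Im z - 1 / 2))"
      by (rule cusp_order_max_modulus[OF cusp _ half z]) auto
    moreover have "cmod (disc z) = exp (- 2 * pi * Im z) * cmod (h (qexp z))"
      using h(2)[of z] z by (simp add: norm_mult norm_qexp)
    moreover have "exp (- 2 * pi * real 1 * (Im z - 1 / 2)) = exp (- 2 * pi * Im z) * exp pi"
      by (simp add: algebra_simps flip: exp_add)
    ultimately have "exp (- 2 * pi * Im z) * cmod (h (qexp z)) \<le> exp (- 2 * pi * Im z) * (exp 22 * 64 * exp pi)"
      by (simp only: mult_ac)
    hence "cmod (h (qexp z)) \<le> exp 22 * 64 * exp pi" by simp
    also have "64 \<le> exp (4.2 :: real)"
    proof -
      have "64 \<le> 2.718 ^ 4 * (1 + 0.2 :: real)" by (simp add: power_divide)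
      also have "\<dots> \<le> exp (real 4) * exp 0.2" by (intro mult_mono exp_lower exp_ge_add_one_self) auto
      also have "\<dots> = exp 4.2" by (simp flip: exp_add)
      finally show ?thesis .
    qed
    also have "exp pi \<le> exp 3.2" using pi_approx by simp
    also have "exp 22 * exp 4.2 * exp 3.2 = exp (29.4 :: real)" by (simp flip: exp_add)
    finally show ?thesis by simp
  qed
  have HB: "H w \<noteq> 0 \<and> cmod (H w) < exp 29.5" if w: "cmod w < 1" for w
  proof -
    have le: "cmod (h v) \<le> exp 29.4" "h v \<noteq> 0" if v: "v \<noteq> 0" "cmod v \<le> R" for v
    proof -
      obtain z where z: "qexp z = v" "Im z = - ln (cmod v) / (2 * pi)" using qexp_surj[OF v(1)] .
      have "ln (cmod v) \<le> ln R" using v R by (subst ln_le_cancel_iff) auto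
      hence "pi * 1 \<le> pi * (Im z * 2)" using z(2) by (simp add: R_def field_simps)
      hence "1 \<le> Im z * 2" by (rule mult_left_le_imp_le) auto
      hence "Im z \<ge> 1 / 2" by simp
      thus "cmod (h v) \<le> exp 29.4" using up z(1) by metis
      show "h v \<noteq> 0" using disc_nonzero[of z] h(2)[of z] \<open>Im z \<ge> 1 / 2\<close> z(1) by auto
    qed
    have "cmod (H w) \<le> exp 29.4"
    proof (cases "w = 0")
      case False
      have "R * cmod w \<le> R" using w R by (intro mult_left_le) auto
      thus ?thesis using le(1)[of "of_real R * w"] False R by (simp add: H_def norm_mult)
    next
      case True
      have cont: "continuous_on (ball 0 1) (\<lambda>v. cmod (h v))"
        by (intro continuous_intros holomorphic_on_imp_continuous_on h)
      hence "isCont (\<lambda>v. cmod (h v)) 0" by (simp add: continuous_on_eq_continuous_at)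
      hence "((\<lambda>v. cmod (h v)) \<longlongrightarrow> cmod (h 0)) (at 0)" by (simp add: isCont_def)
      moreover have "\<forall>\<^sub>F v in at 0. cmod (h v) \<le> exp 29.4"
        unfolding eventually_at using R le(1) by (intro exI[of _ R]) auto
      ultimately have "cmod (h 0) \<le> exp 29.4" by (rule tendsto_upperbound) auto
      thus ?thesis using True by (simp add: H_def)
    qed
    also have "exp 29.4 < exp (29.5 :: real)" by simp
    finally have "cmod (H w) < exp 29.5" .
    moreover have "H w \<noteq> 0"
    proof (cases "w = 0")
      case False
      have "R * cmod w \<le> R" using w R by (intro mult_left_le) auto
      thus ?thesis using le(2)[of "of_real R * w"] False R by (simp add: H_def norm_mult)
    qed (use h(3) in \<open>simp add: H_def\<close>)
    ultimately show ?thesis by simp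
  qed
  define u where "u = (\<lambda>w. 29.5 - ln (cmod (H w)))"
  have har: "\<bar>u w - u 0\<bar> \<le> cmod w * (u w + u 0)" if "cmod w < 1" for w
    using harnack_nonvanishing[OF H HB that] by (simp add: u_def abs_minus_commute algebra_simps)
  have u_pos: "u w \<ge> 0" if "cmod w < 1" for w
    using HB[OF that] ln_le_cancel_iff[of "cmod (H w)" "exp 29.5"] by (simp add: u_def)
  have Hq: "ln (cmod (H (qexp z / of_real R))) = ln (cmod (disc z)) + 2 * pi * Im z" if "Im z > 0" for z
  proof -
    have "cmod (disc z) = exp (- 2 * pi * Im z) * cmod (h (qexp z))"
      using h(2)[OF that] by (simp add: norm_mult norm_qexp)
    moreover have "H (qexp z / of_real R) = h (qexp z)" using R by (simp add: H_def)
    moreover have "h (qexp z) \<noteq> 0" using h(2)[OF that] disc_nonzero[OF that] by auto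
    ultimately show ?thesis by (simp add: ln_mult)
  qed
  have e3: "exp (- 3) \<le> (1 / 20 :: real)"
  proof -
    have "20 \<le> exp (3 :: real)" using exp_lower[of 3] by (simp add: power_divide)
    thus ?thesis by (simp add: exp_minus field_simps)
  qed
  \<comment> \<open>The points \<open>\<i>\<close> and \<open>z\<close> in the disc of radius \<open>R\<close>, scaled to the unit disc.\<close>
  define w1 where "w1 = qexp \<i> / of_real R"
  have w1: "cmod w1 \<le> 1 / 20"
  proof -
    have "cmod w1 = exp (- pi)" by (simp add: w1_def norm_divide norm_qexp R_def flip: exp_diff)
    also have "\<dots> \<le> exp (- 3)" using pi_gt3 by simp
    finally show ?thesis using e3 by simp
  qed
  define w2 where "w2 = qexp z / of_real R"
  have w2: "cmod w2 \<le> 1 / 1000"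
  proof -
    have "cmod w2 = exp (- 3 * pi)" using assms by (simp add: w2_def norm_divide norm_qexp R_def flip: exp_diff)
    also have "\<dots> \<le> exp (- 9)" using pi_gt3 by simp
    also have "\<dots> = exp (- 3) ^ 3" by (simp add: exp_of_nat_mult[symmetric])
    also have "\<dots> \<le> (1 / 20) ^ 3" using e3 by (intro power_mono) auto
    finally show ?thesis by (simp add: power_divide)
  qed
  have "19 \<le> ln (cmod (disc \<i>)) + 2 * pi"
  proof -
    have "exp 13 \<le> (2.7183 :: real) ^ 13" using exp_upper[of 13] by simp
    also have "\<dots> \<le> 460000" by (simp add: power_divide)
    also have "\<dots> \<le> cmod (disc \<i>)" by (rule norm_disc_ii)
    finally have "13 \<le> ln (cmod (disc \<i>))" by (subst ln_ge_iff) (use disc_nonzero[of \<i>] in auto)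
    thus ?thesis using pi_gt3 by simp
  qed
  hence "u w1 \<le> 10.5" using Hq[of \<i>] by (simp add: u_def w1_def)
  have "cmod w1 * (u w1 + u 0) \<le> 1 / 20 * (u w1 + u 0)"
    using w1 u_pos[of 0] u_pos[of w1] by (intro mult_right_mono) auto
  with har[of w1] w1 \<open>u w1 \<le> 10.5\<close> have "u 0 \<le> 11.7" by (simp add: abs_le_iff)
  have "cmod w2 * (u w2 + u 0) \<le> 1 / 1000 * (u w2 + u 0)"
    using w2 u_pos[of 0] u_pos[of w2] by (intro mult_right_mono) auto
  with har[of w2] w2 \<open>u 0 \<le> 11.7\<close> have "u w2 \<le> 12" by (simp add: abs_le_iff)
  hence "ln (cmod (disc z)) \<ge> 17.5 - 4 * pi" using Hq[of z] assms by (simp add: u_def w2_def)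
  hence "ln (cmod (disc z)) + 6 * ln 2 \<ge> 8" using ln2_ge_two_thirds pi_approx by simp
  moreover have "ln (64 :: real) = 6 * ln 2" using ln_realpow[of "2 :: real" 6] by simp
  ultimately have "exp 8 \<le> exp (ln (cmod (disc z)) + ln 64)" by simp
  also have "\<dots> = disc_norm z"
    unfolding exp_add disc_norm_def assms using disc_nonzero[of z] assms by simp
  finally show ?thesis .
qed

section \<open>The modular function\<close>

lemma norm_eisenstein_G4_ge:
  assumes "Im z \<ge> 2"
  shows "cmod (eisenstein_G 4 z) \<ge> 1"
proof -
  obtain a where a: "a holomorphic_on ball 0 1" "\<And>z. Im z > 0 \<Longrightarrow> eisenstein_G 4 z = a (qexp z)"
      "a 0 = of_real (2 * zeta_nat 4)"
    using eisenstein_G_cusp[of 2] by auto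
  define f where "f = (\<lambda>z. eisenstein_G 4 z - of_real (2 * zeta_nat 4))"
  have "cusp_order (Suc 0) f"
    by (rule cusp_order_Suc[where g = "\<lambda>w. a w - of_real (2 * zeta_nat 4)"])
       (use a in \<open>auto simp: f_def intro!: holomorphic_intros\<close>)
  hence cusp: "cusp_order 1 f" by simp
  have z4: "1 \<le> zeta_nat 4" "zeta_nat 4 \<le> 1.645" using zeta_nat_ge_1[of 4] zeta_nat_antimono[of 2 4] zeta_nat_2_le by auto
  have f1: "cmod (f w) \<le> 21" if "Im w = 1" for w
  proof -
    have "cmod (f w) \<le> cmod (eisenstein_G 4 w) + cmod (of_real (2 * zeta_nat 4))"
      unfolding f_def by (rule norm_triangle_ineq4)
    thus ?thesis using norm_eisenstein_G_le_1[of 2 w] that z4 by simp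
  qed
  have "cmod (f z) \<le> 21 * exp (- 2 * pi * real 1 * (Im z - 1))"
    by (rule cusp_order_max_modulus[OF cusp _ f1]) (use assms in auto)
  also have "\<dots> \<le> 21 * exp (- 6)"
  proof -
    have "3 * 1 \<le> pi * (Im z - 1)" using pi_gt3 assms by (intro mult_mono) auto
    thus ?thesis by simp
  qed
  also have "exp (- 6) \<le> (1 / 400 :: real)"
  proof -
    have "400 \<le> exp (6 :: real)" using exp_lower[of 6] by (simp add: power_divide)
    thus ?thesis by (simp add: exp_minus field_simps)
  qed
  finally have "cmod (f z) \<le> 1" by simp
  moreover have "cmod (of_real (2 * zeta_nat 4)) \<le> cmod (eisenstein_G 4 z) + cmod (f z)"
    using norm_triangle_ineq4[of "eisenstein_G 4 z" "f z"] by (simp add: f_def)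
  ultimately show ?thesis using z4 by simp
qed

lemma modular_j_plus1: "modular_j (z + 1) = modular_j z"
  by (simp add: modular_j_eq disc_plus1 eisenstein_G_plus1)

lemma modular_j_inversion: "Im z > 0 \<Longrightarrow> modular_j (- (1 / z)) = modular_j z"
proof -
  assume z: "Im z > 0"
  hence "z \<noteq> 0" by auto
  thus ?thesis unfolding modular_j_eq disc_inversion[OF z]
    by (simp add: eisenstein_G_inversion power_mult_distrib flip: power_mult)
qed

lemma modular_j_modular_equiv: "modular_equiv z w \<Longrightarrow> Im z > 0 \<Longrightarrow> modular_j w = modular_j z"
  by (rule modular_equiv_invariant[OF modular_j_plus1 modular_j_inversion])

lemma modular_j_holomorphic: "modular_j holomorphic_on upper_half_plane"
  unfolding modular_j_eq[abs_def]
  using holomorphic_eisenstein_G[of 2] disc_holomorphic disc_nonzero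
  by (intro holomorphic_intros) (auto simp: upper_half_plane_def)

lemma norm_modular_j_gt_1:
  assumes "Im z \<ge> 2"
  shows "cmod (modular_j z) > 1"
proof -
  have "cmod (disc z) \<le> 1330000000 * exp (- 2 * pi * (Im z - 1))"
    by (rule norm_disc_le_1) (use assms in auto)
  also have "\<dots> \<le> 1330000000 * exp (- 6)"
  proof -
    have "3 * 1 \<le> pi * (Im z - 1)" using pi_gt3 assms by (intro mult_mono) auto
    thus ?thesis by simp
  qed
  also have "exp (- 6) \<le> (1 / 400 :: real)"
  proof -
    have "400 \<le> exp (6 :: real)" using exp_lower[of 6] by (simp add: power_divide)
    thus ?thesis by (simp add: exp_minus field_simps)
  qed
  finally have d: "cmod (disc z) \<le> 1330000000 / 400" by simp
  have "60 ^ 3 \<le> cmod (60 * eisenstein_G 4 z) ^ 3"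
    using norm_eisenstein_G4_ge[OF assms] by (intro power_mono) (auto simp: norm_mult)
  with d have "cmod (disc z) < 1728 * cmod (60 * eisenstein_G 4 z) ^ 3" by simp
  moreover have "cmod (disc z) > 0" using disc_nonzero[of z] assms by simp
  ultimately show ?thesis
    by (simp add: modular_j_eq norm_divide norm_mult norm_power less_divide_eq)
qed

text \<open>
  The simple pole of \<open>j\<close> at the cusp comes from the simple zero of the discriminant.
\<close>

lemma modular_j_cusp:
  obtains J where "J holomorphic_on ball 0 1" "J 0 \<noteq> 0" "\<And>z. Im z > 0 \<Longrightarrow> modular_j z * qexp z = J (qexp z)"
proof -
  obtain h where h: "h holomorphic_on ball 0 1" "\<And>z. Im z > 0 \<Longrightarrow> disc z = qexp z * h (qexp z)" "h 0 \<noteq> 0"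
    by (rule disc_cusp_simple, rule that, assumption, blast, assumption)
  obtain a where a: "a holomorphic_on ball 0 1" "\<And>z. Im z > 0 \<Longrightarrow> eisenstein_G 4 z = a (qexp z)"
      "a 0 = of_real (2 * zeta_nat 4)"
    using eisenstein_G_cusp[of 2] by auto
  have nz: "h w \<noteq> 0" if w: "cmod w < 1" for w
  proof (cases "w = 0")
    case False
    obtain z where z: "qexp z = w" "Im z > 0" using qexp_onto[OF False w] .
    thus ?thesis using disc_nonzero[of z] h(2)[of z] z(1) by auto
  qed (use h in auto)
  define J where "J = (\<lambda>w. 1728 * (60 * a w) ^ 3 / h w)"
  show thesis
  proof (rule that)
    show "J holomorphic_on ball 0 1" unfolding J_def by (intro holomorphic_intros a h) (use nz in auto)
    show "J 0 \<noteq> 0" using zeta_nat_ge_1[of 4] h(3) a(3) by (auto simp: J_def)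
    show "modular_j z * qexp z = J (qexp z)" if "Im z > 0" for z
      unfolding modular_j_eq J_def a(2)[OF that] h(2)[OF that] by simp
  qed
qed

text \<open>
  Induction on the order of the pole at the cusp: subtracting a multiple of a power of \<open>j\<close> lowers it, and
  without a pole the function is constant.
\<close>

lemma invariant_is_poly:
  assumes "\<And>z. Im z > 0 \<Longrightarrow> f (- (1 / z)) = f z" "cusp_order 0 (\<lambda>z. f z * qexp z ^ N)"
  shows "\<exists>A. \<forall>z. Im z > 0 \<longrightarrow> f z = poly A (modular_j z)"
  using assms
proof (induction N arbitrary: f)
  case 0
  hence "mform 0 0 f" by (simp add: mform_def)
  then obtain c where "\<And>z. Im z > 0 \<Longrightarrow> f z = c" using mform_0_const by blast
  thus ?case by (intro exI[of _ "[:c:]"]) auto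
next
  case (Suc N)
  obtain J where J: "J holomorphic_on ball 0 1" "J 0 \<noteq> 0" "\<And>z. Im z > 0 \<Longrightarrow> modular_j z * qexp z = J (qexp z)"
    by (rule modular_j_cusp, rule that, assumption, assumption, blast)
  obtain g where g: "g holomorphic_on ball 0 1" "\<And>z. Im z > 0 \<Longrightarrow> f z * qexp z ^ Suc N = g (qexp z)"
    using Suc.prems(2) by (auto simp: cusp_order_def)
  define c where "c = g 0 / J 0 ^ Suc N"
  define f' where "f' = (\<lambda>z. f z - c * modular_j z ^ Suc N)"
  have eq: "f' z * qexp z ^ Suc N = g (qexp z) - c * J (qexp z) ^ Suc N" if "Im z > 0" for z
    unfolding f'_def left_diff_distrib g(2)[OF that] J(3)[OF that, symmetric]
    by (simp only: power_mult_distrib mult.assoc)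
  have "\<exists>A. \<forall>z. Im z > 0 \<longrightarrow> f' z = poly A (modular_j z)"
  proof (rule Suc.IH)
    show "f' (- (1 / z)) = f' z" if "Im z > 0" for z
      using Suc.prems(1)[OF that] modular_j_inversion[OF that] by (simp add: f'_def)
    have hol: "(\<lambda>w. g w - c * J w ^ Suc N) holomorphic_on ball 0 1" by (intro holomorphic_intros g J)
    have g0: "g 0 - c * J 0 ^ Suc N = 0" using J(2) by (simp add: c_def)
    obtain k where k: "k holomorphic_on ball 0 1" "\<And>w. cmod w < 1 \<Longrightarrow> g w - c * J w ^ Suc N = w * k w"
      by (rule Schwarz3[OF hol g0], rule that, assumption, blast)
    show "cusp_order 0 (\<lambda>z. f' z * qexp z ^ N)" unfolding cusp_order_def
    proof (intro exI[of _ k] conjI allI impI k(1))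
      fix z assume z: "Im z > 0"
      have "qexp z * (f' z * qexp z ^ N) = qexp z * k (qexp z)"
        using eq[OF z] k(2)[OF norm_qexp_less_1[OF z]] by (simp add: mult_ac)
      thus "f' z * qexp z ^ N = qexp z ^ 0 * k (qexp z)" by simp
    qed
  qed
  then obtain A where "\<And>z. Im z > 0 \<Longrightarrow> f' z = poly A (modular_j z)" by blast
  thus ?case
    by (intro exI[of _ "A + smult c (monom 1 (Suc N))"]) (auto simp: f'_def poly_monom algebra_simps simp del: power_Suc)
qed

text \<open>
  If \<open>j\<close> omitted the value \<open>c\<close>, then \<open>1 / (j - c)\<close> would be a form of weight 0 that vanishes at the cusp.
\<close>

lemma modular_j_surj: "\<exists>z. Im z > 0 \<and> modular_j z = c"
proof (rule ccontr)
  assume contr: "\<not> ?thesis"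
  hence ne: "modular_j z \<noteq> c" if "Im z > 0" for z using that by auto
  obtain J where J: "J holomorphic_on ball 0 1" "J 0 \<noteq> 0" "\<And>z. Im z > 0 \<Longrightarrow> modular_j z * qexp z = J (qexp z)"
    by (rule modular_j_cusp, rule that, assumption, assumption, blast)
  have eq: "J (qexp z) - c * qexp z = (modular_j z - c) * qexp z" if "Im z > 0" for z
    using J(3)[OF that] by (simp add: algebra_simps)
  have nz: "J w - c * w \<noteq> 0" if w: "cmod w < 1" for w
  proof (cases "w = 0")
    case False
    obtain z where z: "qexp z = w" "Im z > 0" using qexp_onto[OF False w] .
    thus ?thesis using eq[of z] ne[of z] z(1) qexp_nonzero[of z] by auto
  qed (use J in auto)
  have "cusp_order 1 (\<lambda>z. 1 / (modular_j z - c))" unfolding cusp_order_def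
  proof (intro exI[of _ "\<lambda>w. 1 / (J w - c * w)"] conjI allI impI)
    show "(\<lambda>w. 1 / (J w - c * w)) holomorphic_on ball 0 1"
      by (intro holomorphic_intros J) (use nz in auto)
    show "1 / (modular_j z - c) = qexp z ^ 1 * (1 / (J (qexp z) - c * qexp z))" if "Im z > 0" for z
      unfolding eq[OF that] by simp
  qed
  hence "mform 0 1 (\<lambda>z. 1 / (modular_j z - c))" by (simp add: mform_def modular_j_inversion)
  hence "1 / (modular_j \<i> - c) = 0" using mform_vanishes[of 0 1 "\<lambda>z. 1 / (modular_j z - c)" \<i>] by simp
  thus False using ne[of \<i>] by simp
qed

lemma poly_coeff_Cauchy:
  fixes A :: "complex poly"
  assumes "\<And>y. cmod y = 1 \<Longrightarrow> cmod (poly A y) \<le> B"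
  shows "cmod (coeff A k) \<le> B"
proof -
  have fps: "poly A has_fps_expansion fps_of_poly A" by (simp add: has_fps_expansion_def)
  have hol: "poly A holomorphic_on S" for S
    using poly_holomorphic_on[OF holomorphic_on_ident] by simp
  have "cmod ((deriv ^^ k) (poly A) 0) \<le> fact k * B / 1 ^ k"
    by (rule Cauchy_inequality) (use assms in \<open>auto intro: hol holomorphic_on_imp_continuous_on\<close>)
  moreover have "(deriv ^^ k) (poly A) 0 = fact k * coeff A k"
    using fps_nth_fps_expansion[OF fps, of k] by simp
  ultimately have "fact k * cmod (coeff A k) \<le> fact k * B" by (simp add: norm_mult)
  thus ?thesis by simp
qed

text \<open>
  Every point of the unit circle is a value \<open>j w\<close> at a reduced point \<open>w\<close>. Since \<open>\<bar>j\<bar> > 1\<close> above height 2,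
  that point lies below the line \<open>Im z = 2\<close>, from which the maximum principle for invariant functions
  transports the bound. Cauchy's inequality finishes the proof.
\<close>

lemma poly_in_j_coeff_bound:
  assumes B: "\<And>z. Im z = 2 \<Longrightarrow> cmod (poly A (modular_j z)) \<le> B"
  shows "cmod (coeff A k) \<le> B"
proof (rule poly_coeff_Cauchy)
  fix y :: complex assume y: "cmod y = 1"
  obtain z where z: "Im z > 0" "modular_j z = y" using modular_j_surj by blast
  obtain w where w: "modular_equiv z w" "Im w > 0" "\<bar>Re w\<bar> \<le> 1 / 2" "cmod w \<ge> 1" "Im w \<ge> 0.86"
    using fundamental_domain[OF z(1)] .
  have jw: "modular_j w = y" using modular_j_modular_equiv[OF w(1) z(1)] z(2) by simp
  have "Im w \<le> 2" using norm_modular_j_gt_1[of w] jw y by (intro leI notI) auto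
  have "cmod (poly A (modular_j w)) \<le> B"
  proof (rule invariant_max_modulus[of "\<lambda>z. poly A (modular_j z)"])
    show "(\<lambda>z. poly A (modular_j z)) holomorphic_on upper_half_plane"
      by (intro holomorphic_intros modular_j_holomorphic)
  qed (use B w \<open>Im w \<le> 2\<close> in \<open>auto simp: modular_j_plus1 modular_j_inversion\<close>)
  thus "cmod (poly A y) \<le> B" by (simp add: jw)
qed

section \<open>Counting Hermite normal forms\<close>

text \<open>
  The number of Hermite normal forms defined below, sorted by \<open>d\<close>: the residues \<open>b\<close> modulo \<open>d\<close> that are prime
  to \<open>gcd d (m div d)\<close>.
\<close>

definition cyc_count :: "nat \<Rightarrow> real" where
  "cyc_count m = (\<Sum>d | d dvd m. real (d div gcd d (m div d) * totient (gcd d (m div d))))"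

lemma gcd_mult_mult_coprime:
  fixes x y u v a b :: nat
  assumes "coprime a b" "x dvd a" "u dvd a" "y dvd b" "v dvd b"
  shows "gcd (x * y) (u * v) = gcd x u * gcd y v"
proof -
  have cop: "coprime x' y'" if "x' dvd a" "y' dvd b" for x' y'
    using coprime_divisors[OF that assms(1)] .
  show ?thesis
  proof (rule dvd_antisym)
    obtain g h where gh: "gcd (x * y) (u * v) = g * h" "g dvd x" "h dvd y"
      by (rule dvd_productE[of "gcd (x * y) (u * v)" x y]) auto
    have "g dvd u * v" using gh(1) by (metis dvd_mult_left gcd_dvd2)
    moreover have "coprime g v" using cop[of g v] gh(2) assms dvd_trans by blast
    ultimately have "g dvd u" by (simp add: coprime_dvd_mult_left_iff)
    have "h dvd u * v" using gh(1) by (metis dvd_mult_right gcd_dvd2)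
    moreover have "coprime h u" using cop[of u h] gh(3) assms dvd_trans coprime_commute by blast
    ultimately have "h dvd v" by (simp add: coprime_dvd_mult_right_iff)
    show "gcd (x * y) (u * v) dvd gcd x u * gcd y v"
      unfolding gh(1) using \<open>g dvd u\<close> \<open>h dvd v\<close> gh by (intro mult_dvd_mono) auto
    show "gcd x u * gcd y v dvd gcd (x * y) (u * v)"
      by (intro gcd_greatest mult_dvd_mono) auto
  qed
qed

lemma cyc_count_mult:
  assumes cop: "coprime a b" and pos: "a > 0" "b > 0"
  shows "cyc_count (a * b) = cyc_count a * cyc_count b"
proof -
  let ?t = "\<lambda>m d. real (d div gcd d (m div d) * totient (gcd d (m div d)))"
  have bij: "bij_betw (\<lambda>p. fst p * snd p) ({d. d dvd a} \<times> {d. d dvd b}) {d. d dvd a * b}"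
  proof (rule bij_betwI')
    fix p q assume pq: "p \<in> {d. d dvd a} \<times> {d. d dvd b}" "q \<in> {d. d dvd a} \<times> {d. d dvd b}"
    obtain x y x' y' where [simp]: "p = (x, y)" "q = (x', y')" by force
    have c: "coprime x y'" "coprime x' y" using pq cop by (auto intro: coprime_divisors)
    show "(fst p * snd p = fst q * snd q) = (p = q)"
    proof
      assume "fst p * snd p = fst q * snd q"
      hence eq: "x * y = x' * y'" by simp
      have "x dvd x' * y'" "x' dvd x * y" using eq by (metis dvd_triv_left)+
      hence "x dvd x'" "x' dvd x" using c by (auto simp: coprime_dvd_mult_left_iff)
      hence "x = x'" by (rule dvd_antisym)
      moreover have "x > 0" using pq pos by (auto intro: dvd_pos_nat)
      ultimately show "p = q" using eq by simp
    qed auto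
  next
    fix p assume "p \<in> {d. d dvd a} \<times> {d. d dvd b}"
    thus "fst p * snd p \<in> {d. d dvd a * b}" by (auto intro: mult_dvd_mono)
  next
    fix d assume "d \<in> {d. d dvd a * b}"
    then obtain x y where "d = x * y" "x dvd a" "y dvd b" by (auto elim: dvd_productE)
    thus "\<exists>p\<in>{d. d dvd a} \<times> {d. d dvd b}. d = fst p * snd p" by (intro bexI[of _ "(x, y)"]) auto
  qed
  have "cyc_count (a * b) = (\<Sum>p\<in>{d. d dvd a} \<times> {d. d dvd b}. ?t (a * b) (fst p * snd p))"
    unfolding cyc_count_def by (rule sum.reindex_bij_betw[OF bij, symmetric])
  also have "\<dots> = (\<Sum>(x, y)\<in>{d. d dvd a} \<times> {d. d dvd b}. ?t (a * b) (x * y))"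
    by (simp only: case_prod_unfold)
  also have "\<dots> = (\<Sum>(x, y)\<in>{d. d dvd a} \<times> {d. d dvd b}. ?t a x * ?t b y)"
  proof (rule sum.cong[OF refl], clarify)
    fix x y assume xy: "x dvd a" "y dvd b"
    have q: "a * b div (x * y) = (a div x) * (b div y)" using xy by (simp add: div_mult_div_if_dvd)
    have g: "gcd (x * y) (a * b div (x * y)) = gcd x (a div x) * gcd y (b div y)"
      unfolding q using cop xy by (intro gcd_mult_mult_coprime[of a b]) (auto simp: div_dvd_iff_mult)
    have "coprime (gcd x (a div x)) (gcd y (b div y))"
      by (rule coprime_divisors[OF _ _ cop]) (use xy in \<open>auto intro: dvd_trans[OF gcd_dvd1]\<close>)
    thus "?t (a * b) (x * y) = ?t a x * ?t b y"
      unfolding g by (simp add: totient_mult_coprime div_mult_div_if_dvd[symmetric])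
  qed
  also have "\<dots> = cyc_count a * cyc_count b"
    unfolding cyc_count_def sum_product sum.cartesian_product ..
  finally show ?thesis .
qed

lemma cyc_count_prime_power:
  assumes p: "prime p"
  shows "cyc_count (p ^ Suc k) = real p ^ Suc k * (1 + 1 / real p)"
proof -
  have p0: "p > 0" "p > 1" using p prime_gt_0_nat prime_gt_1_nat by auto
  let ?t = "\<lambda>m d. real (d div gcd d (m div d) * totient (gcd d (m div d)))"
  have t: "?t (p ^ Suc k) (p ^ i) = (if i = 0 \<or> i = Suc k then real p ^ i else real p ^ i - real p ^ (i - 1))"
    if i: "i \<le> Suc k" for i
  proof -
    have q: "p ^ Suc k div p ^ i = p ^ (Suc k - i)" using i p0 by (metis power_diff neq0_conv)
    show ?thesis
    proof (cases "i = 0 \<or> i = Suc k")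
      case True
      thus ?thesis unfolding q by (auto simp del: power_Suc)
    next
      case False
      define j where "j = min i (Suc k - i)"
      have j: "j > 0" "j \<le> i" using False i by (auto simp: j_def)
      have "gcd (p ^ i) (p ^ (Suc k - i)) = p ^ j"
        unfolding j_def by (cases "i \<le> Suc k - i") (auto simp: min_def gcd_proj1_iff gcd_proj2_iff le_imp_power_dvd simp del: power_Suc)
      moreover have "p ^ i div p ^ j * totient (p ^ j) = p ^ (i - j) * (p ^ (j - 1) * (p - 1))"
        using j p0 totient_prime_power[OF p j(1)] by (simp add: power_diff)
      moreover have "p ^ (i - j) * (p ^ (j - 1) * (p - 1)) = p ^ (i - 1) * (p - 1)"
        using j by (simp add: mult.assoc[symmetric] flip: power_add)
      moreover have "real (p ^ (i - 1) * (p - 1)) = real p ^ i - real p ^ (i - 1)"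
        using j p0 by (cases i) (auto simp: algebra_simps of_nat_diff)
      ultimately have "?t (p ^ Suc k) (p ^ i) = real p ^ i - real p ^ (i - 1)"
        unfolding q by (simp only:)
      thus ?thesis using False by simp
    qed
  qed
  have set: "{d. d dvd p ^ Suc k} = (\<lambda>i. p ^ i) ` {..Suc k}"
    using divides_primepow_nat[OF p, of _ "Suc k"] by auto
  have inj: "inj_on (\<lambda>i. p ^ i) {..Suc k}" using p0 by (auto simp: inj_on_def)
  have "cyc_count (p ^ Suc k) = (\<Sum>i\<le>Suc k. ?t (p ^ Suc k) (p ^ i))"
    unfolding cyc_count_def set sum.reindex[OF inj] by simp
  also have "\<dots> = (\<Sum>i\<le>Suc k. if i = 0 \<or> i = Suc k then real p ^ i else real p ^ i - real p ^ (i - 1))"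
    by (intro sum.cong t) auto
  also have "\<dots> = (\<Sum>i\<le>k. if i = 0 then 1 else real p ^ i - real p ^ (i - 1)) + real p ^ Suc k"
    by (simp del: power_Suc) (auto intro!: sum.cong)
  also have "(\<Sum>i\<le>n. if i = 0 then 1 else real p ^ i - real p ^ (i - 1)) = real p ^ n" for n
    by (induction n) auto
  also have "real p ^ k + real p ^ Suc k = real p ^ Suc k * (1 + 1 / real p)"
    using p0 by (simp add: field_simps)
  finally show ?thesis .
qed

lemma psi_mult_prime_power:
  assumes p: "prime p" and m: "m > 0" and cop: "\<not> p dvd m"
  shows "psi (p ^ Suc k * m) = real p ^ Suc k * (1 + 1 / real p) * psi m"
proof -
  have "{q. prime q \<and> q dvd p ^ Suc k * m} = insert p {q. prime q \<and> q dvd m}"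
  proof -
    have "q dvd p ^ Suc k * m \<longleftrightarrow> q = p \<or> q dvd m" if "prime q" for q
      using that p by (metis dvd_refl dvd_mult2 dvd_power prime_dvd_mult_iff prime_dvd_power primes_dvd_imp_eq zero_less_Suc dvd_trans)
    thus ?thesis using p by auto
  qed
  moreover have "finite {q. prime q \<and> q dvd m}" using m by (auto intro: finite_subset[OF _ finite_divisors_nat[of m]])
  ultimately show ?thesis using cop by (simp add: psi_def)
qed

lemma cyc_count_eq_psi: "m > 0 \<Longrightarrow> cyc_count m = psi m"
proof (induction m rule: less_induct)
  case (less m)
  show ?case
  proof (cases "m = 1")
    case True
    have "(\<Prod>p\<in>{p. prime p \<and> p dvd 1}. 1 + 1 / real p) = 1" by (rule prod.neutral) auto
    hence "psi 1 = 1" unfolding psi_def by (simp only:)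
    thus ?thesis using True by (simp add: cyc_count_def)
  next
    case False
    then obtain p where p: "prime p" "p dvd m" using prime_factor_nat by blast
    have "\<not> is_unit p" "m \<noteq> 0" using p less.prems by auto
    then obtain m' where m': "m = p ^ multiplicity p m * m'" "\<not> p dvd m'"
      using multiplicity_decompose'[of m p] by metis
    have "multiplicity p m \<noteq> 0" using multiplicity_gt_zero_iff[of m p] \<open>\<not> is_unit p\<close> \<open>m \<noteq> 0\<close> p(2) by simp
    then obtain k where k: "m = p ^ Suc k * m'" using m'(1) by (metis not0_implies_Suc)
    have pos: "m' > 0" using k less.prems by (cases m') auto
    have "1 < p ^ Suc k" using prime_gt_1_nat[OF p(1)] by (intro one_less_power) auto
    hence "m' < m" using k pos by simp
    have "coprime (p ^ Suc k) m'" using m'(2) p(1) by (simp add: prime_imp_coprime coprime_power_left_iff)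
    hence "cyc_count m = cyc_count (p ^ Suc k) * cyc_count m'"
      unfolding k using pos prime_gt_0_nat[OF p(1)] by (intro cyc_count_mult) auto
    also have "\<dots> = psi m"
      unfolding cyc_count_prime_power[OF p(1)] less.IH[OF \<open>m' < m\<close> pos] k
      using psi_mult_prime_power[OF p(1) pos m'(2)] by simp
    finally show ?thesis .
  qed
qed

lemma coprime_add_multiple: "coprime (c + e * t) e \<longleftrightarrow> coprime c e" for c e t :: nat
proof -
  have "c + e * t = t * e + c" by simp
  thus ?thesis using gcd_add_mult[of e t c] by (metis coprime_iff_gcd_eq_1 gcd.commute)
qed

lemma card_coprime_residues:
  fixes e t :: nat
  assumes "e > 0"
  shows "card {b. b < e * t \<and> coprime b e} = t * totient e"
proof (induction t)
  case (Suc t)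
  have one: "card {b. b < e \<and> coprime b e} = totient e"
  proof (cases "e = 1")
    case False
    have "{b. b < e \<and> coprime b e} = totatives e"
      using False assms by (auto simp: totatives_def order_le_less intro: Nat.gr0I)
    thus ?thesis by (simp add: totient_def)
  qed auto
  have "{b. b < e * Suc t \<and> coprime b e} = {b. b < e * t \<and> coprime b e} \<union> (\<lambda>b. b + e * t) ` {b. b < e \<and> coprime b e}"
  proof (intro equalityI subsetI)
    fix b assume b: "b \<in> {b. b < e * Suc t \<and> coprime b e}"
    show "b \<in> {b. b < e * t \<and> coprime b e} \<union> (\<lambda>b. b + e * t) ` {b. b < e \<and> coprime b e}"
    proof (cases "b < e * t")
      case False
      then obtain c where c: "b = c + e * t" by (metis add.commute le_add_diff_inverse not_less)
      have "coprime c e" using b unfolding c by (simp add: coprime_add_multiple)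
      thus ?thesis using b c by auto
    qed (use b in auto)
  qed (auto simp: coprime_add_multiple)
  hence "card {b. b < e * Suc t \<and> coprime b e} = card {b. b < e * t \<and> coprime b e} + card ((\<lambda>b. b + e * t) ` {b. b < e \<and> coprime b e})"
    by (simp only:) (rule card_Un_disjoint, auto)
  also have "card ((\<lambda>b. b + e * t) ` {b. b < e \<and> coprime b e}) = totient e"
    using one by (subst card_image) (auto simp: inj_on_def)
  finally show ?case using Suc by simp
qed auto

lemma gcd_rotate: "gcd (gcd a b) d = gcd b (gcd d a)" for a b d :: "'a :: semiring_gcd"
  by (simp only: gcd.assoc gcd.commute gcd.left_commute)

text \<open>
  The primitive matrices with rows \<open>(a, b)\<close>, \<open>(0, d)\<close> and determinant \<open>m\<close>, in Hermite normal form.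
\<close>

definition hnf_triples :: "nat \<Rightarrow> (nat \<times> nat \<times> nat) set" where
  "hnf_triples m = {(a, b, d). a > 0 \<and> a * d = m \<and> b < d \<and> gcd (gcd a b) d = 1}"

lemma card_hnf_triples:
  assumes m: "m > 0"
  shows "finite (hnf_triples m)" "real (card (hnf_triples m)) = psi m"
proof -
  let ?B = "\<lambda>d. {b. b < d \<and> coprime b (gcd d (m div d))}"
  have eq: "hnf_triples m = (\<lambda>(d, b). (m div d, b, d)) ` (SIGMA d:{d. d dvd m}. ?B d)"
  proof (intro equalityI subsetI)
    fix t assume "t \<in> hnf_triples m"
    then obtain a b d where t: "t = (a, b, d)" "a > 0" "a * d = m" "b < d" "gcd (gcd a b) d = 1"
      by (auto simp: hnf_triples_def)
    have "a = m div d" using t by auto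
    moreover have "coprime b (gcd d a)"
      unfolding coprime_iff_gcd_eq_1 by (rule trans[OF gcd_rotate[symmetric] t(5)])
    moreover have "d dvd m" using t(3) by auto
    ultimately show "t \<in> (\<lambda>(d, b). (m div d, b, d)) ` (SIGMA d:{d. d dvd m}. ?B d)"
      using t by (intro image_eqI[of _ _ "(d, b)"]) auto
  next
    fix t assume "t \<in> (\<lambda>(d, b). (m div d, b, d)) ` (SIGMA d:{d. d dvd m}. ?B d)"
    then obtain b d where t: "t = (m div d, b, d)" "d dvd m" "b < d" "coprime b (gcd d (m div d))" by auto
    have "m div d > 0" using t(2) m by (metis dvd_div_eq_0_iff gr0I)
    moreover have "gcd (gcd (m div d) b) d = 1"
      by (rule trans[OF gcd_rotate t(4)[unfolded coprime_iff_gcd_eq_1]])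
    ultimately show "t \<in> hnf_triples m" using t by (auto simp: hnf_triples_def)
  qed
  have fin: "finite {d. d dvd m}" using m by simp
  show "finite (hnf_triples m)" unfolding eq using fin by (intro finite_imageI finite_SigmaI) auto
  have "card (hnf_triples m) = card (SIGMA d:{d. d dvd m}. ?B d)"
    unfolding eq by (rule card_image) (auto simp: inj_on_def)
  also have "\<dots> = (\<Sum>d | d dvd m. card (?B d))" using fin by (intro card_SigmaI) auto
  also have "\<dots> = (\<Sum>d | d dvd m. d div gcd d (m div d) * totient (gcd d (m div d)))"
  proof (rule sum.cong[OF refl])
    fix d assume "d \<in> {d. d dvd m}"
    hence "d > 0" using m by (auto intro: dvd_pos_nat)
    hence "gcd d (m div d) > 0" by simp
    from card_coprime_residues[OF this, of "d div gcd d (m div d)"]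
    show "card (?B d) = d div gcd d (m div d) * totient (gcd d (m div d))" by simp
  qed
  finally have "real (card (hnf_triples m)) = cyc_count m" by (simp add: cyc_count_def)
  thus "real (card (hnf_triples m)) = psi m" using cyc_count_eq_psi[OF m] by simp
qed

section \<open>Sublattices with cyclic quotient\<close>

text \<open>
  For \<open>(u, v)\<close> primitive modulo \<open>m\<close> this is the kernel of a surjection of the lattice onto the integers
  modulo \<open>m\<close>, and every sublattice with cyclic quotient of order \<open>m\<close> arises in this way. The description by
  congruences makes the action of the modular group evident, the one by a basis makes the sublattice a multiple
  of a lattice generated by 1 and a point of the upper half plane.
\<close>

definition cyc_lattice :: "nat \<Rightarrow> int \<Rightarrow> int \<Rightarrow> (int \<times> int) set" where
  "cyc_lattice m u v = {(x, y). int m dvd u * x + v * y}"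

definition cyc_lattices :: "nat \<Rightarrow> (int \<times> int) set set" where
  "cyc_lattices m = {cyc_lattice m u v | u v. gcd (gcd u v) (int m) = 1}"

text \<open>
  The sublattice spanned by \<open>d\<close> and \<open>b + a * z\<close>.
\<close>

definition hnf_lattice :: "nat \<times> nat \<times> nat \<Rightarrow> (int \<times> int) set" where
  "hnf_lattice = (\<lambda>(a, b, d). {(s * int d + t * int b, t * int a) | s t. True})"

text \<open>
  With \<open>a = gcd u m\<close>, the second coordinates of the points of the sublattice are the multiples of \<open>a\<close>, and the
  points with second coordinate 0 are the multiples of \<open>(d, 0)\<close> for \<open>d = m / a\<close>. The point \<open>(b, a)\<close> lies in
  it if \<open>u / a * b \<equiv> - v\<close> modulo \<open>d\<close>, which is solvable as \<open>u / a\<close> is prime to \<open>d\<close>.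
\<close>

lemma cyc_lattice_hnf:
  assumes m: "m > 0" and prim: "gcd (gcd u v) (int m) = 1"
  shows "\<exists>T\<in>hnf_triples m. cyc_lattice m u v = hnf_lattice T"
proof -
  define a where "a = nat (gcd u (int m))"
  have ia: "int a = gcd u (int m)" by (simp add: a_def)
  have a0: "a > 0" using m by (simp add: a_def)
  obtain d where d: "int m = int a * d" using ia by (metis dvd_def gcd_dvd2)
  obtain u' where u': "u = int a * u'" using ia by (metis dvd_def gcd_dvd1)
  have "0 < int a * d" using d m by linarith
  hence d0: "d > 0" using a0 by (simp add: zero_less_mult_iff)
  have "gcd (int a * u') (int a * d) = int a" using ia u' d by simp
  hence "int a * gcd u' d = int a" using gcd_mult_left[of "int a" u' d] by (simp add: normalize_mult)
  hence cop_ud: "coprime u' d" using a0 by (simp add: coprime_iff_gcd_eq_1)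
  have cop_av: "coprime (int a) v"
  proof -
    have "gcd (gcd u (int m)) v = gcd (gcd u v) (int m)" by (simp only: gcd.assoc gcd.commute gcd.left_commute)
    thus ?thesis using prim unfolding ia coprime_iff_gcd_eq_1 by simp
  qed
  obtain x where x: "[u' * x = 1] (mod d)" using cong_solve_coprime_int[OF cop_ud] by auto
  define b where "b = nat ((- v * x) mod d)"
  have ib: "int b = (- v * x) mod d" using d0 by (simp add: b_def)
  have "[u' * int b = u' * (- v * x)] (mod d)" unfolding ib by (simp add: cong_def mod_mult_right_eq)
  also have "u' * (- v * x) = - v * (u' * x)" by (simp add: algebra_simps)
  also have "[- v * (u' * x) = - v * 1] (mod d)" by (intro cong_mult x) auto
  finally have dvd: "d dvd u' * int b + v" by (simp add: cong_iff_dvd_diff)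
  have bd: "int b < d" using d0 by (simp add: ib)
  have nd: "int (nat d) = d" using d0 by simp
  have "gcd (gcd (int a) (int b)) d = 1"
  proof -
    let ?g = "gcd (gcd (int a) (int b)) d"
    have "?g dvd u' * int b + v" using dvd by (meson dvd_trans gcd_dvd2)
    moreover have "?g dvd int b" by (meson dvd_trans gcd_dvd1 gcd_dvd2)
    ultimately have "?g dvd v" by (metis dvd_add_right_iff dvd_mult)
    moreover have "?g dvd int a" by (meson dvd_trans gcd_dvd1)
    ultimately have "is_unit ?g" by (intro coprime_common_divisor[OF cop_av])
    hence "\<bar>?g\<bar> = 1" using zdvd1_eq by blast
    thus ?thesis by simp
  qed
  hence "int (gcd (gcd a b) (nat d)) = 1" using nd by (simp flip: gcd_int_int_eq)
  hence g: "gcd (gcd a b) (nat d) = 1" by linarith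
  have T: "(a, b, nat d) \<in> hnf_triples m"
  proof -
    have "int (a * nat d) = int m" using d nd by simp
    hence "a * nat d = m" by (simp only: of_nat_eq_iff)
    moreover have "int b < int (nat d)" using bd nd by simp
    hence "b < nat d" by (simp only: of_nat_less_iff)
    ultimately show ?thesis using a0 g by (simp add: hnf_triples_def)
  qed
  have "cyc_lattice m u v = hnf_lattice (a, b, nat d)"
  proof (intro equalityI subsetI)
    fix p assume "p \<in> cyc_lattice m u v"
    then obtain x y where p: "p = (x, y)" "int a * d dvd int a * u' * x + v * y"
      using d u' by (auto simp: cyc_lattice_def)
    have "int a dvd int a * u' * x + v * y" using p(2) by (meson dvd_mult_left)
    hence "int a dvd v * y" by (simp add: mult.assoc dvd_add_right_iff)
    hence "int a dvd y" using cop_av by (simp add: coprime_dvd_mult_right_iff)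
    then obtain t where t: "y = int a * t" by (auto simp: dvd_def)
    have "int a * u' * x + v * y = int a * (u' * x + v * t)" by (simp add: t algebra_simps)
    hence "d dvd u' * x + v * t" using p(2) a0 by simp
    moreover have "d dvd (u' * int b + v) * t" using dvd by simp
    ultimately have "d dvd (u' * x + v * t) - (u' * int b + v) * t" by (rule dvd_diff)
    hence "d dvd u' * (x - int b * t)" by (simp add: algebra_simps)
    hence "d dvd x - int b * t" using cop_ud by (simp add: coprime_commute coprime_dvd_mult_right_iff)
    then obtain s where "x - int b * t = d * s" by (auto simp: dvd_def)
    hence "x = s * int (nat d) + t * int b" using d0 by (simp add: algebra_simps)
    thus "p \<in> hnf_lattice (a, b, nat d)" using p t by (auto simp: hnf_lattice_def)
  next
    fix p assume "p \<in> hnf_lattice (a, b, nat d)"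
    then obtain s t where p: "p = (s * d + t * int b, t * int a)" using d0 by (auto simp: hnf_lattice_def)
    have "u * (s * d + t * int b) + v * (t * int a) = int a * (d * (u' * s) + (u' * int b + v) * t)"
      by (simp add: u' algebra_simps)
    also have "int a * d dvd \<dots>" using dvd by (intro mult_dvd_mono dvd_add) auto
    finally show "p \<in> cyc_lattice m u v" using d p by (simp add: cyc_lattice_def)
  qed
  with T show ?thesis by blast
qed

lemma cyc_lattices_subset:
  assumes "m > 0"
  shows "cyc_lattices m \<subseteq> hnf_lattice ` hnf_triples m"
proof
  fix L assume "L \<in> cyc_lattices m"
  then obtain u v where "L = cyc_lattice m u v" "gcd (gcd u v) (int m) = 1" by (auto simp: cyc_lattices_def)
  thus "L \<in> hnf_lattice ` hnf_triples m" using cyc_lattice_hnf[OF assms, of u v] by auto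
qed

lemma finite_cyc_lattices: "m > 0 \<Longrightarrow> finite (cyc_lattices m)"
  using cyc_lattices_subset card_hnf_triples(1) by (meson finite_imageI finite_subset)

lemma card_cyc_lattices:
  assumes "m > 0"
  shows "real (card (cyc_lattices m)) \<le> psi m"
proof -
  have "card (cyc_lattices m) \<le> card (hnf_lattice ` hnf_triples m)"
    using cyc_lattices_subset[OF assms] card_hnf_triples(1)[OF assms] by (intro card_mono) auto
  also have "\<dots> \<le> card (hnf_triples m)" using card_hnf_triples(1)[OF assms] by (rule card_image_le)
  finally show ?thesis using card_hnf_triples(2)[OF assms] by linarith
qed

lemma mapT_cyc_lattice: "mapT ` cyc_lattice m u v = cyc_lattice m u (v - u)"
proof (intro equalityI subsetI)
  fix p assume "p \<in> cyc_lattice m u (v - u)"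
  thus "p \<in> mapT ` cyc_lattice m u v"
    by (intro image_eqI[of _ _ "(fst p - snd p, snd p)"]) (auto simp: mapT_def cyc_lattice_def algebra_simps)
qed (auto simp: mapT_def cyc_lattice_def algebra_simps)

lemma mapS_cyc_lattice: "mapS ` cyc_lattice m u v = cyc_lattice m (- v) u"
proof (intro equalityI subsetI)
  fix p assume "p \<in> cyc_lattice m (- v) u"
  thus "p \<in> mapS ` cyc_lattice m u v"
    by (intro image_eqI[of _ _ "(snd p, - fst p)"]) (auto simp: mapS_def cyc_lattice_def algebra_simps)
qed (auto simp: mapS_def cyc_lattice_def algebra_simps)

lemma mapT_cyc_lattices: "L \<in> cyc_lattices m \<Longrightarrow> mapT ` L \<in> cyc_lattices m"
proof -
  assume "L \<in> cyc_lattices m"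
  then obtain u v where L: "L = cyc_lattice m u v" "gcd (gcd u v) (int m) = 1" by (auto simp: cyc_lattices_def)
  have "gcd u (v - u) = gcd u v" using gcd_diff1[of v u] by (simp add: gcd.commute)
  hence "gcd (gcd u (v - u)) (int m) = 1" using L(2) by simp
  thus ?thesis unfolding L(1) mapT_cyc_lattice cyc_lattices_def mem_Collect_eq by (intro exI[of _ u] exI[of _ "v - u"] conjI refl)
qed

lemma mapS_cyc_lattices: "L \<in> cyc_lattices m \<Longrightarrow> mapS ` L \<in> cyc_lattices m"
proof -
  assume "L \<in> cyc_lattices m"
  then obtain u v where L: "L = cyc_lattice m u v" "gcd (gcd u v) (int m) = 1" by (auto simp: cyc_lattices_def)
  have "gcd (- v) u = gcd u v" by (simp add: gcd.commute)
  hence "gcd (gcd (- v) u) (int m) = 1" using L(2) by simp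
  thus ?thesis unfolding L(1) mapS_cyc_lattice cyc_lattices_def mem_Collect_eq by (intro exI[of _ "- v"] exI[of _ u] conjI refl)
qed

lemma bij_mapT_cyc_lattices: "m > 0 \<Longrightarrow> bij_betw ((`) mapT) (cyc_lattices m) (cyc_lattices m)"
  by (intro bij_betw_imageI endo_inj_surj finite_cyc_lattices)
     (use mapT_cyc_lattices inj_mapT in \<open>auto simp: inj_on_def inj_image_eq_iff\<close>)

lemma bij_mapS_cyc_lattices: "m > 0 \<Longrightarrow> bij_betw ((`) mapS) (cyc_lattices m) (cyc_lattices m)"
  by (intro bij_betw_imageI endo_inj_surj finite_cyc_lattices)
     (use mapS_cyc_lattices inj_mapS in \<open>auto simp: inj_on_def inj_image_eq_iff\<close>)

section \<open>The product of the discriminants of the sublattices\<close>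

definition lat_disc :: "(int \<times> int) set \<Rightarrow> complex \<Rightarrow> complex" where
  "lat_disc L z = (60 * lat_sum 4 L z) ^ 3 - 27 * (140 * lat_sum 6 L z) ^ 2"

definition lat_j :: "(int \<times> int) set \<Rightarrow> complex \<Rightarrow> complex" where
  "lat_j L z = 1728 * (60 * lat_sum 4 L z) ^ 3 / lat_disc L z"

lemma lat_disc_plus1: "lat_disc L (z + 1) = lat_disc (mapT ` L) z"
  by (simp add: lat_disc_def lat_sum_plus1)

lemma lat_disc_inversion: "z \<noteq> 0 \<Longrightarrow> lat_disc L (- (1 / z)) = z ^ 12 * lat_disc (mapS ` L) z"
  by (simp add: lat_disc_def lat_sum_inversion power_mult_distrib algebra_simps flip: power_mult)

lemma lat_j_plus1: "lat_j L (z + 1) = lat_j (mapT ` L) z"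
  by (simp add: lat_j_def lat_disc_plus1 lat_sum_plus1)

lemma lat_j_inversion: "z \<noteq> 0 \<Longrightarrow> lat_j L (- (1 / z)) = lat_j (mapS ` L) z"
  by (simp add: lat_j_def lat_disc_inversion lat_sum_inversion power_mult_distrib flip: power_mult)

definition hnf_point :: "nat \<times> nat \<times> nat \<Rightarrow> complex \<Rightarrow> complex" where
  "hnf_point = (\<lambda>(a, b, d) z. (of_nat a * z + of_nat b) / of_nat d)"

definition hnf_of :: "nat \<Rightarrow> (int \<times> int) set \<Rightarrow> nat \<times> nat \<times> nat" where
  "hnf_of m L = (SOME T. T \<in> hnf_triples m \<and> L = hnf_lattice T)"

text \<open>
  The point \<open>\<tau> = (a * z + b) / d\<close> for which the sublattice is \<open>d\<close> times the lattice spanned by 1 and \<open>\<tau>\<close>.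
\<close>

definition cyc_point :: "nat \<Rightarrow> (int \<times> int) set \<Rightarrow> complex \<Rightarrow> complex" where
  "cyc_point m L = hnf_point (hnf_of m L)"

definition cyc_ratio :: "nat \<Rightarrow> (int \<times> int) set \<Rightarrow> real" where
  "cyc_ratio m L = (case hnf_of m L of (a, b, d) \<Rightarrow> real a / real d)"

definition cyc_denom :: "nat \<Rightarrow> (int \<times> int) set \<Rightarrow> nat" where
  "cyc_denom m L = (case hnf_of m L of (a, b, d) \<Rightarrow> d)"

lemma lat_sum_hnf:
  assumes "a > 0" "d > 0"
  shows "lat_sum k (hnf_lattice (a, b, d)) z = eisenstein_G k (hnf_point (a, b, d) z) / of_nat d ^ k"
proof -
  define f where "f = (\<lambda>(s, t). (s * int d + t * int b, t * int a))"
  have inj: "inj f" using assms by (auto simp: inj_def f_def)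
  have "hnf_lattice (a, b, d) - {(0, 0)} = f ` (UNIV - {(0, 0)})"
  proof -
    have "hnf_lattice (a, b, d) = range f" by (auto simp: hnf_lattice_def f_def)
    moreover have "f (0, 0) = (0, 0)" by (simp add: f_def)
    hence "f ` (UNIV - {(0, 0)}) = range f - {(0, 0)}" using inj by (simp add: image_set_diff)
    ultimately show ?thesis by simp
  qed
  hence "lat_sum k (hnf_lattice (a, b, d)) z =
      infsum ((\<lambda>(x, y). 1 / (of_int x + of_int y * z) ^ k) \<circ> f) (UNIV - {(0, 0)})"
    unfolding lat_sum_def by (simp add: infsum_reindex[OF inj_on_subset[OF inj]])
  also have "\<dots> = (\<Sum>\<^sub>\<infinity>p\<in>UNIV - {(0, 0)}. 1 / of_nat d ^ k * (case p of (s, t) \<Rightarrow> 1 / (of_int s + of_int t * hnf_point (a, b, d) z) ^ k))"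
  proof (rule infsum_cong)
    fix p :: "int \<times> int"
    obtain s t where p: "p = (s, t)" by force
    have "of_int (s * int d + t * int b) + of_int (t * int a) * z =
            of_nat d * (of_int s + of_int t * hnf_point (a, b, d) z)"
      using assms by (simp add: hnf_point_def field_simps)
    thus "((\<lambda>(x, y). 1 / (of_int x + of_int y * z) ^ k) \<circ> f) p =
            1 / of_nat d ^ k * (case p of (s, t) \<Rightarrow> 1 / (of_int s + of_int t * hnf_point (a, b, d) z) ^ k)"
      by (simp add: p f_def power_mult_distrib)
  qed
  also have "\<dots> = 1 / of_nat d ^ k * eisenstein_G k (hnf_point (a, b, d) z)"
    unfolding eisenstein_G_def by (rule infsum_cmult_right')
  finally show ?thesis by simp
qed

lemma cyc_lattice_facts:
  assumes m: "m > 0" and L: "L \<in> cyc_lattices m"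
  shows "cyc_denom m L > 0" "cyc_ratio m L > 0" "cyc_ratio m L \<le> real m" "1 / real m \<le> cyc_ratio m L"
    "Im (cyc_point m L z) = cyc_ratio m L * Im z"
    "lat_disc L z = disc (cyc_point m L z) / of_nat (cyc_denom m L) ^ 12"
    "lat_j L z = modular_j (cyc_point m L z)"
proof -
  have "\<exists>T. T \<in> hnf_triples m \<and> L = hnf_lattice T" using cyc_lattices_subset[OF m] L by blast
  hence T: "hnf_of m L \<in> hnf_triples m" "L = hnf_lattice (hnf_of m L)"
    unfolding hnf_of_def by (metis (mono_tags, lifting) someI_ex)+
  obtain a b d where abd: "hnf_of m L = (a, b, d)" by (metis prod_cases3)
  have t: "a > 0" "a * d = m" "d > 0" using T(1) abd m by (auto simp: hnf_triples_def intro: Nat.gr0I)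
  have m': "real m = real a * real d" by (simp flip: t(2))
  have ge1: "real a \<ge> 1" "real d \<ge> 1" using t by auto
  show d0: "cyc_denom m L > 0" using t by (simp add: cyc_denom_def abd)
  show "cyc_ratio m L > 0" using t by (simp add: cyc_ratio_def abd)
  show "cyc_ratio m L \<le> real m"
  proof -
    have "real a / real d \<le> real a / 1" using ge1 by (intro divide_left_mono) auto
    also have "\<dots> \<le> real a * real d" using ge1 by simp
    finally show ?thesis by (simp add: cyc_ratio_def abd m')
  qed
  show "1 / real m \<le> cyc_ratio m L"
  proof -
    have "1 / (real a * real d) \<le> real a / real d" using ge1 mult_mono[of 1 "real a" 1 "real a"] by (simp add: field_simps)
    thus ?thesis by (simp add: cyc_ratio_def abd m')
  qed
  show "Im (cyc_point m L z) = cyc_ratio m L * Im z"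
    by (simp add: cyc_point_def cyc_ratio_def hnf_point_def abd Im_divide_of_nat)
  have ls: "lat_sum k L z = eisenstein_G k (cyc_point m L z) / of_nat d ^ k" for k
    unfolding cyc_point_def abd lat_sum_hnf[OF t(1,3), symmetric] using T(2) abd by simp
  show ld: "lat_disc L z = disc (cyc_point m L z) / of_nat (cyc_denom m L) ^ 12"
    using t(3) unfolding lat_disc_def ls disc_def
    by (simp add: cyc_denom_def abd power_divide diff_divide_distrib flip: power_mult)
  show "lat_j L z = modular_j (cyc_point m L z)"
    using t(3) unfolding lat_j_def ld unfolding ls modular_j_eq
    by (simp add: cyc_denom_def abd power_divide flip: power_mult)
qed

lemma holomorphic_cyc_point: "cyc_point m L holomorphic_on A"
proof -
  obtain a b d where abd: "hnf_of m L = (a, b, d)" by (metis prod_cases3)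
  show ?thesis
  proof (cases "d = 0")
    case True
    thus ?thesis by (simp add: cyc_point_def hnf_point_def abd)
  next
    case False
    have "(\<lambda>z. (of_nat a * z + of_nat b) / of_nat d) holomorphic_on A"
      using False by (intro holomorphic_intros) auto
    thus ?thesis by (simp add: cyc_point_def hnf_point_def abd)
  qed
qed

text \<open>
  The modular group permutes the sublattices, so the quotient \<open>F\<close> of the two sides, without absolute values,
  is an invariant function without zeros. At the cusp \<open>\<bar>F z\<bar>\<close> behaves like \<open>exp (- 2 * pi * s * Im z)\<close>, up to
  a factor that tends to 1. Whichever of \<open>F\<close> and \<open>1 / F\<close> is bounded there is constant, which forces \<open>s = 0\<close>
  and \<open>\<bar>F\<bar> = 1\<close>.
\<close>

lemma prod_disc_cyc_points:
  assumes m: "m > 0" and z: "Im z > 0"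
  shows "(\<Prod>L\<in>cyc_lattices m. cmod (disc (cyc_point m L z))) = cmod (disc z) ^ card (cyc_lattices m)"
proof -
  define C where "C = cyc_lattices m"
  define N where "N = card C"
  note facts = cyc_lattice_facts[OF m, folded C_def]
  have finC: "finite C" unfolding C_def by (rule finite_cyc_lattices[OF m])
  have Im_pos: "Im (cyc_point m L z) > 0" if "L \<in> C" "Im z > 0" for L z
    using facts(2,5)[OF that(1)] that(2) by simp
  define F where "F = (\<lambda>z. (\<Prod>L\<in>C. disc (cyc_point m L z)) / disc z ^ N)"
  \<comment> \<open>The invariance is visible for the discriminants of the sublattices, which differ by the constant \<open>E\<close>.\<close>
  define E where "E = (\<Prod>L\<in>C. of_nat (cyc_denom m L) ^ 12 :: complex)"
  have F_lat: "F z = E * (\<Prod>L\<in>C. lat_disc L z) / disc z ^ N" for z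
  proof -
    have "E * (\<Prod>L\<in>C. lat_disc L z) = (\<Prod>L\<in>C. of_nat (cyc_denom m L) ^ 12 * lat_disc L z)"
      by (simp add: E_def prod.distrib)
    also have "\<dots> = (\<Prod>L\<in>C. disc (cyc_point m L z))"
      by (rule prod.cong) (use facts in auto)
    finally show ?thesis by (simp add: F_def)
  qed
  have nz: "F z \<noteq> 0" if "Im z > 0" for z
    using finC disc_nonzero[OF that] disc_nonzero[OF Im_pos[OF _ that]] by (auto simp: F_def)
  have hol: "F holomorphic_on upper_half_plane"
  proof -
    have "(\<lambda>z. disc (cyc_point m L z)) holomorphic_on upper_half_plane" if "L \<in> C" for L
      by (rule holomorphic_on_compose_gen[OF holomorphic_cyc_point disc_holomorphic, unfolded o_def])
         (use Im_pos[OF that] in \<open>auto simp: upper_half_plane_def\<close>)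
    thus ?thesis unfolding F_def
      by (intro holomorphic_intros disc_holomorphic) (use disc_nonzero in \<open>auto simp: upper_half_plane_def\<close>)
  qed
  have F_plus: "F (z + 1) = F z" if "Im z > 0" for z
  proof -
    have "(\<Prod>L\<in>C. lat_disc L (z + 1)) = (\<Prod>L\<in>C. lat_disc (mapT ` L) z)" by (simp add: lat_disc_plus1)
    also have "\<dots> = (\<Prod>L\<in>C. lat_disc L z)"
      using prod.reindex_bij_betw[OF bij_mapT_cyc_lattices[OF m], of "\<lambda>L. lat_disc L z"] by (simp add: C_def)
    finally show ?thesis by (simp add: F_lat disc_plus1)
  qed
  have F_inv: "F (- (1 / z)) = F z" if "Im z > 0" for z
  proof -
    have "z \<noteq> 0" using that by auto
    have "(\<Prod>L\<in>C. lat_disc L (- (1 / z))) = (\<Prod>L\<in>C. z ^ 12 * lat_disc (mapS ` L) z)"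
      by (intro prod.cong refl lat_disc_inversion \<open>z \<noteq> 0\<close>)
    also have "\<dots> = (z ^ 12) ^ N * (\<Prod>L\<in>C. lat_disc (mapS ` L) z)" by (simp add: prod.distrib N_def)
    also have "(\<Prod>L\<in>C. lat_disc (mapS ` L) z) = (\<Prod>L\<in>C. lat_disc L z)"
      using prod.reindex_bij_betw[OF bij_mapS_cyc_lattices[OF m], of "\<lambda>L. lat_disc L z"] by (simp add: C_def)
    finally show ?thesis using \<open>z \<noteq> 0\<close> by (simp add: F_lat disc_inversion[OF that] power_mult_distrib)
  qed
  obtain h where h: "h holomorphic_on ball 0 1" "\<And>z. Im z > 0 \<Longrightarrow> disc z = qexp z * h (qexp z)" "h 0 \<noteq> 0"
    by (rule disc_cusp_simple, rule that, assumption, blast, assumption)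
  define H where "H = (\<lambda>z. cmod (h (qexp z)))"
  define c where "c = cmod (h 0)"
  have c: "c > 0" using h(3) by (simp add: c_def)
  have disc_H: "cmod (disc z) = exp (- 2 * pi * Im z) * H z" if "Im z > 0" for z
    using h(2)[OF that] by (simp add: norm_mult norm_qexp H_def)
  have H_pos: "H z > 0" if "Im z > 0" for z
    using disc_nonzero[OF that] h(2)[OF that] by (simp add: H_def)
  have "isCont (\<lambda>w. cmod (h w)) 0"
    using holomorphic_on_imp_continuous_on[OF h(1)] by (simp add: continuous_on_eq_continuous_at isCont_norm)
  hence near: "\<exists>Y>0. \<forall>z. Im z \<ge> Y \<longrightarrow> \<bar>H z - c\<bar> < e" if e: "e > 0" for e
  proof -
    obtain \<delta> where \<delta>: "\<delta> > 0" "\<And>w. cmod w < \<delta> \<Longrightarrow> \<bar>cmod (h w) - cmod (h 0)\<bar> < e"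
      using \<open>isCont (\<lambda>w. cmod (h w)) 0\<close> e unfolding continuous_at_eps_delta
      by (auto simp: dist_norm)
    have "((\<lambda>y::real. exp (- 2 * pi * y)) \<longlongrightarrow> 0) at_top" by real_asymp
    hence "\<forall>\<^sub>F y in at_top. exp (- 2 * pi * y) < \<delta>" using \<delta>(1) by (rule order_tendstoD)
    then obtain Y0 where Y0: "\<And>y. y \<ge> Y0 \<Longrightarrow> exp (- 2 * pi * y) < \<delta>" by (auto simp: eventually_at_top_linorder)
    show ?thesis
    proof (intro exI[of _ "max 1 Y0"] conjI allI impI)
      fix z assume "Im z \<ge> max 1 Y0"
      hence "cmod (qexp z) < \<delta>" using Y0 unfolding norm_qexp by simp
      thus "\<bar>H z - c\<bar> < e" using \<delta>(2) by (simp add: H_def c_def)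
    qed auto
  qed
  define R where "R = (\<lambda>z. (\<Prod>L\<in>C. H (cyc_point m L z)) / H z ^ N)"
  \<comment> \<open>The order of \<open>F\<close> at the cusp.\<close>
  define s where "s = (\<Sum>L\<in>C. cyc_ratio m L) - real N"
  have F_R: "cmod (F z) = exp (- 2 * pi * s * Im z) * R z" if z: "Im z > 0" for z
  proof -
    have "cmod (\<Prod>L\<in>C. disc (cyc_point m L z)) = (\<Prod>L\<in>C. exp (- 2 * pi * (cyc_ratio m L * Im z)) * H (cyc_point m L z))"
      unfolding prod_norm[symmetric]
      by (intro prod.cong refl) (use disc_H Im_pos z facts(5) in auto)
    also have "\<dots> = exp (\<Sum>L\<in>C. - 2 * pi * (cyc_ratio m L * Im z)) * (\<Prod>L\<in>C. H (cyc_point m L z))"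
      by (simp add: prod.distrib exp_sum[OF finC])
    also have "(\<Sum>L\<in>C. - 2 * pi * (cyc_ratio m L * Im z)) = - 2 * pi * (\<Sum>L\<in>C. cyc_ratio m L) * Im z"
      by (simp add: sum_distrib_left sum_distrib_right sum_negf mult_ac)
    finally have 1: "cmod (\<Prod>L\<in>C. disc (cyc_point m L z)) =
       exp (- 2 * pi * (\<Sum>L\<in>C. cyc_ratio m L) * Im z) * (\<Prod>L\<in>C. H (cyc_point m L z))" .
    have 2: "cmod (disc z ^ N) = exp (- 2 * pi * real N * Im z) * H z ^ N"
      by (simp add: norm_power disc_H[OF z] power_mult_distrib exp_of_nat_mult[symmetric] mult_ac)
    have "exp (- 2 * pi * s * Im z) = exp (- 2 * pi * (\<Sum>L\<in>C. cyc_ratio m L) * Im z) / exp (- 2 * pi * real N * Im z)"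
      by (simp add: s_def algebra_simps flip: exp_diff)
    thus ?thesis unfolding F_def norm_divide 1 2 R_def by simp
  qed
  have R_pos: "R z > 0" if "Im z > 0" for z
    unfolding R_def using H_pos Im_pos that by (intro divide_pos_pos prod_pos) auto
  obtain Y where Y: "Y > 0" "\<And>z. Im z \<ge> Y \<Longrightarrow> \<bar>H z - c\<bar> < c / 2" using near[of "c / 2"] c by auto
  have H_bd: "c / 2 \<le> H z \<and> H z \<le> 2 * c" if "Im z \<ge> Y" for z using Y(2)[OF that] c unfolding abs_less_iff by (intro conjI) linarith+
  define Y' where "Y' = max Y (real m * Y)"
  have Y': "Im (cyc_point m L z) \<ge> Y" if "L \<in> C" "Im z \<ge> Y'" for L z
  proof -
    have "Y = 1 / real m * (real m * Y)" using m by simp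
    also have "\<dots> \<le> cyc_ratio m L * Im z"
      using facts(4)[OF that(1)] that(2) Y(1) facts(2)[OF that(1)] by (intro mult_mono) (auto simp: Y'_def)
    finally show ?thesis using facts(5)[OF that(1)] by simp
  qed
  have R_up: "R z \<le> (2 * c) ^ N / (c / 2) ^ N" and R_lo: "R z \<ge> (c / 2) ^ N / (2 * c) ^ N" if "Im z \<ge> Y'" for z
  proof -
    have zY: "Im z \<ge> Y" using that by (simp add: Y'_def)
    have "(\<Prod>L\<in>C. H (cyc_point m L z)) \<le> (\<Prod>L\<in>C. 2 * c)"
      using H_bd Y'[OF _ that] c by (intro prod_mono) (auto simp: H_def)
    moreover have "(\<Prod>L\<in>C. c / 2) \<le> (\<Prod>L\<in>C. H (cyc_point m L z))"
      using H_bd Y'[OF _ that] c by (intro prod_mono) auto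
    moreover have "(c / 2) ^ N \<le> H z ^ N" "H z ^ N \<le> (2 * c) ^ N"
      using H_bd[OF zY] c by (intro power_mono; auto simp: H_def)+
    moreover have "0 < (c / 2) ^ N" using c by simp
    ultimately show "R z \<le> (2 * c) ^ N / (c / 2) ^ N" "R z \<ge> (c / 2) ^ N / (2 * c) ^ N"
      unfolding R_def using c H_pos[of z] zY Y(1) by (auto simp: N_def intro!: frac_le prod_nonneg simp: H_def)
  qed
  define G where "G = (if s \<ge> 0 then F else (\<lambda>z. 1 / F z))"
  have "cusp_order 0 G"
  proof (rule cusp_orderI[of _ Y' "(2 * c) ^ N / (c / 2) ^ N"])
    show "G holomorphic_on upper_half_plane" unfolding G_def
      using hol nz by (auto intro!: holomorphic_intros simp: upper_half_plane_def)
    show "G (z + 1) = G z" if "Im z > 0" for z using F_plus[OF that] by (simp add: G_def)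
    fix z assume z: "Im z > 0" "Im z \<ge> Y'"
    show "cmod (G z) \<le> (2 * c) ^ N / (c / 2) ^ N * exp (- 2 * pi * real 0 * Im z)"
    proof (cases "s \<ge> 0")
      case True
      have "exp (- 2 * pi * s * Im z) * R z \<le> 1 * R z"
        using True z R_pos[OF z(1)] by (intro mult_right_mono) auto
      thus ?thesis using True R_up[OF z(2)] F_R[OF z(1)] by (simp add: G_def)
    next
      case False
      have "1 / ((c / 2) ^ N / (2 * c) ^ N) \<ge> 1 / R z"
        using R_lo[OF z(2)] c by (intro divide_left_mono mult_pos_pos R_pos z(1)) auto
      hence 1: "1 / R z \<le> (2 * c) ^ N / (c / 2) ^ N" by simp
      have "1 * R z \<le> exp (- 2 * pi * s * Im z) * R z"
      proof (rule mult_right_mono)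
        have "2 * pi * s * Im z \<le> 0"
          using False z by (intro mult_nonpos_nonneg mult_nonneg_nonpos) auto
        thus "1 \<le> exp (- 2 * pi * s * Im z)" by simp
        show "0 \<le> R z" using R_pos[OF z(1)] by simp
      qed
      hence "R z \<le> cmod (F z)" using F_R[OF z(1)] by simp
      hence "1 / cmod (F z) \<le> 1 / R z" using R_pos[OF z(1)] by (intro divide_left_mono mult_pos_pos) auto
      thus ?thesis using False 1 by (simp add: G_def norm_divide)
    qed
  qed
  hence "mform 0 0 G" using F_inv by (simp add: mform_def G_def)
  then obtain \<kappa> where "\<And>z. Im z > 0 \<Longrightarrow> G z = \<kappa>" using mform_0_const by blast
  hence const: "F w = F z" if "Im w > 0" for w
  proof -
    have "G w = G z" using \<open>\<And>z. Im z > 0 \<Longrightarrow> G z = \<kappa>\<close> that z by simp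
    thus ?thesis by (cases "s \<ge> 0") (simp_all add: G_def divide_inverse)
  qed
  have ev: "\<forall>\<^sub>F y in at_top. R (\<i> * of_real y) * exp (- 2 * pi * s * y) = cmod (F z)"
    using eventually_gt_at_top[of "0::real"]
  proof eventually_elim
    case (elim y)
    have "cmod (F (\<i> * of_real y)) = exp (- 2 * pi * s * y) * R (\<i> * of_real y)"
      using F_R[of "\<i> * of_real y"] elim by simp
    moreover have "F (\<i> * of_real y) = F z" using const[of "\<i> * of_real y"] elim by simp
    ultimately show ?case by (simp only: mult.commute)
  qed
  have Hlim: "((\<lambda>y::real. H (p y)) \<longlongrightarrow> c) at_top" if "\<And>y. Im (p y) = r * y" "r > 0" for p r
  proof (rule tendstoI)
    fix e :: real assume "e > 0"
    then obtain Y where Y: "\<And>z. Im z \<ge> Y \<Longrightarrow> \<bar>H z - c\<bar> < e" using near by blast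
    show "\<forall>\<^sub>F y in at_top. dist (H (p y)) c < e"
      using eventually_ge_at_top[of "Y / r"]
      by eventually_elim (use Y that in \<open>auto simp: dist_real_def field_simps\<close>)
  qed
  have Rlim: "((\<lambda>y::real. R (\<i> * of_real y)) \<longlongrightarrow> 1) at_top"
  proof -
    have "((\<lambda>y::real. R (\<i> * of_real y)) \<longlongrightarrow> (\<Prod>L\<in>C. c) / c ^ N) at_top"
      unfolding R_def
    proof (intro tendsto_divide tendsto_prod tendsto_power)
      show "((\<lambda>y::real. H (\<i> * of_real y)) \<longlongrightarrow> c) at_top" by (rule Hlim[of _ 1]) auto
      show "((\<lambda>y::real. H (cyc_point m L (\<i> * of_real y))) \<longlongrightarrow> c) at_top" if "L \<in> C" for L
        by (rule Hlim[of _ "cyc_ratio m L"]) (use facts(2,5)[OF that] in auto)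
    qed (use c in auto)
    thus ?thesis using c by (simp add: N_def)
  qed
  have Fz: "cmod (F z) > 0" using nz[OF z] by simp
  have "cmod (F z) = 1"
  proof (cases s "0 :: real" rule: linorder_cases)
    case equal
    have "((\<lambda>y::real. R (\<i> * of_real y)) \<longlongrightarrow> cmod (F z)) at_top"
      by (rule tendsto_eventually) (use ev equal in simp)
    thus ?thesis using Rlim by (metis tendsto_unique trivial_limit_at_top_linorder)
  next
    case greater
    have "((\<lambda>y::real. exp (- 2 * pi * s * y)) \<longlongrightarrow> 0) at_top" using greater by real_asymp
    from tendsto_mult[OF Rlim this] have "((\<lambda>y::real. R (\<i> * of_real y) * exp (- 2 * pi * s * y)) \<longlongrightarrow> 0) at_top" by simp
    hence "cmod (F z) = 0" using tendsto_eventually[OF ev] by (metis tendsto_unique trivial_limit_at_top_linorder)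
    thus ?thesis using Fz by simp
  next
    case less
    define t where "t = - s"
    have "t > 0" using less by (simp add: t_def)
    hence "((\<lambda>y::real. exp (- 2 * pi * t * y)) \<longlongrightarrow> 0) at_top" by real_asymp
    hence "((\<lambda>y::real. exp (2 * pi * s * y)) \<longlongrightarrow> 0) at_top" by (simp add: t_def)
    from tendsto_mult[OF tendsto_eventually[OF ev] this]
    have "((\<lambda>y::real. R (\<i> * of_real y) * exp (- 2 * pi * s * y) * exp (2 * pi * s * y)) \<longlongrightarrow> 0) at_top" by simp
    hence "((\<lambda>y::real. R (\<i> * of_real y)) \<longlongrightarrow> 0) at_top" by (simp add: mult.assoc flip: exp_add)
    hence "(1 :: real) = 0" using Rlim by (metis tendsto_unique trivial_limit_at_top_linorder)
    thus ?thesis by simp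
  qed
  hence "cmod (\<Prod>L\<in>C. disc (cyc_point m L z)) = cmod (disc z) ^ N"
    using disc_nonzero[OF z] by (simp add: F_def norm_divide norm_power)
  thus ?thesis unfolding C_def N_def prod_norm .
qed

text \<open>
  Each imaginary part is \<open>a / d * Im z \<ge> Im z / m\<close>.
\<close>

lemma prod_disc_norm_ge:
  assumes m: "m > 0" and z: "Im z > 0"
  shows "(\<Prod>L\<in>cyc_lattices m. disc_norm (cyc_point m L z)) \<ge> (disc_norm z / real m ^ 6) ^ card (cyc_lattices m)"
proof -
  let ?C = "cyc_lattices m"
  note facts = cyc_lattice_facts[OF m]
  have "(disc_norm z / real m ^ 6) ^ card ?C = cmod (disc z) ^ card ?C * (\<Prod>L\<in>?C. (1 / real m * Im z) ^ 6)"
    by (simp add: disc_norm_def power_mult_distrib power_divide flip: power_mult)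
  also have "\<dots> \<le> cmod (disc z) ^ card ?C * (\<Prod>L\<in>?C. (cyc_ratio m L * Im z) ^ 6)"
    using facts z by (intro mult_left_mono prod_mono conjI power_mono mult_right_mono) auto
  also have "\<dots> = (\<Prod>L\<in>?C. disc_norm (cyc_point m L z))"
    unfolding prod_disc_cyc_points[OF assms, symmetric] prod.distrib[symmetric] disc_norm_def
    by (intro prod.cong refl) (simp add: facts)
  finally show ?thesis .
qed

section \<open>Factorization of the modular polynomial\<close>

lemma coeff_linear_mult:
  "coeff ([:- a, 1:] * p) i = (if i = 0 then 0 else coeff p (i - 1)) - a * coeff p i" for a :: complex
  by (cases i) (auto simp: mult_pCons_left)

lemma norm_coeff_prod_linear_le:
  fixes x :: "'a \<Rightarrow> complex"
  assumes "finite S"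
  shows "cmod (coeff (\<Prod>f\<in>S. [:- x f, 1:]) i) \<le> (\<Prod>f\<in>S. 1 + cmod (x f))"
  using assms
proof (induction S arbitrary: i rule: finite_induct)
  case (insert f S)
  let ?p = "\<Prod>f\<in>S. [:- x f, 1:]" and ?B = "\<Prod>f\<in>S. 1 + cmod (x f)"
  have B: "?B \<ge> 0" by (intro prod_nonneg) auto
  have "cmod (coeff ([:- x f, 1:] * ?p) i) \<le> cmod (if i = 0 then 0 else coeff ?p (i - 1)) + cmod (x f * coeff ?p i)"
    unfolding coeff_linear_mult by (rule norm_triangle_ineq4)
  also have "\<dots> \<le> ?B + cmod (x f) * ?B"
    using insert.IH B by (intro add_mono) (auto simp: norm_mult intro: mult_left_mono)
  finally show ?case using insert.hyps by (simp add: algebra_simps)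
qed auto

lemma degree_prod_linear:
  fixes x :: "'a \<Rightarrow> complex"
  assumes "finite S"
  shows "degree (\<Prod>f\<in>S. [:- x f, 1:]) = card S" "lead_coeff (\<Prod>f\<in>S. [:- x f, 1:]) = 1"
proof -
  have "degree (\<Prod>f\<in>S. [:- x f, 1:]) = card S \<and> lead_coeff (\<Prod>f\<in>S. [:- x f, 1:]) = 1"
    using assms
  proof (induction S rule: finite_induct)
    case (insert f S)
    let ?p = "\<Prod>f\<in>S. [:- x f, 1:]"
    have "?p \<noteq> 0" using insert by auto
    hence "degree ([:- x f, 1:] * ?p) = Suc (card S)"
      using insert by (subst degree_mult_eq) auto
    note deg = this
    have "lead_coeff ([:- x f, 1:] * ?p) = lead_coeff [:- x f, 1:] * lead_coeff ?p"
      by (rule lead_coeff_mult)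
    moreover have "lead_coeff [:- x f, 1:] = 1" by simp
    moreover have "lead_coeff ?p = 1" using insert.IH by blast
    ultimately have "lead_coeff ([:- x f, 1:] * ?p) = 1" by (simp only: mult_1_left)
    note lead = this
    have eq: "(\<Prod>f\<in>insert f S. [:- x f, 1:]) = [:- x f, 1:] * ?p"
      by (rule prod.insert[OF insert.hyps])
    show ?case unfolding eq card_insert_disjoint[OF insert.hyps] using deg lead by (rule conjI)
  qed auto
  thus "degree (\<Prod>f\<in>S. [:- x f, 1:]) = card S" "lead_coeff (\<Prod>f\<in>S. [:- x f, 1:]) = 1" by auto
qed

lemma monic_eq_prod_roots:
  fixes p :: "complex poly"
  assumes S: "finite S" and inj: "inj_on x S" and roots: "\<And>f. f \<in> S \<Longrightarrow> poly p (x f) = 0"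
      and monic: "coeff p n = 1" "degree p = n" and le: "n \<le> card S"
  shows "p = (\<Prod>f\<in>S. [:- x f, 1:])"
proof -
  let ?q = "\<Prod>f\<in>S. [:- x f, 1:]"
  have card_le: "card S \<le> degree r" if "r \<noteq> 0" "\<And>f. f \<in> S \<Longrightarrow> poly r (x f) = 0" for r
  proof -
    have "card S = card (x ` S)" using inj by (simp add: card_image)
    also have "\<dots> \<le> card {a. poly r a = 0}" using that poly_roots_finite[of r] by (intro card_mono) auto
    also have "\<dots> \<le> degree r" by (rule card_poly_roots_bound[OF that(1)])
    finally show ?thesis .
  qed
  have "p \<noteq> 0" using monic by auto
  hence n: "n = card S" using card_le[OF _ roots] monic le by simp
  have "p - ?q = 0"
  proof (rule ccontr)
    assume nz: "p - ?q \<noteq> 0"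
    have "poly (p - ?q) (x f) = 0" if "f \<in> S" for f
      using roots[OF that] that S by (auto simp: poly_prod intro!: bexI[of _ f])
    hence "card S \<le> degree (p - ?q)" by (intro card_le nz) auto
    moreover have "coeff (p - ?q) i = 0" if "i \<ge> card S" for i
    proof (cases "i = card S")
      case True
      thus ?thesis using monic n degree_prod_linear[OF S, of x] by simp
    next
      case False
      hence "i > card S" using that by simp
      thus ?thesis using monic n degree_prod_linear(1)[OF S, of x] by (simp add: coeff_eq_0)
    qed
    ultimately have "lead_coeff (p - ?q) = 0" by blast
    thus False using nz leading_coeff_0_iff[of "p - ?q"] by blast
  qed
  thus ?thesis by simp
qed

lemma holomorphic_coeff_prod_linear:
  assumes "finite S" "\<And>f. f \<in> S \<Longrightarrow> f holomorphic_on A"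
  shows "(\<lambda>z. coeff (\<Prod>f\<in>S. [:- f z, 1:]) i) holomorphic_on A"
  using assms
proof (induction S arbitrary: i rule: finite_induct)
  case (insert f S)
  have "(\<lambda>z. (if i = 0 then 0 else coeff (\<Prod>f\<in>S. [:- f z, 1:]) (i - 1)) - f z * coeff (\<Prod>f\<in>S. [:- f z, 1:]) i) holomorphic_on A"
    by (cases "i = 0") (use insert in \<open>auto intro!: holomorphic_intros\<close>)
  thus ?case using insert.hyps by (simp add: coeff_linear_mult del: mult_pCons_left)
qed auto

lemma poly_fun_apply: "poly P f z = poly (map_poly (\<lambda>c. c z) P) (f z)"
  for P :: "(complex \<Rightarrow> complex) poly"
  by (induction P) (auto simp: map_poly_pCons)

text \<open>
  The polynomial \<open>\<Phi>(X, j(z))\<close> over the complex numbers.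
\<close>

definition specialize :: "int poly poly \<Rightarrow> complex \<Rightarrow> complex poly" where
  "specialize \<Phi> z = map_poly (\<lambda>a. poly (map_poly of_int a) (modular_j z)) \<Phi>"

lemma coeff_specialize: "coeff (specialize \<Phi> z) i = poly (map_poly of_int (coeff \<Phi> i)) (modular_j z)"
  by (simp add: specialize_def coeff_map_poly)

lemma coeff_subst_Y: "coeff (subst_Y \<Phi> g) i = (\<lambda>z. poly (map_poly of_int (coeff \<Phi> i)) (g z))"
  unfolding subst_Y_def by (subst coeff_map_poly) auto

lemma poly_subst_Y: "poly (subst_Y \<Phi> modular_j) f z = poly (specialize \<Phi> z) (f z)"
proof -
  have "map_poly (\<lambda>c. c z) (subst_Y \<Phi> modular_j) = specialize \<Phi> z"
    by (rule poly_eqI) (simp add: coeff_map_poly coeff_subst_Y coeff_specialize)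
  thus ?thesis by (simp add: poly_fun_apply)
qed

lemma vanishes_everywhere:
  assumes hol: "g holomorphic_on upper_half_plane" and ev: "\<forall>\<^sub>\<approx>z\<in>upper_half_plane. g z = 0" and z: "Im z > 0"
  shows "g z = 0"
proof -
  have zH: "z \<in> upper_half_plane" using z by (simp add: upper_half_plane_def)
  have "\<forall>\<^sub>F w in at z. g w = 0"
    using ev zH by (simp add: eventually_cosparse_open_eq[OF open_upper_half_plane])
  hence "(g \<longlongrightarrow> 0) (at z)" by (rule tendsto_eventually)
  moreover have "isCont g z"
    using holomorphic_on_imp_continuous_on[OF hol] zH by (simp add: continuous_on_eq_continuous_at open_upper_half_plane)
  hence "(g \<longlongrightarrow> g z) (at z)" by (simp add: isCont_def)
  ultimately show ?thesis by (metis LIM_unique)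
qed

text \<open>
  The functions are 0 outside the upper half plane, so that equality of two elements of \<open>S\<close> means equality on
  it; composition with \<open>g\<close> is then an injection of the finite set \<open>S\<close> into itself.
\<close>

lemma prod_linear_reindex:
  fixes g :: "complex \<Rightarrow> complex" and S :: "(complex \<Rightarrow> complex) set"
  assumes S: "finite S" and g: "\<And>z. Im z > 0 \<Longrightarrow> \<exists>w. Im w > 0 \<and> g w = z"
      and zero: "\<And>f z. f \<in> S \<Longrightarrow> \<not> Im z > 0 \<Longrightarrow> f z = 0"
      and stable: "\<And>f. f \<in> S \<Longrightarrow> (\<lambda>z. if Im z > 0 then f (g z) else 0) \<in> S"
      and z: "Im z > 0"
  shows "(\<Prod>f\<in>S. [:- f (g z), 1:]) = (\<Prod>f\<in>S. [:- f z, 1:])"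
proof -
  define A where "A = (\<lambda>f z. if Im z > 0 then f (g z) else (0::complex))"
  have "inj_on A S"
  proof (rule inj_onI, rule ext)
    fix f f' w assume f: "f \<in> S" "f' \<in> S" "A f = A f'"
    show "f w = f' w"
    proof (cases "Im w > 0")
      case True
      then obtain v where "Im v > 0" "g v = w" using g by blast
      thus ?thesis using fun_cong[OF f(3), of v] by (simp add: A_def)
    next
      case False
      thus ?thesis using zero[OF f(1) False] zero[OF f(2) False] by simp
    qed
  qed
  hence "bij_betw A S S"
    using stable by (intro bij_betw_imageI endo_inj_surj S) (auto simp: A_def)
  from prod.reindex_bij_betw[OF this, of "\<lambda>f. [:- f z, 1:]"] show ?thesis
    using z by (simp add: A_def)
qed

lemma modular_j_growth:
  obtains K where "K \<ge> 0" "\<And>z. Im z \<ge> 1 \<Longrightarrow> cmod (modular_j z) \<le> K * exp (2 * pi * Im z)"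
proof -
  obtain J where J: "J holomorphic_on ball 0 1" "J 0 \<noteq> 0" "\<And>z. Im z > 0 \<Longrightarrow> modular_j z * qexp z = J (qexp z)"
    by (rule modular_j_cusp, rule that, assumption, assumption, blast)
  have "cusp_order 0 (\<lambda>z. modular_j z * qexp z)" unfolding cusp_order_def using J by auto
  then obtain K where K: "K \<ge> 0" "\<And>z. Im z \<ge> 1 \<Longrightarrow> cmod (modular_j z * qexp z) \<le> K * exp (- 2 * pi * real 0 * Im z)"
    by (rule cusp_order_bound[of _ _ 1]) auto
  have "cmod (modular_j z) \<le> K * exp (2 * pi * Im z)" if "Im z \<ge> 1" for z
  proof -
    have "cmod (modular_j z) * exp (- (2 * pi * Im z)) \<le> K" using K(2)[OF that] by (simp add: norm_mult norm_qexp)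
    hence "cmod (modular_j z) * exp (- (2 * pi * Im z)) * exp (2 * pi * Im z) \<le> K * exp (2 * pi * Im z)"
      by (intro mult_right_mono) auto
    thus ?thesis by (simp add: mult.assoc flip: exp_add)
  qed
  with K(1) that show thesis by blast
qed

lemma holomorphic_lat_j:
  assumes "m > 0" "L \<in> cyc_lattices m"
  shows "lat_j L holomorphic_on upper_half_plane"
proof -
  have "(\<lambda>z. modular_j (cyc_point m L z)) holomorphic_on upper_half_plane"
    by (rule holomorphic_on_compose_gen[OF holomorphic_cyc_point modular_j_holomorphic, unfolded o_def])
       (use cyc_lattice_facts(2,5)[OF assms] in \<open>auto simp: upper_half_plane_def\<close>)
  thus ?thesis by (rule holomorphic_transform) (simp add: cyc_lattice_facts(7)[OF assms])
qed

lemma lat_j_isogeny: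
  assumes m: "m > 0"
  shows "cyc_lattice m 0 1 \<in> cyc_lattices m" "lat_j (cyc_lattice m 0 1) z = modular_j (of_nat m * z)"
proof -
  show "cyc_lattice m 0 1 \<in> cyc_lattices m"
    unfolding cyc_lattices_def mem_Collect_eq by (intro exI[of _ 0] exI[of _ 1] conjI refl) simp
  have eq: "cyc_lattice m 0 1 = hnf_lattice (m, 0, 1)"
    by (auto simp: cyc_lattice_def hnf_lattice_def dvd_def mult.commute)
  show "lat_j (cyc_lattice m 0 1) z = modular_j (of_nat m * z)"
    unfolding eq lat_j_def lat_disc_def lat_sum_hnf[OF m zero_less_one]
    by (simp add: modular_j_eq disc_def hnf_point_def)
qed

text \<open>
  Let \<open>S\<close> consist of those functions \<open>z \<mapsto> j(L)\<close>, with \<open>L\<close> a sublattice of the lattice of \<open>z\<close> with cyclic quotient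
  of order \<open>m\<close>, that are roots of \<open>\<Phi>(X, j(z))\<close> for all \<open>z\<close>. It contains \<open>j(m * z)\<close> and is stable under the
  modular group, because \<open>\<Phi>(X, j(z))\<close> is invariant. So the coefficients of the product \<open>e\<close> of all \<open>X - f(z)\<close>
  with \<open>f \<in> S\<close> are invariant functions with at most a pole at the cusp, that is, polynomials in \<open>j\<close>. Minimality
  bounds the degree of \<open>\<Phi>\<close> in \<open>X\<close> by that of \<open>e\<close>. Conversely all elements of \<open>S\<close> are roots of \<open>\<Phi>(X, j(z))\<close>,
  and they take distinct values at almost every \<open>z\<close>. Hence the two polynomials agree, and the coefficients of \<open>e\<close>
  are bounded by the product of all \<open>1 + \<bar>f(z)\<bar>\<close>.
\<close>

lemma coeff_modular_polynomial_le:
  assumes m: "m > 0" and \<Phi>: "is_modular_polynomial m \<Phi>" and z0: "Im z0 > 0"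
  shows "cmod (poly (map_poly of_int (coeff \<Phi> i)) (modular_j z0)) \<le> (\<Prod>L\<in>cyc_lattices m. 1 + cmod (lat_j L z0))"
proof -
  define C where "C = cyc_lattices m"
  have finC: "finite C" unfolding C_def by (rule finite_cyc_lattices[OF m])
  define P where "P = subst_Y \<Phi> modular_j"
  define n where "n = degree P"
  have lead: "coeff P n = 1" and van: "vanishes_at P (\<lambda>z. modular_j (of_nat m * z))"
    and min: "\<And>Q. \<lbrakk>\<And>i. coeff Q i \<in> field_of_j; lead_coeff Q = 1; vanishes_at Q (\<lambda>z. modular_j (of_nat m * z))\<rbrakk> \<Longrightarrow> n \<le> degree Q"
    using \<Phi> by (auto simp: is_modular_polynomial_def is_minimal_polynomial_def P_def n_def)
  have spec_coeff: "coeff (specialize \<Phi> z) i = coeff P i z" for z i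
    by (simp add: coeff_specialize P_def coeff_subst_Y)
  have spec_monic: "coeff (specialize \<Phi> z) n = 1" for z by (simp add: spec_coeff lead)
  have spec_deg: "degree (specialize \<Phi> z) = n" for z
  proof (rule antisym)
    show "degree (specialize \<Phi> z) \<le> n"
      by (rule degree_le) (auto simp: spec_coeff n_def coeff_eq_0)
    show "n \<le> degree (specialize \<Phi> z)" by (rule le_degree) (simp add: spec_monic)
  qed
  have spec_inv: "specialize \<Phi> (z + 1) = specialize \<Phi> z" "Im z > 0 \<Longrightarrow> specialize \<Phi> (- (1 / z)) = specialize \<Phi> z" for z
    by (simp_all add: specialize_def modular_j_plus1 modular_j_inversion)
  have hol_a: "(\<lambda>z. coeff (specialize \<Phi> z) i) holomorphic_on upper_half_plane" for i
    unfolding coeff_specialize by (intro holomorphic_intros modular_j_holomorphic)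
  define F where "F = (\<lambda>L z. if Im z > 0 then lat_j L z else 0)"
  define S where "S = {f. \<exists>L\<in>C. f = F L \<and> (\<forall>z. Im z > 0 \<longrightarrow> poly (specialize \<Phi> z) (F L z) = 0)}"
  have S_sub: "S \<subseteq> F ` C" by (auto simp: S_def)
  have finS: "finite S" using S_sub finC by (meson finite_imageI finite_subset)
  have S_zero: "f z = 0" if "f \<in> S" "\<not> Im z > 0" for f z using that by (auto simp: S_def F_def)
  have S_root: "poly (specialize \<Phi> z) (f z) = 0" if "f \<in> S" "Im z > 0" for f z using that by (auto simp: S_def)
  have hol_F: "F L holomorphic_on upper_half_plane" if "L \<in> C" for L
    by (rule holomorphic_transform[OF holomorphic_lat_j[OF m]])
       (use that in \<open>auto simp: C_def F_def upper_half_plane_def\<close>)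
  have hol_S: "f holomorphic_on upper_half_plane" if "f \<in> S" for f using that hol_F by (auto simp: S_def)
  have stable_T: "(\<lambda>z. if Im z > 0 then f (z + 1) else 0) \<in> S" if f: "f \<in> S" for f
  proof -
    obtain L where L: "L \<in> C" "f = F L" using f by (auto simp: S_def)
    have eq: "(\<lambda>z. if Im z > 0 then f (z + 1) else 0) = F (mapT ` L)"
      by (rule ext) (simp add: L F_def lat_j_plus1)
    have "poly (specialize \<Phi> z) (F (mapT ` L) z) = 0" if z: "Im z > 0" for z
      using S_root[OF f, of "z + 1"] z by (simp add: spec_inv flip: eq)
    thus ?thesis unfolding S_def eq using mapT_cyc_lattices L(1) by (auto simp: C_def)
  qed
  have stable_S: "(\<lambda>z. if Im z > 0 then f (- (1 / z)) else 0) \<in> S" if f: "f \<in> S" for f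
  proof -
    obtain L where L: "L \<in> C" "f = F L" using f by (auto simp: S_def)
    have eq: "(\<lambda>z. if Im z > 0 then f (- (1 / z)) else 0) = F (mapS ` L)"
    proof (rule ext)
      fix z :: complex
      have "Im z > 0 \<Longrightarrow> z \<noteq> 0" by auto
      thus "(if Im z > 0 then f (- (1 / z)) else 0) = F (mapS ` L) z"
        using Im_inversion_pos[of z] lat_j_inversion[of z L] by (auto simp: L F_def)
    qed
    have "poly (specialize \<Phi> z) (F (mapS ` L) z) = 0" if z: "Im z > 0" for z
      using S_root[OF f Im_inversion_pos[OF z]] z spec_inv(2)[OF z] by (simp flip: eq)
    thus ?thesis unfolding S_def eq using mapS_cyc_lattices L(1) by (auto simp: C_def)
  qed
  define e where "e = (\<lambda>z. \<Prod>f\<in>S. [:- f z, 1:])"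
  define r where "r = card S"
  have e_deg: "degree (e z) = r" "coeff (e z) r = 1" for z
    using degree_prod_linear[OF finS, of "\<lambda>f. f z"] by (auto simp: e_def r_def)
  have e_plus: "e (z + 1) = e z" if "Im z > 0" for z
    unfolding e_def
  proof (rule prod_linear_reindex[where g = "\<lambda>z. z + 1" and S = S])
    show "\<exists>v. Im v > 0 \<and> v + 1 = w" if "Im w > 0" for w
      using that by (intro exI[of _ "w - 1"]) auto
  qed (fact finS S_zero stable_T that)+
  have e_inv: "e (- (1 / z)) = e z" if "Im z > 0" for z
    unfolding e_def
  proof (rule prod_linear_reindex[where g = "\<lambda>z. - (1 / z)" and S = S])
    show "\<exists>v. Im v > 0 \<and> - (1 / v) = w" if "Im w > 0" for w
      using that Im_inversion_pos[of w] by (intro exI[of _ "- (1 / w)"]) auto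
  qed (fact finS S_zero stable_S that)+
  have hol_e: "(\<lambda>z. coeff (e z) i) holomorphic_on upper_half_plane" for i
    unfolding e_def by (rule holomorphic_coeff_prod_linear[OF finS hol_S])
  have e_bound: "cmod (coeff (e z) i) \<le> (\<Prod>f\<in>S. 1 + cmod (f z))" for z i
    unfolding e_def by (rule norm_coeff_prod_linear_le[OF finS])
  obtain K where K: "K \<ge> 0" "\<And>z. Im z \<ge> 1 \<Longrightarrow> cmod (modular_j z) \<le> K * exp (2 * pi * Im z)"
    by (rule modular_j_growth, rule that, assumption, blast)
  have F_bound: "1 + cmod (f z) \<le> (1 + K) * exp (2 * pi * real m * Im z)" if f: "f \<in> S" and z: "Im z \<ge> real m" for f z
  proof -
    obtain L where L: "L \<in> C" "f = F L" using f by (auto simp: S_def)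
    note facts = cyc_lattice_facts[OF m L(1)[unfolded C_def]]
    have z0: "Im z > 0" using z m by (auto intro: less_le_trans[of 0 "real m"])
    have "1 / real m * real m \<le> cyc_ratio m L * Im z" using facts z by (intro mult_mono) auto
    hence "1 \<le> Im (cyc_point m L z)" using m facts(5) by simp
    from K(2)[OF this] have "cmod (f z) \<le> K * exp (2 * pi * (cyc_ratio m L * Im z))"
      using z0 facts(5,7) by (simp add: L F_def)
    also have "\<dots> \<le> K * exp (2 * pi * (real m * Im z))"
      using facts(3) z0 K(1) by (intro mult_left_mono) auto
    finally have "cmod (f z) \<le> K * exp (2 * pi * (real m * Im z))" .
    moreover have "1 \<le> exp (2 * pi * (real m * Im z))" using z0 by simp
    moreover have "2 * pi * real m * Im z = 2 * pi * (real m * Im z)" by simp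
    ultimately show ?thesis unfolding distrib_right by (simp only: mult_1_left)
  qed
  have "\<exists>A. \<forall>z. Im z > 0 \<longrightarrow> coeff (e z) i = poly A (modular_j z)" for i
  proof (rule invariant_is_poly[of _ "m * r"])
    show "coeff (e (- (1 / z))) i = coeff (e z) i" if "Im z > 0" for z using e_inv[OF that] by simp
    show "cusp_order 0 (\<lambda>z. coeff (e z) i * qexp z ^ (m * r))"
    proof (rule cusp_orderI[of _ "real m" "(1 + K) ^ r"])
      show "(\<lambda>z. coeff (e z) i * qexp z ^ (m * r)) holomorphic_on upper_half_plane"
        by (intro holomorphic_intros hol_e)
      show "coeff (e (z + 1)) i * qexp (z + 1) ^ (m * r) = coeff (e z) i * qexp z ^ (m * r)" if "Im z > 0" for z
        using e_plus[OF that] by simp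
      fix z assume z: "Im z > 0" "Im z \<ge> real m"
      have "cmod (coeff (e z) i) \<le> (\<Prod>f\<in>S. (1 + K) * exp (2 * pi * real m * Im z))"
        by (rule order_trans[OF e_bound prod_mono]) (use F_bound z(2) in auto)
      also have "\<dots> = (1 + K) ^ r * exp (2 * pi * real m * Im z) ^ r" by (simp add: r_def power_mult_distrib)
      finally have 1: "cmod (coeff (e z) i) \<le> (1 + K) ^ r * exp (2 * pi * real m * Im z) ^ r" .
      have "cmod (coeff (e z) i * qexp z ^ (m * r)) = cmod (coeff (e z) i) * exp (- (2 * pi * real m * Im z)) ^ r"
        by (simp add: norm_mult norm_power norm_qexp power_mult exp_of_nat_mult[symmetric] mult_ac)
      also have "\<dots> \<le> (1 + K) ^ r * exp (2 * pi * real m * Im z) ^ r * exp (- (2 * pi * real m * Im z)) ^ r"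
        using 1 by (intro mult_right_mono) auto
      also have "\<dots> = (1 + K) ^ r * (exp (2 * pi * real m * Im z) * exp (- (2 * pi * real m * Im z))) ^ r"
        by (simp only: power_mult_distrib mult.assoc)
      also have "exp (2 * pi * real m * Im z) * exp (- (2 * pi * real m * Im z)) = 1" by (simp flip: exp_add)
      finally show "cmod (coeff (e z) i * qexp z ^ (m * r)) \<le> (1 + K) ^ r * exp (- 2 * pi * real 0 * Im z)" by simp
    qed
  qed
  then obtain A where A: "\<And>i z. Im z > 0 \<Longrightarrow> coeff (e z) i = poly (A i) (modular_j z)" by metis
  \<comment> \<open>The product \<open>e\<close> as a competitor in the definition of the minimal polynomial.\<close>
  define Q :: "(complex \<Rightarrow> complex) poly" where
    "Q = (\<Sum>i<r. monom (\<lambda>z. poly (A i) (modular_j z)) i) + monom 1 r"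
  have Q_coeff: "coeff Q i = (if i < r then (\<lambda>z. poly (A i) (modular_j z)) else if i = r then 1 else 0)" for i
    by (auto simp: Q_def coeff_sum)
  have Q_deg: "degree Q = r"
  proof (rule antisym)
    show "degree Q \<le> r" by (rule degree_le) (auto simp: Q_coeff)
    show "r \<le> degree Q" by (rule le_degree) (simp add: Q_coeff)
  qed
  have Q_eval: "map_poly (\<lambda>c. c z) Q = e z" if "Im z > 0" for z
  proof (rule poly_eqI)
    fix i
    show "coeff (map_poly (\<lambda>c. c z) Q) i = coeff (e z) i"
      using e_deg[of z] A[OF that, of i] by (cases i r rule: linorder_cases) (auto simp: coeff_map_poly Q_coeff coeff_eq_0)
  qed
  have mz: "Im (of_nat m * z) > 0" if "Im z > 0" for z using that m by simp
  have in_S: "F (cyc_lattice m 0 1) \<in> S"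
  proof -
    have hol_mz: "(\<lambda>z. modular_j (of_nat m * z)) holomorphic_on upper_half_plane"
      by (rule holomorphic_on_compose_gen[OF _ modular_j_holomorphic, unfolded o_def, of "\<lambda>z. of_nat m * z"])
         (use mz in \<open>auto intro!: holomorphic_intros simp: upper_half_plane_def\<close>)
    have "poly (specialize \<Phi> z) (modular_j (of_nat m * z)) = 0" if "Im z > 0" for z
    proof (rule vanishes_everywhere[OF _ _ that])
      show "(\<lambda>z. poly (specialize \<Phi> z) (modular_j (of_nat m * z))) holomorphic_on upper_half_plane"
        unfolding poly_altdef spec_deg by (intro holomorphic_intros hol_a hol_mz)
      show "\<forall>\<^sub>\<approx>z\<in>upper_half_plane. poly (specialize \<Phi> z) (modular_j (of_nat m * z)) = 0"
        using van unfolding vanishes_at_def P_def poly_subst_Y .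
    qed
    thus ?thesis using lat_j_isogeny[OF m] by (auto simp: S_def C_def F_def)
  qed
  have n_le: "n \<le> r" unfolding Q_deg[symmetric]
  proof (rule min)
    show "lead_coeff Q = 1" by (simp add: Q_deg Q_coeff)
    show "coeff Q i \<in> field_of_j" for i
    proof -
      have in_field: "(\<lambda>z. poly B (modular_j z)) \<in> field_of_j" for B
        unfolding field_of_j_def mem_Collect_eq
        by (rule exI[of _ B], rule exI[of _ 1]) (simp add: fun_eq_iff)
      have "(1 :: complex \<Rightarrow> complex) = (\<lambda>z. poly 1 (modular_j z))" by (simp add: fun_eq_iff)
      hence "1 \<in> field_of_j" by (rule ssubst) (rule in_field)
      moreover have "(0 :: complex \<Rightarrow> complex) = (\<lambda>z. poly 0 (modular_j z))" by (simp add: fun_eq_iff)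
      hence "0 \<in> field_of_j" by (rule ssubst) (rule in_field)
      ultimately show ?thesis using in_field by (simp add: Q_coeff)
    qed
    have "poly Q (\<lambda>z. modular_j (of_nat m * z)) z = 0" if "Im z > 0" for z
    proof -
      have "poly (e z) (F (cyc_lattice m 0 1) z) = 0"
        using in_S finS by (auto simp: e_def poly_prod intro!: bexI[of _ "F (cyc_lattice m 0 1)"])
      thus ?thesis using that lat_j_isogeny(2)[OF m, of z] by (simp add: poly_fun_apply Q_eval F_def)
    qed
    thus "vanishes_at Q (\<lambda>z. modular_j (of_nat m * z))"
      unfolding vanishes_at_def eventually_cosparse_open_eq[OF open_upper_half_plane]
      by (auto intro!: eventually_at_in_open'[THEN eventually_mono, OF open_upper_half_plane] simp: upper_half_plane_def)
  qed
  have "\<forall>\<^sub>\<approx>z\<in>upper_half_plane. \<forall>p\<in>S \<times> S. fst p \<noteq> snd p \<longrightarrow> fst p z \<noteq> snd p z"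
    unfolding eventually_cosparse_open_eq[OF open_upper_half_plane]
  proof (intro ballI eventually_ball_finite finite_cartesian_product finS)
    fix z p assume z: "z \<in> upper_half_plane" and p: "p \<in> S \<times> S"
    obtain f f' where ff: "p = (f, f')" "f \<in> S" "f' \<in> S" using p by auto
    show "\<forall>\<^sub>F y in at z. fst p \<noteq> snd p \<longrightarrow> fst p y \<noteq> snd p y"
    proof (cases "f = f'")
      case False
      then obtain b where b: "f b \<noteq> f' b" by auto
      have "Im b > 0"
      proof (rule ccontr)
        assume "\<not> Im b > 0"
        thus False using S_zero[OF ff(2)] S_zero[OF ff(3)] b by simp
      qed
      hence "b \<in> upper_half_plane" by (simp add: upper_half_plane_def)
      moreover have "(\<lambda>z. f z - f' z) holomorphic_on upper_half_plane" using hol_S ff by (intro holomorphic_intros) auto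
      ultimately have "\<forall>\<^sub>F w in at z. f w - f' w \<noteq> 0 \<and> w \<in> upper_half_plane"
        using b z open_upper_half_plane connected_upper_half_plane
        by (intro non_zero_neighbour_alt[of _ _ _ b]) auto
      thus ?thesis by eventually_elim (auto simp: ff)
    qed (simp add: ff)
  qed
  hence "\<forall>\<^sub>\<approx>z\<in>upper_half_plane. coeff (specialize \<Phi> z) i - coeff (e z) i = 0"
  proof -
    assume "\<forall>\<^sub>\<approx>z\<in>upper_half_plane. \<forall>p\<in>S \<times> S. fst p \<noteq> snd p \<longrightarrow> fst p z \<noteq> snd p z"
    moreover have "\<forall>\<^sub>\<approx>z\<in>upper_half_plane. z \<in> upper_half_plane"
      by (rule eventually_in_cosparse) (auto simp: open_upper_half_plane)
    ultimately show ?thesis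
    proof eventually_elim
      case (elim z)
      have inj: "inj_on (\<lambda>f. f z) S" using elim(1) by (auto simp: inj_on_def)
      have "specialize \<Phi> z = e z"
        unfolding e_def
        by (rule monic_eq_prod_roots[OF finS inj])
           (use S_root elim(2) spec_monic spec_deg n_le in \<open>auto simp: upper_half_plane_def r_def\<close>)
      thus ?case by simp
    qed
  qed
  hence "coeff (specialize \<Phi> z0) i - coeff (e z0) i = 0"
    by (intro vanishes_everywhere[OF _ _ z0, of "\<lambda>z. coeff (specialize \<Phi> z) i - coeff (e z) i"])
       (auto intro!: holomorphic_intros hol_a hol_e)
  hence "cmod (poly (map_poly of_int (coeff \<Phi> i)) (modular_j z0)) = cmod (coeff (e z0) i)"
    by (simp add: coeff_specialize)
  also have "\<dots> \<le> (\<Prod>f\<in>S. 1 + cmod (f z0))" by (rule e_bound)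
  also have "\<dots> \<le> (\<Prod>L\<in>C. 1 + cmod (F L z0))"
  proof -
    obtain C' where C': "C' \<subseteq> C" "inj_on F C'" "S = F ` C'" using S_sub by (auto simp: subset_image_inj)
    have "(\<Prod>f\<in>S. 1 + cmod (f z0)) = (\<Prod>L\<in>C'. 1 + cmod (F L z0))"
      unfolding C'(3) using C'(2) by (simp add: prod.reindex)
    also have "\<dots> \<le> (\<Prod>L\<in>C. 1 + cmod (F L z0))"
      using finC C'(1) by (intro prod_mono2) auto
    finally show ?thesis .
  qed
  also have "\<dots> = (\<Prod>L\<in>cyc_lattices m. 1 + cmod (lat_j L z0))" using z0 by (simp add: C_def F_def)
  finally show ?thesis .
qed

section \<open>The bound\<close>

text \<open>
  Let \<open>y\<close> be the height of the reduced representative of \<open>z\<close>. Then \<open>1 + \<bar>j\<bar>\<close> is at most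
  \<open>exp 29 * y ^ 6 / disc_norm z\<close>, and since \<open>disc_norm z\<close> is at most \<open>exp (28 - 2 * pi * y) * y ^ 6\<close>, the height \<open>y\<close> is bounded
  linearly in \<open>- l\<close>. Replacing \<open>ln y\<close> by its tangent at \<open>W / 2\<close> makes the bound linear in \<open>l\<close>, so that it can be
  summed over many points of which only the sum of the \<open>l\<close> is known.
\<close>

lemma ln_one_plus_j_le:
  assumes z: "Im z > 0" and W: "W > 0"
  defines "l \<equiv> ln (disc_norm z)"
  shows "ln (1 + cmod (modular_j z)) \<le> 29 - l + 4 / W * (28 - l) + 6 * ln (W / 2) - 6"
proof -
  obtain w where w: "modular_equiv z w" "in_fundamental_domain w" using exists_in_fundamental_domain[OF z] .
  define y where "y = Im w"
  have y: "y > 0" using w(2) by (simp add: in_fundamental_domain_def y_def)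
  have dn: "disc_norm w = disc_norm z" by (rule disc_norm_modular_equiv[OF w(1) z])
  have jw: "modular_j w = modular_j z" by (rule modular_j_modular_equiv[OF w(1) z])
  have dw: "cmod (disc w) > 0" using disc_nonzero[of w] y by (simp add: y_def)
  have dnw: "disc_norm z = cmod (disc w) * y ^ 6" using dn by (simp add: disc_norm_def y_def)
  have pos: "disc_norm z > 0" unfolding dnw using dw y by simp
  have "1 + cmod (modular_j w) = (cmod (disc w) + 1728 * cmod (60 * eisenstein_G 4 w) ^ 3) / cmod (disc w)"
    unfolding modular_j_eq using dw by (simp add: norm_divide norm_mult norm_power add_divide_distrib)
  hence "1 + cmod (modular_j z) = (cmod (disc w) + 1728 * cmod (60 * eisenstein_G 4 w) ^ 3) / cmod (disc w)"
    by (simp only: jw)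
  also have "\<dots> = (cmod (disc w) + 1728 * cmod (60 * eisenstein_G 4 w) ^ 3) * y ^ 6 / disc_norm z"
    unfolding dnw using y by simp
  also have "\<dots> \<le> exp 29 * y ^ 6 / disc_norm z"
    using norm_disc_plus_le[OF w(2)] pos y by (intro divide_right_mono mult_right_mono) auto
  finally have "ln (1 + cmod (modular_j z)) \<le> ln (exp 29 * y ^ 6 / disc_norm z)"
    by (subst ln_le_cancel_iff) (use pos y in \<open>auto simp: add_pos_nonneg\<close>)
  also have "\<dots> = 29 + 6 * ln y - l"
    using pos y by (simp add: l_def ln_mult ln_div ln_realpow)
  finally have 1: "ln (1 + cmod (modular_j z)) \<le> 29 + 6 * ln y - l" .
  have "ln (disc_norm z) \<le> ln (exp (28 - 2 * pi * y) * y ^ 6)"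
    using disc_norm_le_fund[OF w(2)] pos y unfolding dn y_def[symmetric] by (subst ln_le_cancel_iff) auto
  also have "\<dots> = 28 - 2 * pi * y + 6 * ln y" using y by (simp add: ln_mult ln_realpow)
  finally have 2: "l \<le> 28 - 2 * pi * y + 6 * ln y" by (simp add: l_def)
  have "ln (y / 2) \<le> y / 2 - 1" using y by (intro ln_le_minus_one) auto
  moreover have "ln 2 \<le> (2 - 1 :: real)" by (rule ln_le_minus_one) auto
  ultimately have "ln y \<le> y / 2" using y by (simp add: ln_div)
  moreover have "3 * y \<le> pi * y" using pi_gt3 y by (intro mult_right_mono) auto
  ultimately have 3: "y \<le> (28 - l) / 3" using 2 by simp
  have "ln (y / (W / 2)) \<le> y / (W / 2) - 1" using y W by (intro ln_le_minus_one) auto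
  moreover have "ln (y / (W / 2)) = ln y - ln (W / 2)" using y W by (simp add: ln_div ln_mult)
  moreover have "y / (W / 2) = 2 / W * y" by simp
  ultimately have "ln y \<le> 2 / W * y + ln (W / 2) - 1" by linarith
  moreover have "2 / W * y \<le> 2 / W * ((28 - l) / 3)" using 3 W by (intro mult_left_mono) auto
  moreover have "4 / W * (28 - l) = 6 * (2 / W * ((28 - l) / 3))" using W by (simp add: field_simps)
  moreover have "6 * a \<le> e + 6 * c - 6" if "a \<le> b + c - 1" "b \<le> d" "e = 6 * d" for a b c d e :: real
    using that by linarith
  ultimately have "6 * ln y \<le> 4 / W * (28 - l) + 6 * ln (W / 2) - 6" by blast
  with 1 show ?thesis by simp
qed

lemma psi_ge_1:
  assumes "m > 0"
  shows "psi m \<ge> 1"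
proof -
  have "(\<Prod>p\<in>{p. prime p \<and> p dvd m}. 1 + 1 / real p) \<ge> 1" by (intro prod_ge_1) auto
  moreover have "real m \<ge> 1" using assms by simp
  ultimately show ?thesis unfolding psi_def using mult_mono[of 1 "real m" 1] by fastforce
qed

text \<open>
  The preceding bound is summed over the sublattices; the product formula for the discriminants bounds the sum of
  the \<open>l L\<close> from below. The parameter \<open>W\<close> is at least \<open>12 * ln m + 25.2\<close>, so that the linear terms contribute at
  most 3.2 for each sublattice.
\<close>

lemma prod_lat_j_le:
  assumes m: "m > 0" and z: "Im z = 2"
  defines "W \<equiv> 12 * ln (real m) + 2 * ln (psi m) + 25.2"
  shows "(\<Prod>L\<in>cyc_lattices m. 1 + cmod (lat_j L z)) \<le> exp (psi m * (6 * ln (real m) + ln (psi m) + 6 * ln W + 15.7))"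
proof -
  define C where "C = cyc_lattices m"
  define N where "N = card C"
  define M where "M = ln (real m)"
  note facts = cyc_lattice_facts[OF m, folded C_def]
  have M: "M \<ge> 0" using m by (simp add: M_def)
  have lpsi: "ln (psi m) \<ge> 0" using psi_ge_1[OF m] by simp
  have W: "W \<ge> 12 * M + 25.2" using lpsi by (simp add: W_def M_def)
  hence W0: "W > 0" "W \<ge> 1" using M by auto
  define l where "l = (\<lambda>L. ln (disc_norm (cyc_point m L z)))"
  have pos: "Im (cyc_point m L z) > 0" "disc_norm (cyc_point m L z) > 0" if "L \<in> C" for L
  proof -
    show "Im (cyc_point m L z) > 0" using facts(2,5)[OF that] z by simp
    thus "disc_norm (cyc_point m L z) > 0" using disc_nonzero by (simp add: disc_norm_def)
  qed
  have dz: "disc_norm z \<ge> exp 8" by (rule disc_norm_lower[OF z])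
  have "real N * (8 - 6 * M) \<le> (\<Sum>L\<in>C. l L)"
  proof -
    have "exp (8 - 6 * M) \<le> disc_norm z / real m ^ 6"
    proof -
      have "exp (8 - 6 * M) = exp 8 / exp (6 * M)" by (simp add: exp_diff)
      also have "exp (6 * M) = real m ^ 6" using m exp_of_nat_mult[of 6 M] by (simp add: M_def)
      finally show ?thesis using dz by (simp add: divide_right_mono)
    qed
    hence "exp (8 - 6 * M) ^ N \<le> (disc_norm z / real m ^ 6) ^ N" by (intro power_mono) auto
    also have "\<dots> \<le> (\<Prod>L\<in>C. disc_norm (cyc_point m L z))"
      using prod_disc_norm_ge[OF m, of z] z by (simp add: C_def N_def)
    also have "\<dots> = (\<Prod>L\<in>C. exp (l L))" by (rule prod.cong) (use pos in \<open>auto simp: l_def\<close>)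
    also have "\<dots> = exp (\<Sum>L\<in>C. l L)" using finite_cyc_lattices[OF m] by (simp add: exp_sum C_def)
    finally show ?thesis by (simp add: exp_of_nat_mult[symmetric])
  qed
  hence lsum: "- (\<Sum>L\<in>C. l L) \<le> real N * (6 * M - 8)" by (simp add: algebra_simps)
  have "(\<Prod>L\<in>C. 1 + cmod (lat_j L z)) = (\<Prod>L\<in>C. exp (ln (1 + cmod (modular_j (cyc_point m L z)))))"
    by (rule prod.cong) (use facts(7) in \<open>auto simp: add_pos_nonneg\<close>)
  also have "\<dots> = exp (\<Sum>L\<in>C. ln (1 + cmod (modular_j (cyc_point m L z))))"
    using finite_cyc_lattices[OF m] by (simp add: exp_sum C_def)
  also have "(\<Sum>L\<in>C. ln (1 + cmod (modular_j (cyc_point m L z)))) \<le>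
     (\<Sum>L\<in>C. (23 + 112 / W + 6 * ln (W / 2)) - (1 + 4 / W) * l L)"
  proof (rule sum_mono)
    fix L assume "L \<in> C"
    from ln_one_plus_j_le[OF pos(1)[OF this] W0(1)]
    show "ln (1 + cmod (modular_j (cyc_point m L z))) \<le> (23 + 112 / W + 6 * ln (W / 2)) - (1 + 4 / W) * l L"
      by (simp add: l_def algebra_simps)
  qed
  also have "(\<Sum>L\<in>C. (23 + 112 / W + 6 * ln (W / 2)) - (1 + 4 / W) * l L) =
      real N * (23 + 112 / W + 6 * ln (W / 2)) + (1 + 4 / W) * (- (\<Sum>L\<in>C. l L))"
    by (simp add: sum_subtractf N_def sum_distrib_left)
  also have "\<dots> \<le> real N * (23 + 112 / W + 6 * ln (W / 2)) + (1 + 4 / W) * (real N * (6 * M - 8))"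
    using lsum W0 by (intro add_left_mono mult_left_mono) auto
  also have "\<dots> = real N * (15 + 6 * M + 6 * ln (W / 2) + 4 * (20 + 6 * M) / W)"
    by (simp add: algebra_simps add_divide_distrib)
  also have "\<dots> \<le> real N * (6 * M + ln (psi m) + 6 * ln W + 15.7)"
  proof (rule mult_left_mono)
    define X where "X = 4 * (20 + 6 * M) / W"
    have "X \<le> 3.2" unfolding X_def using W W0 M by (simp add: divide_le_eq)
    moreover have "ln (W / 2) \<le> ln W - 2 / 3" using ln2_ge_two_thirds W0 by (simp add: ln_div)
    ultimately show "15 + 6 * M + 6 * ln (W / 2) + 4 * (20 + 6 * M) / W \<le> 6 * M + ln (psi m) + 6 * ln W + 15.7"
      using lpsi unfolding X_def[symmetric] by linarith
  qed auto
  also have "\<dots> \<le> psi m * (6 * M + ln (psi m) + 6 * ln W + 15.7)"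
    using card_cyc_lattices[OF m] M lpsi W0 by (intro mult_right_mono) (auto simp: N_def C_def)
  finally show ?thesis by (simp add: C_def M_def)
qed

theorem corollary4p3:
  fixes m :: nat and \<Phi> :: "int poly poly"
  assumes "m > 0"
    and "is_modular_polynomial m \<Phi>"
  shows "h_inf (map_poly (map_poly of_int) \<Phi>)
         \<le> psi m * (6 * ln (real m) + ln (psi m)
             + 6 * ln (12 * ln (real m) + 2 * ln (psi m) + 25.2) + 15.7)"
proof -
  define B where "B = psi m * (6 * ln (real m) + ln (psi m)
             + 6 * ln (12 * ln (real m) + 2 * ln (psi m) + 25.2) + 15.7)"
  define P :: "complex poly poly" where "P = map_poly (map_poly of_int) \<Phi>"
  have P_coeff: "coeff P s = map_poly of_int (coeff \<Phi> s)" for s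
    by (simp add: P_def coeff_map_poly)
  have le: "cmod (coeff (coeff P s) k) \<le> exp B" for s k
    unfolding P_coeff
  proof (rule poly_in_j_coeff_bound)
    fix z assume "Im z = 2"
    hence "cmod (poly (map_poly of_int (coeff \<Phi> s)) (modular_j z)) \<le> (\<Prod>L\<in>cyc_lattices m. 1 + cmod (lat_j L z))"
      by (intro coeff_modular_polynomial_le assms) auto
    also have "\<dots> \<le> exp B" unfolding B_def by (rule prod_lat_j_le[OF assms(1) \<open>Im z = 2\<close>])
    finally show "cmod (poly (map_poly of_int (coeff \<Phi> s)) (modular_j z)) \<le> exp B" .
  qed
  have psi: "psi m \<ge> 1" by (rule psi_ge_1[OF assms(1)])
  have l: "ln (real m) \<ge> 0" "ln (psi m) \<ge> 0" using psi assms(1) by auto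
  have "ln (12 * ln (real m) + 2 * ln (psi m) + 25.2) \<ge> 0" by (rule ln_ge_zero) (use l in linarith)
  hence "B \<ge> 0" unfolding B_def using psi l by (intro mult_nonneg_nonneg) linarith+
  define X where "X = {cmod (coeff (coeff P s) k) | s k. s \<le> degree P \<and> k \<le> degree (coeff P s)}"
  have "X = (\<Union>s\<in>{..degree P}. (\<lambda>k. cmod (coeff (coeff P s) k)) ` {..degree (coeff P s)})"
    by (auto simp: X_def)
  hence fin: "finite X" by simp
  have ne: "X \<noteq> {}" by (auto simp: X_def)
  obtain s k where sk: "Max X = cmod (coeff (coeff P s) k)" using Max_in[OF fin ne] by (auto simp: X_def)
  have "ln (Max X) \<le> B"
  proof (cases "Max X = 0")
    case False
    hence "Max X > 0" using sk by simp
    hence "ln (Max X) \<le> ln (exp B)" using le[of s k] sk by (subst ln_le_cancel_iff) auto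
    thus ?thesis by simp
  qed (use \<open>B \<ge> 0\<close> in simp)
  thus ?thesis by (simp add: h_inf_def P_def X_def B_def)
qed

end
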